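(* Let $\mathbb{F}$ be a field of positive characteristic $p$, let $\lambda\vdash n$, let $a>1$ be an integer and $b=\lfloor n/p\rfloor$. If $a\le\dim_{\mathbb{F}}M^\lambda$, then $\Lambda^aM^\lambda$ is a projective $\mathbb{F}\mathfrak{S}_n$-module if and only if, for all $1\le i\le b$ and all integers $x,y\ge0$ with $a=x+py$, either $m_{\lambda,i}<x$ or $\overline{m_{\lambda,i}}<py$.
   Context: $n$ is a positive integer. $M^\lambda$ is the Young permutation module: the permutation $\mathbb{F}\mathfrak{S}_n$-module on $\lambda$-tabloids. $\Lambda^a$ is the exterior power with diagonal action. For $1\le i\le b$ let $t_i=\prod_{j=1}^i((j-1)p+1,\ldots,jp)\in\mathfrak{S}_n$ (a product of $i$ disjoint $p$-cycles) and $F_i=\langle t_i\rangle$. Set $m_{\lambda,i}=\dim_{\mathbb{F}}M^\lambda(F_i)$, where for a $p$-subgroup $P$ the Brauer quotient is $M(P)=M^P/\sum_{Q<P}\mathrm{Tr}_Q^P(M^Q)$ with $\mathrm{Tr}_Q^P(v)=\sum_{g\in P/Q}gv$; equivalently $m_{\lambda,i}$ is the number of $\lambda$-tabloids fixed by $F_i$. Set $\overline{m_{\lambda,i}}=\dim_{\mathbb{F}}M^\lambda-m_{\lambda,i}$. *)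

theory Defs
  imports
    "Jordan_Normal_Form.VS_Connect"
    "HOL-Algebra.Sym_Groups"
    "HOL-Algebra.Left_Coset"
    "HOL-Algebra.AbelCoset"
    "HOL-Combinatorics.Cycles"
begin

hide_const (open) Multiset.mult Polynomial.smult Modules.module Modules.module_hom

section \<open>Modules over a group algebra\<close>

text \<open>A (left) module over the group algebra of \<open>G\<close> over a field \<open>'k\<close> is a \<open>'k\<close>-vector space
  with a linear action of \<open>G\<close>.\<close>

record ('k, 'v, 'g) gmodule = "('k, 'v) module" +
  act :: "'g \<Rightarrow> 'v \<Rightarrow> 'v"

locale gmodule = group G + vectorspace "class_ring :: 'k::field ring" V
  for G :: "('g, 'z) monoid_scheme" (structure) and V :: "('k::field, 'v, 'g, 'e) gmodule_scheme" +
  assumes act_hom: "g \<in> carrier G \<Longrightarrow> act V g \<in> module_hom (class_ring :: 'k::field ring) V V"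
    and act_one: "v \<in> carrier V \<Longrightarrow> act V \<one> v = v"
    and act_mult: "g \<in> carrier G \<Longrightarrow> h \<in> carrier G \<Longrightarrow> v \<in> carrier V \<Longrightarrow>
      act V (g \<otimes> h) v = act V g (act V h v)"

definition gmodule_hom ::
  "('g, 'z) monoid_scheme \<Rightarrow> ('k::field, 'v, 'g, 'e) gmodule_scheme \<Rightarrow>
    ('k, 'w, 'g, 'f) gmodule_scheme \<Rightarrow> ('v \<Rightarrow> 'w) set" where
  "gmodule_hom G V W = {f \<in> module_hom (class_ring :: 'k ring) V W.
     \<forall>g\<in>carrier G. \<forall>v\<in>carrier V. f (act V g v) = act W g (f v)}"

text \<open>The permutation module on a \<open>G\<close>-set \<open>B\<close> with action \<open>\<phi>\<close> consists of the finitely supported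
  functions \<open>B \<rightarrow> 'k\<close> (extended by \<open>0\<close>); \<open>point x\<close> is the basis vector \<open>x\<close>, and
  \<open>g\<close> takes \<open>point x\<close> to \<open>point (\<phi> g x)\<close>.\<close>

definition point :: "'b \<Rightarrow> 'b \<Rightarrow> 'k::field" where
  "point x = (\<lambda>y. if y = x then 1 else 0)"

definition permutation_module ::
  "('g, 'z) monoid_scheme \<Rightarrow> 'b set \<Rightarrow> ('g \<Rightarrow> 'b \<Rightarrow> 'b) \<Rightarrow> ('k::field, 'b \<Rightarrow> 'k, 'g) gmodule" where
  "permutation_module G B \<phi> =
    \<lparr>carrier = {f. finite {x. f x \<noteq> 0} \<and> (\<forall>x. x \<notin> B \<longrightarrow> f x = 0)},
     mult = undefined, one = undefined,
     zero = (\<lambda>x. 0), add = (\<lambda>f h x. f x + h x), smult = (\<lambda>c f x. c * f x),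
     act = (\<lambda>g f x. if x \<in> B then f (\<phi> (inv\<^bsub>G\<^esub> g) x) else 0)\<rparr>"

lemma vectorspace_class_ringI:
  fixes V :: "('k::field, 'v, 'g, 'e) gmodule_scheme"
  assumes "module (class_ring :: 'k ring) V" shows "vectorspace (class_ring :: 'k ring) V"
  using assms class_field by (simp add: vectorspace_def)

lemma gmodule_permutation_module:
  fixes G :: "('g, 'z) monoid_scheme" (structure) and B :: "'b set"
  assumes G: "group G"
    and closed: "\<And>g x. g \<in> carrier G \<Longrightarrow> x \<in> B \<Longrightarrow> \<phi> g x \<in> B"
    and one: "\<And>x. x \<in> B \<Longrightarrow> \<phi> \<one>\<^bsub>G\<^esub> x = x"
    and mult: "\<And>g h x. g \<in> carrier G \<Longrightarrow> h \<in> carrier G \<Longrightarrow> x \<in> B \<Longrightarrow>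
      \<phi> (g \<otimes>\<^bsub>G\<^esub> h) x = \<phi> g (\<phi> h x)"
  shows "gmodule G (permutation_module G B \<phi> :: ('k::field, 'b \<Rightarrow> 'k, 'g) gmodule)" (is "gmodule G ?V")
proof -
  interpret group G by fact
  have fin: "finite {x. f x + h x \<noteq> 0}" if "finite {x. f x \<noteq> 0}" "finite {x. h x \<noteq> 0}" for f h :: "'b \<Rightarrow> 'k"
    by (rule finite_subset[OF _ finite_UnI[OF that]]) auto
  have fins: "finite {x. c * f x \<noteq> 0}" if "finite {x. f x \<noteq> 0}" for c and f :: "'b \<Rightarrow> 'k"
    by (rule finite_subset[OF _ that]) auto
  have ab: "abelian_group ?V"
  proof (rule abelian_groupI)
    fix f assume "f \<in> carrier ?V"
    then show "\<exists>y\<in>carrier ?V. y \<oplus>\<^bsub>?V\<^esub> f = \<zero>\<^bsub>?V\<^esub>"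
      by (intro bexI[of _ "\<lambda>x. - f x"]) (auto simp: permutation_module_def)
  qed (auto simp: permutation_module_def fin add_ac)
  have mod: "module (class_ring :: 'k ring) ?V"
    by (rule moduleI[OF _ ab]) (auto simp: permutation_module_def fins distrib_left distrib_right class_ring_simps mult_ac intro: class_cring.cring_axioms)
  have inv_inj: "inj_on (\<phi> (inv g)) B" if "g \<in> carrier G" for g
    by (rule inj_on_inverseI[where g="\<phi> g"]) (use that mult one in \<open>metis inv_closed r_inv\<close>)
  have act_closed: "act ?V g f \<in> carrier ?V" if "g \<in> carrier G" "f \<in> carrier ?V" for g f
  proof -
    have "finite (\<phi> (inv g) -` {x. f x \<noteq> 0} \<inter> B)"
      using that inv_inj by (intro finite_vimage_IntI) (auto simp: permutation_module_def)
    then have "finite {x. x \<in> B \<and> f (\<phi> (inv g) x) \<noteq> 0}"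
      by (rule rev_finite_subset) auto
    moreover have "{x. (if x \<in> B then f (\<phi> (inv g) x) else 0) \<noteq> 0} = {x. x \<in> B \<and> f (\<phi> (inv g) x) \<noteq> 0}" by auto
    ultimately show ?thesis using that by (auto simp: permutation_module_def)
  qed
  show ?thesis
  proof (intro gmodule.intro gmodule_axioms.intro)
    show "vectorspace (class_ring :: 'k ring) ?V" using mod by (rule vectorspace_class_ringI)
    show "act ?V g \<in> module_hom (class_ring :: 'k ring) ?V ?V" if "g \<in> carrier G" for g
      using act_closed[OF that] unfolding LinearCombinations.module_hom_def
      by (auto simp: permutation_module_def class_ring_simps fun_eq_iff)
    show "act ?V \<one> v = v" if "v \<in> carrier ?V" for v
      using that one by (auto simp: permutation_module_def fun_eq_iff)
    show "act ?V (g \<otimes> h) v = act ?V g (act ?V h v)" 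
      if "g \<in> carrier G" "h \<in> carrier G" "v \<in> carrier ?V" for g h v
      using that mult closed by (auto simp: permutation_module_def fun_eq_iff inv_mult_group)
  qed fact
qed

lemma act_permutation_module_point:
  fixes G :: "('g, 'z) monoid_scheme" (structure) and B :: "'b set"
  assumes G: "group G"
    and closed: "\<And>g x. g \<in> carrier G \<Longrightarrow> x \<in> B \<Longrightarrow> \<phi> g x \<in> B"
    and one: "\<And>x. x \<in> B \<Longrightarrow> \<phi> \<one>\<^bsub>G\<^esub> x = x"
    and mult: "\<And>g h x. g \<in> carrier G \<Longrightarrow> h \<in> carrier G \<Longrightarrow> x \<in> B \<Longrightarrow>
      \<phi> (g \<otimes>\<^bsub>G\<^esub> h) x = \<phi> g (\<phi> h x)"
    and g: "g \<in> carrier G" "x \<in> B"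
  shows "act (permutation_module G B \<phi> :: ('k::field, 'b \<Rightarrow> 'k, 'g) gmodule) g (point x) = point (\<phi> g x)"
proof -
  interpret group G by fact
  have "\<phi> (inv g) y = x \<longleftrightarrow> y = \<phi> g x" if "y \<in> B" for y
    using that g mult one closed by (metis inv_closed l_inv r_inv)
  then show ?thesis using g closed
    by (auto simp: permutation_module_def point_def fun_eq_iff)
qed

text \<open>The direct sum of copies of the regular module, indexed by \<open>X\<close>.\<close>

definition free_gmodule ::
  "('g, 'z) monoid_scheme \<Rightarrow> 'x set \<Rightarrow> ('k::field, 'x \<times> 'g \<Rightarrow> 'k, 'g) gmodule" where
  "free_gmodule G X = permutation_module G (X \<times> carrier G) (\<lambda>g (x, h). (x, g \<otimes>\<^bsub>G\<^esub> h))"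

text \<open>Projective means being isomorphic to a direct summand of a free module: \<open>i\<close> embeds \<open>V\<close> and
  \<open>r\<close> projects onto it, with complement the kernel of \<open>r\<close>. Index sets \<open>X\<close> inside the type
  of \<open>V\<close> suffice: \<open>V\<close> is a quotient of the free module on \<open>carrier V\<close>, and
  this quotient map splits as soon as \<open>V\<close> is a direct summand of any free module.\<close>

definition projective_gmodule ::
  "('g, 'z) monoid_scheme \<Rightarrow> ('k::field, 'v, 'g, 'e) gmodule_scheme \<Rightarrow> bool" where
  "projective_gmodule G V \<longleftrightarrow> gmodule G V \<and>
    (\<exists>(X :: 'v set) i r.
      i \<in> gmodule_hom G V (free_gmodule G X) \<and> r \<in> gmodule_hom G (free_gmodule G X) V \<and>
      (\<forall>v\<in>carrier V. r (i v) = v))"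

text \<open>In a quotient, the product of the scalar \<open>c\<close> with a coset \<open>X\<close> of \<open>W\<close> is \<open>W + cX\<close>; the
  summand \<open>W\<close> is needed for \<open>c = 0\<close>.\<close>

definition quotient_gmodule ::
  "('k::field, 'v, 'g, 'e) gmodule_scheme \<Rightarrow> 'v set \<Rightarrow> ('k, 'v set, 'g) gmodule" where
  "quotient_gmodule V W =
    \<lparr>carrier = a_rcosets\<^bsub>V\<^esub> W, mult = undefined, one = undefined,
     zero = W, add = set_add V, smult = (\<lambda>c X. W <+>\<^bsub>V\<^esub> ((\<lambda>v. c \<odot>\<^bsub>V\<^esub> v) ` X)),
     act = (\<lambda>g X. act V g ` X)\<rparr>"

lemma gmodule_quotient_gmodule:
  fixes V :: "('k::field, 'v, 'g, 'e) gmodule_scheme" and G :: "('g, 'z) monoid_scheme" (structure)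
  assumes V: "gmodule G V" and W: "submodule (class_ring :: 'k ring) W V"
    and W_act: "\<And>g w. g \<in> carrier G \<Longrightarrow> w \<in> W \<Longrightarrow> act V g w \<in> W"
  shows "gmodule G (quotient_gmodule V W)" (is "gmodule G ?Q")
proof -
  interpret gmodule G V by fact
  interpret W: submodule "class_ring :: 'k ring" W V by fact
  have cl: "W \<subseteq> carrier V" by (rule W.subset)
  have neg: "\<ominus>\<^bsub>V\<^esub> w \<in> W" if "w \<in> W" for w
  proof -
    have "(- 1 :: 'k) \<odot>\<^bsub>V\<^esub> w = \<ominus>\<^bsub>V\<^esub> w"
      using that cl smult_l_minus[of 1 w] smult_one[of w] by (auto simp: class_ring_simps)
    then show ?thesis using W.smult_closed[of "-1" w] that by auto
  qed
  have sub: "additive_subgroup W V"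
    by (rule additive_subgroup.intro, rule add.subgroupI)
       (use cl neg W.zero_closed in \<open>auto simp: a_inv_def[symmetric] simp del: W.zero_closed\<close>)
  then interpret A: abelian_subgroup W V
    by (intro abelian_subgroupI3) (auto intro: abelian_group_axioms)
  define q where "q v = W +>\<^bsub>V\<^esub> v" for v
  have carr: "carrier ?Q = q ` carrier V"
    by (auto simp: quotient_gmodule_def A_RCOSETS_def' q_def)
  have qadd: "q v \<oplus>\<^bsub>?Q\<^esub> q w = q (v \<oplus>\<^bsub>V\<^esub> w)" if "v \<in> carrier V" "w \<in> carrier V" for v w
    using A.a_rcos_sum[OF that] by (simp add: quotient_gmodule_def q_def)
  have qzero: "\<zero>\<^bsub>?Q\<^esub> = q \<zero>\<^bsub>V\<^esub>"
    using cl a_coset_add_zero by (simp add: quotient_gmodule_def q_def)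
  have qmem: "x \<in> q v \<longleftrightarrow> (\<exists>w\<in>W. x = w \<oplus>\<^bsub>V\<^esub> v)" for x v
    by (auto simp: q_def a_r_coset_def')
  have qsm: "c \<odot>\<^bsub>?Q\<^esub> q v = q (c \<odot>\<^bsub>V\<^esub> v)" if v: "v \<in> carrier V" for c :: 'k and v
  proof (intro subset_antisym subsetI)
    fix x assume "x \<in> c \<odot>\<^bsub>?Q\<^esub> q v"
    then obtain w w' where w: "w \<in> W" "w' \<in> W" "x = w \<oplus>\<^bsub>V\<^esub> c \<odot>\<^bsub>V\<^esub> (w' \<oplus>\<^bsub>V\<^esub> v)"
      by (auto simp: quotient_gmodule_def set_add_def' qmem)
    then have "x = (w \<oplus>\<^bsub>V\<^esub> c \<odot>\<^bsub>V\<^esub> w') \<oplus>\<^bsub>V\<^esub> c \<odot>\<^bsub>V\<^esub> v"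
      using v cl by (auto simp: smult_r_distr a_assoc subset_iff)
    then show "x \<in> q (c \<odot>\<^bsub>V\<^esub> v)" using w by (auto simp: qmem)
  next
    fix x assume "x \<in> q (c \<odot>\<^bsub>V\<^esub> v)"
    then obtain w where w: "w \<in> W" "x = w \<oplus>\<^bsub>V\<^esub> c \<odot>\<^bsub>V\<^esub> v" by (auto simp: qmem)
    moreover have "v \<in> q v" using v by (auto simp: qmem intro!: bexI[of _ "\<zero>\<^bsub>V\<^esub>"])
    ultimately show "x \<in> c \<odot>\<^bsub>?Q\<^esub> q v"
      by (auto simp: quotient_gmodule_def set_add_def')
  qed
  have act_add: "act V g (v \<oplus>\<^bsub>V\<^esub> w) = act V g v \<oplus>\<^bsub>V\<^esub> act V g w"
    and act_sm: "act V g (c \<odot>\<^bsub>V\<^esub> v) = c \<odot>\<^bsub>V\<^esub> act V g v"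
    and act_cl: "act V g v \<in> carrier V"
    if "g \<in> carrier G" "v \<in> carrier V" "w \<in> carrier V" for g v w c
    using act_hom[OF that(1)] that by (auto simp: LinearCombinations.module_hom_def)
  have qact: "act ?Q g (q v) = q (act V g v)" if g: "g \<in> carrier G" and v: "v \<in> carrier V" for g v
  proof (intro subset_antisym subsetI)
    fix x assume "x \<in> act ?Q g (q v)"
    then show "x \<in> q (act V g v)" using g v cl W_act act_add[OF g]
      by (fastforce simp: quotient_gmodule_def qmem subset_iff)
  next
    fix x assume "x \<in> q (act V g v)"
    then obtain w where w: "w \<in> W" "x = w \<oplus>\<^bsub>V\<^esub> act V g v" by (auto simp: qmem)
    have wV: "w \<in> carrier V" using w cl by auto
    have "x = act V g (act V (inv g) w \<oplus>\<^bsub>V\<^esub> v)"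
      using g v w wV act_add[OF g] act_mult[of g "inv g" w] act_one[of w] act_cl[of "inv g" w w] by auto
    moreover have "act V (inv g) w \<oplus>\<^bsub>V\<^esub> v \<in> q v" using W_act g w by (auto simp: qmem)
    ultimately show "x \<in> act ?Q g (q v)" by (auto simp: quotient_gmodule_def)
  qed
  have ab: "abelian_group ?Q"
  proof (rule abelian_groupI)
    fix f assume "f \<in> carrier ?Q"
    then obtain v where "v \<in> carrier V" "f = q v" by (auto simp: carr)
    then show "\<exists>y\<in>carrier ?Q. y \<oplus>\<^bsub>?Q\<^esub> f = \<zero>\<^bsub>?Q\<^esub>"
      by (intro bexI[of _ "q (\<ominus>\<^bsub>V\<^esub> v)"]) (auto simp: carr qadd qzero l_neg)
  qed (auto simp: carr qadd qzero a_assoc a_comm a_lcomm)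
  have mod: "module (class_ring :: 'k ring) ?Q"
    by (rule moduleI[OF _ ab])
       (auto simp: carr qadd qsm smult_r_distr smult_l_distr[simplified] smult_assoc1[simplified]
          smult_one[simplified] class_ring_simps intro: class_cring.cring_axioms)
  show ?thesis
  proof (intro gmodule.intro gmodule_axioms.intro)
    show "vectorspace (class_ring :: 'k ring) ?Q" using mod by (rule vectorspace_class_ringI)
    show "act ?Q g \<in> module_hom (class_ring :: 'k ring) ?Q ?Q" if "g \<in> carrier G" for g
      unfolding LinearCombinations.module_hom_def using that
      by (auto simp: carr qact qadd qsm act_add act_sm act_cl)
    show "act ?Q \<one> v = v" if "v \<in> carrier ?Q" for v
      using that by (auto simp: carr qact act_one)
    show "act ?Q (g \<otimes> h) v = act ?Q g (act ?Q h v)"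
      if "g \<in> carrier G" "h \<in> carrier G" "v \<in> carrier ?Q" for g h v
      using that by (auto simp: carr qact act_mult act_cl)
  qed (rule group_axioms)
qed
section \<open>Exterior powers\<close>

text \<open>The \<open>a\<close>-th exterior power is presented by generators \<open>v\<^sub>1 \<and> \<dots> \<and> v\<^sub>a\<close> (the lists of length \<open>a\<close>
  over \<open>V\<close>) and the relations expressing that this symbol is multilinear and alternating.\<close>

definition tuples :: "nat \<Rightarrow> ('k::field, 'v, 'g, 'e) gmodule_scheme \<Rightarrow> 'v list set" where
  "tuples a V = {vs. length vs = a \<and> set vs \<subseteq> carrier V}"

definition exterior_relations ::
  "nat \<Rightarrow> ('k::field, 'v, 'g, 'e) gmodule_scheme \<Rightarrow> ('v list \<Rightarrow> 'k) set" where
  "exterior_relations a V =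
    {(\<lambda>x. point (us @ (v \<oplus>\<^bsub>V\<^esub> w) # ws) x - point (us @ v # ws) x - point (us @ w # ws) x) | us v w ws.
       us @ v # ws \<in> tuples a V \<and> us @ w # ws \<in> tuples a V} \<union>
    {(\<lambda>x. point (us @ (c \<odot>\<^bsub>V\<^esub> v) # ws) x - c * point (us @ v # ws) x) | us c v ws.
       us @ v # ws \<in> tuples a V} \<union>
    {point (us @ v # vs @ v # ws) | us v vs ws. us @ v # vs @ v # ws \<in> tuples a V}"

definition exterior_power ::
  "('g, 'z) monoid_scheme \<Rightarrow> nat \<Rightarrow> ('k::field, 'v, 'g, 'e) gmodule_scheme \<Rightarrow>
    ('k, ('v list \<Rightarrow> 'k) set, 'g) gmodule" where
  "exterior_power G a V =
    (let F = permutation_module G (tuples a V) (\<lambda>g. map (act V g))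
     in quotient_gmodule F (LinearCombinations.module.span (class_ring :: 'k ring) F (exterior_relations a V)))"

section \<open>Brauer quotients\<close>

definition fixed_points :: "('k::field, 'v, 'g, 'e) gmodule_scheme \<Rightarrow> 'g set \<Rightarrow> 'v set" where
  "fixed_points V P = {v \<in> carrier V. \<forall>g\<in>P. act V g v = v}"

definition relative_trace ::
  "('g, 'z) monoid_scheme \<Rightarrow> ('k::field, 'v, 'g, 'e) gmodule_scheme \<Rightarrow>
    'g set \<Rightarrow> 'g set \<Rightarrow> 'v \<Rightarrow> 'v" where
  "relative_trace G V Q P v =
    finsum V (\<lambda>C. act V (SOME g. g \<in> C) v) (lcosets\<^bsub>G\<lparr>carrier := P\<rparr>\<^esub> Q)"

text \<open>Only elements normalising \<open>P\<close> act on the Brauer quotient.\<close>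

definition brauer_quotient ::
  "('g, 'z) monoid_scheme \<Rightarrow> ('k::field, 'v, 'g, 'e) gmodule_scheme \<Rightarrow> 'g set \<Rightarrow>
    ('k, 'v set, 'g) gmodule" where
  "brauer_quotient G V P =
    quotient_gmodule (V\<lparr>carrier := fixed_points V P\<rparr>)
      (LinearCombinations.module.span (class_ring :: 'k ring) V
        (\<Union>Q\<in>{Q. subgroup Q G \<and> Q \<subset> P}. relative_trace G V Q P ` fixed_points V Q))"

section \<open>Young permutation modules\<close>

definition is_partition :: "nat list \<Rightarrow> nat \<Rightarrow> bool" where
  "is_partition lam n \<longleftrightarrow> sorted_wrt (\<ge>) lam \<and> 0 \<notin> set lam \<and> sum_list lam = n"

text \<open>Rows and columns of a Young diagram are numbered from \<open>0\<close>.\<close>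

definition young_row :: "nat list \<Rightarrow> nat \<Rightarrow> (nat \<times> nat) set" where
  "young_row lam i = {(i, j) | j. j < lam ! i}"

definition young_diagram :: "nat list \<Rightarrow> (nat \<times> nat) set" where
  "young_diagram lam = (\<Union>i<length lam. young_row lam i)"

definition tableaux :: "nat \<Rightarrow> nat list \<Rightarrow> (nat \<times> nat \<Rightarrow> nat) set" where
  "tableaux n lam =
    {t \<in> extensional (young_diagram lam). bij_betw t (young_diagram lam) {1..n}}"

definition row_equiv ::
  "nat \<Rightarrow> nat list \<Rightarrow> ((nat \<times> nat \<Rightarrow> nat) \<times> (nat \<times> nat \<Rightarrow> nat)) set" where
  "row_equiv n lam = {(s, t). s \<in> tableaux n lam \<and> t \<in> tableaux n lam \<and>
     (\<forall>i<length lam. s ` young_row lam i = t ` young_row lam i)}"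

definition tabloids :: "nat \<Rightarrow> nat list \<Rightarrow> (nat \<times> nat \<Rightarrow> nat) set set" where
  "tabloids n lam = tableaux n lam // row_equiv n lam"

definition tabloid_act ::
  "nat list \<Rightarrow> (nat \<Rightarrow> nat) \<Rightarrow> (nat \<times> nat \<Rightarrow> nat) set \<Rightarrow> (nat \<times> nat \<Rightarrow> nat) set" where
  "tabloid_act lam \<sigma> T = compose (young_diagram lam) \<sigma> ` T"

type_synonym 'k young_module = "('k, (nat \<times> nat \<Rightarrow> nat) set \<Rightarrow> 'k, nat \<Rightarrow> nat) gmodule"

definition young_permutation_module :: "nat \<Rightarrow> nat list \<Rightarrow> 'k::field young_module" where
  "young_permutation_module n lam =
    permutation_module (sym_group n) (tabloids n lam) (tabloid_act lam)"

section \<open>Products of disjoint \<open>p\<close>-cycles\<close>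

text \<open>\<open>p_cycles p i\<close> is the product of the cycles \<open>((j - 1)p + 1, \<dots>, jp)\<close> for \<open>1 \<le> j \<le> i\<close>.\<close>

primrec p_cycles :: "nat \<Rightarrow> nat \<Rightarrow> nat \<Rightarrow> nat" where
  "p_cycles p 0 = id"
| "p_cycles p (Suc i) = p_cycles p i \<circ> cycle_of_list [i * p + 1..<Suc i * p + 1]"

definition p_cycle_group :: "nat \<Rightarrow> nat \<Rightarrow> nat \<Rightarrow> (nat \<Rightarrow> nat) set" where
  "p_cycle_group n p i = generate (sym_group n) {p_cycles p i}"

end

theory Submission
  imports Defs "HOL-Algebra.Sylow" "HOL-Algebra.Multiplicative_Group"
begin

hide_const (open) Multiset.mult Polynomial.smult Polynomial.order Modules.module Modules.module_hom

text \<open>The exterior power of a permutation module on \<open>\<Omega>\<close> has a basis indexed by the \<open>a\<close>-subsets of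
  \<open>\<Omega>\<close>, which the group permutes up to signs. In characteristic \<open>p\<close> such a monomial module is
  projective iff no element of order \<open>p\<close> fixes an index. If one does, the sign is \<open>1\<close>, so that the
  basis element \<open>e\<close> is invariant and its coordinate function \<open>D\<close> is an invariant functional; but
  an invariant functional vanishes on an invariant vector of a free module, its value being a sum over orbits
  of size \<open>p\<close>, which contradicts \<open>D e = 1\<close>. If none does, all stabilisers have order prime to
  \<open>p\<close>, and Higman's criterion applies.

  In the symmetric group an element of order \<open>p\<close> is conjugate to some \<open>t\<^sub>i\<close>, and \<open>t\<^sub>i\<close> fixes an
  \<open>a\<close>-subset of \<open>\<Omega>\<close> iff \<open>a\<close> is the size of a union of some of the \<open>m\<^sub>i\<close> fixed points and
  some of the orbits of size \<open>p\<close> in the complement.\<close>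

section \<open>Permutations of prime period\<close>

text \<open>The exterior power is given by generators and relations only, so its basis has to be
  proved: minors of coefficient matrices kill the relations and tell the \<open>a\<close>-subsets
  apart, and modulo the relations every generator equals its expansion by minors. The delicate point
  is the sign attached to reordering a subset. It is never computed: the projectivity criterion is
  stated for any module in which the coefficients of \<open>act V g (e x)\<close> vanish away from
  the index \<open>\<phi> g x\<close>, and at a fixed index the unknown scalar is a
  \<open>p\<close>th root of unity, for \<open>p = 2\<close> and odd \<open>p\<close> alike. A
  second gap is that \<open>m i\<close> is the dimension of a Brauer quotient, not a number of fixed
  points. In a group of order \<open>p\<close> only the trivial subgroup is proper, and the traces
  from it are exactly the invariant functions vanishing at the fixed points, so evaluation at those
  points gives coordinates of the quotient. All orbit arguments concern a single map
  \<open>t\<close> whose \<open>p\<close>th iterate is the identity on a set; this covers tabloids,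
  basis points of free modules and \<open>{1..n}\<close> at once.\<close>

lemma funpow_fixed_mult:
  assumes "(t ^^ d) x = x" shows "(t ^^ (d * u)) x = x"
  using assms by (induction u) (auto simp: funpow_add)

text \<open>A Bezout relation \<open>d * u = e * v + 1\<close> makes both \<open>e * v\<close> and
  \<open>e * v + 1\<close> periods of \<open>x\<close>, so one further application of
  \<open>t\<close> changes nothing.\<close>

lemma fixed_of_coprime_periods:
  assumes "(t ^^ d) x = x" "(t ^^ e) x = x" "coprime d e" "d \<noteq> 0"
  shows "t x = x"
proof -
  obtain u v where "d * u = e * v + 1"
    using bezout_nat[OF assms(4), of e] assms(3) by auto
  then have "(t ^^ (e * v + 1)) x = x" using funpow_fixed_mult[OF assms(1)] by metis
  then show ?thesis using funpow_fixed_mult[OF assms(2)] by (simp add: funpow_swap1)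
qed

text \<open>A coincidence at \<open>i < j\<close> would, after applying \<open>t ^^ (p - i)\<close>,
  give the period \<open>j - i\<close>; this lies strictly between 0 and \<open>p\<close>, hence is
  coprime to the period \<open>p\<close>, and \<open>x\<close> would be fixed.\<close>

lemma inj_on_prime_orbit:
  assumes p: "prime p" and per: "(t ^^ p) x = x" and nofix: "t x \<noteq> x"
  shows "inj_on (\<lambda>j. (t ^^ j) x) {..<p}"
proof (rule linorder_inj_onI')
  fix i j assume ij: "i \<in> {..<p}" "j \<in> {..<p}" "i < j"
  show "(t ^^ i) x \<noteq> (t ^^ j) x"
  proof
    assume eq: "(t ^^ i) x = (t ^^ j) x"
    have add: "(t ^^ (p - i)) ((t ^^ k) x) = (t ^^ (p - i + k)) x" for k
      by (simp add: funpow_add)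
    have "(t ^^ (p - i)) ((t ^^ i) x) = x" using per ij add[of i] by simp
    moreover have "p - i + j = (j - i) + p" using ij by simp
    then have "(t ^^ (p - i)) ((t ^^ j) x) = (t ^^ (j - i)) x"
      using per add[of j] by (metis comp_apply funpow_add)
    ultimately have "(t ^^ (j - i)) x = x" using eq by simp
    moreover have "coprime (j - i) p"
      using p ij by (metis coprime_commute diff_is_0_eq leD le_less_trans diff_le_self dvd_imp_le
          gr0I lessThan_iff prime_imp_coprime)
    ultimately show False
      using fixed_of_coprime_periods[of "j - i" t x p] per nofix ij by simp
  qed
qed

lemma prime_orbit_closed:
  assumes "(t ^^ p) x = x"
  shows "t ` (\<lambda>j. (t ^^ j) x) ` {..<p} \<subseteq> (\<lambda>j. (t ^^ j) x) ` {..<p}"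
proof (clarsimp)
  fix j assume "j < p"
  show "t ((t ^^ j) x) \<in> (\<lambda>j. (t ^^ j) x) ` {..<p}"
  proof (cases "Suc j < p")
    case True then show ?thesis by (intro image_eqI[of _ _ "Suc j"]) auto
  next
    case False
    then have "p = Suc j" using \<open>j < p\<close> by simp
    then show ?thesis using assms by (intro image_eqI[of _ _ 0]) auto
  qed
qed

text \<open>A set on which every point moves and has period \<open>p\<close> is a disjoint union of
  orbits of exactly \<open>p\<close> points, and these can be stripped off one at a time.
  Divisibility, vanishing of sums, invariant subsets, transversals and the conjugation to
  \<open>p_cycles\<close> all follow by this one induction.\<close>

lemma prime_period_induct [consumes 5, case_names empty orbit]:
  assumes p: "prime p" and "finite A" and "t ` A \<subseteq> A"
    and "\<forall>x\<in>A. (t ^^ p) x = x" and "\<forall>x\<in>A. t x \<noteq> x"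
    and empty: "P {}"
    and orbit: "\<And>B x. finite B \<Longrightarrow> B \<subseteq> A \<Longrightarrow> t ` B \<subseteq> B \<Longrightarrow> x \<in> A \<Longrightarrow>
      inj_on (\<lambda>j. (t ^^ j) x) {..<p} \<Longrightarrow> B \<inter> (\<lambda>j. (t ^^ j) x) ` {..<p} = {} \<Longrightarrow> P B \<Longrightarrow>
      P (B \<union> (\<lambda>j. (t ^^ j) x) ` {..<p})"
  shows "P A"
proof -
  have "P B" if "B \<subseteq> A" "t ` B \<subseteq> B" for B
    using finite_subset[OF that(1) assms(2)] that
  proof (induction B rule: finite_psubset_induct)
    case (psubset B)
    show ?case
    proof (cases "B = {}")
      case False
      then obtain x where x: "x \<in> B" by auto
      define Ob where "Ob = (\<lambda>j. (t ^^ j) x) ` {..<p}"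
      have xA: "x \<in> A" using x psubset by auto
      have pow: "(t ^^ j) y \<in> B" if "y \<in> B" for j y
        using that psubset.prems by (induction j) auto
      have OB: "Ob \<subseteq> B" using pow x by (auto simp: Ob_def)
      have xO: "x \<in> Ob" using p by (auto simp: Ob_def prime_gt_0_nat intro!: image_eqI[of _ _ 0])
      have tO: "t ` Ob \<subseteq> Ob" using prime_orbit_closed[of p t x] assms(4) xA unfolding Ob_def by simp
      have powO: "(t ^^ j) y \<in> Ob" if "y \<in> Ob" for j y
        using that tO by (induction j) auto
      have "t ` (B - Ob) \<subseteq> B - Ob"
      proof (clarify, intro conjI DiffI notI)
        fix y assume y: "y \<in> B" "y \<notin> Ob"
        show "t y \<in> B" using y psubset by auto
        \<comment> \<open>\<open>t ^^ (p - 1)\<close> undoes \<open>t\<close> on \<open>A\<close>,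
          so a point mapped into the closed set \<open>Ob\<close> was already in it.\<close>
        assume "t y \<in> Ob"
        then have "(t ^^ (p - 1)) (t y) \<in> Ob" by (rule powO)
        moreover have "(t ^^ (p - 1)) (t y) = (t ^^ p) y"
          using p prime_gt_0_nat[of p] by (metis Suc_diff_1 comp_apply funpow_Suc_right)
        ultimately show False using assms(4) y psubset.prems by auto
      qed
      moreover have "B - Ob \<subset> B" using xO OB by auto
      ultimately have "P (B - Ob)" using psubset.IH psubset.prems by blast
      moreover have "inj_on (\<lambda>j. (t ^^ j) x) {..<p}"
        by (rule inj_on_prime_orbit[OF p bspec[OF assms(4) xA] bspec[OF assms(5) xA]])
      moreover have "finite (B - Ob)" "B - Ob \<subseteq> A" "(B - Ob) \<inter> Ob = {}" using psubset by auto
      ultimately have "P ((B - Ob) \<union> Ob)"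
        using orbit[of "B - Ob" x, folded Ob_def] xA \<open>t ` (B - Ob) \<subseteq> B - Ob\<close> by metis
      then show ?thesis using OB by (simp add: Un_absorb2)
    qed (simp add: empty)
  qed
  then show ?thesis using assms by blast
qed

lemma card_fixed_point_free:
  assumes "prime p" "finite A" "t ` A \<subseteq> A" "\<forall>x\<in>A. (t ^^ p) x = x" "\<forall>x\<in>A. t x \<noteq> x"
  shows "p dvd card A"
  using assms(1-5)
proof (induction rule: prime_period_induct)
  case (orbit B x)
  then show ?case by (simp add: card_Un_disjoint card_image)
qed simp

lemma fixed_point_free_invariant_subset:
  assumes "prime p" "finite A" "t ` A \<subseteq> A" "\<forall>x\<in>A. (t ^^ p) x = x" "\<forall>x\<in>A. t x \<noteq> x"
    and "p * y \<le> card A"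
  shows "\<exists>S\<subseteq>A. t ` S \<subseteq> S \<and> card S = p * y"
  using assms
proof (induction rule: prime_period_induct)
  case (orbit B x)
  let ?Ob = "(\<lambda>j. (t ^^ j) x) ` {..<p}"
  have card: "card (B \<union> ?Ob) = card B + p"
    using orbit.hyps by (simp add: card_Un_disjoint card_image)
  have dvd: "p dvd card B"
    using orbit.hyps assms by (intro card_fixed_point_free[of p B t]) auto
  have "t ` ?Ob \<subseteq> ?Ob" by (rule prime_orbit_closed[OF bspec[OF assms(4) orbit.hyps(4)]])
  then have inv: "t ` (B \<union> ?Ob) \<subseteq> B \<union> ?Ob"
    using orbit.hyps(3) unfolding image_Un by blast
  show ?case
  proof (cases "p * y \<le> card B")
    case True
    then obtain S where "S \<subseteq> B" "t ` S \<subseteq> S" "card S = p * y" using orbit.IH by auto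
    then show ?thesis by (intro exI[of _ S]) auto
  next
    case False
    \<comment> \<open>Here \<open>p * k < p * y\<close> and \<open>p * y \<le> p * Suc k\<close>, so
      \<open>y = Suc k\<close> and the whole enlarged set is the required subset.\<close>
    obtain k where k: "card B = p * k" using dvd by auto
    have "k < y" using False k mult_le_mono2[of y k p] by (metis not_le)
    moreover have "p * y \<le> p * Suc k" using orbit.prems card k by simp
    then have "y \<le> Suc k" using prime_gt_0_nat[OF assms(1)] by (metis nat_mult_le_cancel1)
    ultimately have "y = Suc k" by simp
    then show ?thesis using inv card k by (intro exI[of _ "B \<union> ?Ob"]) auto
  qed
qed simp

text \<open>Each orbit contributes \<open>of_nat p * f x\<close>, which is zero in characteristic
  \<open>p\<close>. This is the obstruction used in \<open>not_projective_of_fixed\<close>.\<close>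

lemma sum_fixed_point_free:
  fixes f :: "'b \<Rightarrow> 'k::comm_ring_1"
  assumes "prime p" "finite A" "t ` A \<subseteq> A" "\<forall>x\<in>A. (t ^^ p) x = x" "\<forall>x\<in>A. t x \<noteq> x"
    and char: "CHAR('k) = p" and inv: "\<And>x. x \<in> A \<Longrightarrow> f (t x) = f x"
  shows "sum f A = 0"
  using assms(1-5)
proof (induction rule: prime_period_induct)
  case (orbit B x)
  have "(t ^^ j) x \<in> A \<and> f ((t ^^ j) x) = f x" for j
    using assms(3) orbit.hyps by (induction j) (auto simp: inv)
  then have "sum f ((\<lambda>j. (t ^^ j) x) ` {..<p}) = of_nat p * f x"
    using orbit.hyps by (simp add: sum.reindex)
  moreover have "sum f (B \<union> (\<lambda>j. (t ^^ j) x) ` {..<p}) = sum f B + sum f ((\<lambda>j. (t ^^ j) x) ` {..<p})"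
    using orbit.hyps by (intro sum.union_disjoint) auto
  ultimately show ?case using orbit.IH char by (metis add_0 mult_zero_left of_nat_CHAR)
qed simp

text \<open>\<open>R\<close> holds one point of every orbit. The uniqueness of the index
  \<open>j\<close> is what later makes an invariant function the trace of its restriction to
  \<open>R\<close>.\<close>

lemma fixed_point_free_transversal:
  assumes "prime p" "finite A" "t ` A \<subseteq> A" "\<forall>x\<in>A. (t ^^ p) x = x" "\<forall>x\<in>A. t x \<noteq> x"
  shows "\<exists>R\<subseteq>A. \<forall>x\<in>A. \<exists>!j. j < p \<and> (t ^^ j) x \<in> R"
  using assms(1-5)
proof (induction rule: prime_period_induct)
  case (orbit B x)
  let ?Ob = "(\<lambda>j. (t ^^ j) x) ` {..<p}"
  have p0: "p > 0" using assms(1) prime_gt_0_nat by blast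
  obtain R where R: "R \<subseteq> B" "\<forall>x\<in>B. \<exists>!j. j < p \<and> (t ^^ j) x \<in> R" using orbit.IH by auto
  have xO: "x \<in> ?Ob" using p0 by (intro image_eqI[of _ _ 0]) auto
  show ?case
  proof (intro exI[of _ "insert x R"] conjI ballI)
    show "insert x R \<subseteq> B \<union> ?Ob" using R xO by auto
    fix y assume "y \<in> B \<union> ?Ob"
    then show "\<exists>!j. j < p \<and> (t ^^ j) y \<in> insert x R"
    proof
      assume y: "y \<in> B"
      have "(t ^^ j) y \<in> B" for j using orbit.hyps y by (induction j) auto
      then have "(t ^^ j) y \<noteq> x" for j using xO orbit.hyps by blast
      then show ?thesis using R y by auto
    next
      assume "y \<in> ?Ob"
      then obtain i where i: "i < p" "y = (t ^^ i) x" by auto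
      have per: "(t ^^ p) x = x" using assms(4) orbit.hyps by auto
      \<comment> \<open>Exponents on the orbit count modulo \<open>p\<close>, so
        \<open>y = (t ^^ i) x\<close> comes back to the chosen point \<open>x\<close> exactly when
        \<open>j + i\<close> is divisible by \<open>p\<close>.\<close>
      have red: "(t ^^ j) y = (t ^^ ((j + i) mod p)) x" for j
        using funpow_mod_eq[OF per, of "j + i"] i by (simp add: funpow_add)
      have "(t ^^ j) y \<in> ?Ob" for j using red p0 by auto
      then have notR: "(t ^^ j) y \<notin> R" for j using R(1) orbit.hyps by blast
      have iff: "(t ^^ j) y = x \<longleftrightarrow> (j + i) mod p = 0" for j
        using inj_onD[OF orbit.hyps(5), of "(j + i) mod p" 0] red p0 by auto
      have "\<exists>!j. j < p \<and> (j + i) mod p = 0"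
      proof (rule ex_ex1I)
        show "\<exists>j. j < p \<and> (j + i) mod p = 0"
          using i p0 by (cases "i = 0") (auto intro: exI[of _ "p - i"])
        show "j = k" if "j < p \<and> (j + i) mod p = 0" "k < p \<and> (k + i) mod p = 0" for j k
          using that i(1) p0 by (auto simp: mod_if split: if_splits)
      qed
      then show ?thesis using iff notR by auto
    qed
  qed
qed simp

lemma invariant_subset_of_card_iff:
  fixes \<Omega> :: "'b set"
  assumes "prime p" and fin: "finite \<Omega>" and t: "t ` \<Omega> \<subseteq> \<Omega>" and per: "\<And>x. x \<in> \<Omega> \<Longrightarrow> (t ^^ p) x = x"
  defines "m \<equiv> card {x \<in> \<Omega>. t x = x}"
  shows "(\<exists>S\<subseteq>\<Omega>. card S = a \<and> t ` S = S) \<longleftrightarrow> (\<exists>x y. a = x + p * y \<and> x \<le> m \<and> p * y \<le> card \<Omega> - m)"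
proof
  let ?F = "{x \<in> \<Omega>. t x = x}"
  \<comment> \<open>\<open>t ^^ (p - 1)\<close> is a left inverse of \<open>t\<close> on
    \<open>\<Omega>\<close>. Injectivity is needed so that a moved point is never sent to a fixed
    one.\<close>
  have inj: "inj_on t \<Omega>"
  proof (rule inj_on_inverseI[where g = "t ^^ (p - 1)"])
    fix x assume "x \<in> \<Omega>"
    then show "(t ^^ (p - 1)) (t x) = x"
      using per[of x] prime_gt_0_nat[OF assms(1)] by (metis Suc_diff_1 comp_apply funpow_Suc_right)
  qed
  have cdiff: "card (\<Omega> - ?F) = card \<Omega> - m" unfolding m_def using fin by (subst card_Diff_subset) auto
  {
    assume "\<exists>S\<subseteq>\<Omega>. card S = a \<and> t ` S = S"
    then obtain S where S: "S \<subseteq> \<Omega>" "card S = a" "t ` S = S" by auto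
    have fS: "finite S" using S fin finite_subset by auto
    have "t ` (S - ?F) \<subseteq> S - ?F"
      using S inj by (auto dest: inj_onD)
    then have "p dvd card (S - ?F)"
      using S per fS by (intro card_fixed_point_free[OF assms(1), of _ t]) auto
    then obtain y where y: "card (S - ?F) = p * y" by auto
    moreover have "card (S - ?F) \<le> card (\<Omega> - ?F)" using S fin by (intro card_mono) auto
    moreover have "card (S \<inter> ?F) \<le> m" unfolding m_def using fin by (intro card_mono) auto
    moreover have "a = card (S \<inter> ?F) + card (S - ?F)"
      using card_Int_Diff[OF fS] S by simp
    ultimately show "\<exists>x y. a = x + p * y \<and> x \<le> m \<and> p * y \<le> card \<Omega> - m"
      using cdiff y by (intro exI[of _ "card (S \<inter> ?F)"] exI[of _ y]) auto
  next
    assume "\<exists>x y. a = x + p * y \<and> x \<le> m \<and> p * y \<le> card \<Omega> - m"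
    then obtain x y where xy: "a = x + p * y" "x \<le> m" "p * y \<le> card (\<Omega> - ?F)" unfolding cdiff by blast
    obtain X where X: "X \<subseteq> ?F" "card X = x" "finite X"
      using xy(2) unfolding m_def by (meson obtain_subset_with_card_n)
    have inv: "t ` (\<Omega> - ?F) \<subseteq> \<Omega> - ?F" using t inj by (auto dest: inj_onD)
    have "\<forall>x\<in>\<Omega> - ?F. (t ^^ p) x = x" "\<forall>x\<in>\<Omega> - ?F. t x \<noteq> x" using per by simp_all
    from fixed_point_free_invariant_subset[OF assms(1) finite_Diff[OF fin] inv this xy(3)]
    obtain Y where Y: "Y \<subseteq> \<Omega> - ?F" "t ` Y \<subseteq> Y" "card Y = p * y" by (elim exE conjE)
    have Ysub: "Y \<subseteq> \<Omega>" using Y(1) by blast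
    then have fY: "finite Y" using fin by (rule finite_subset)
    have "card (t ` Y) = card Y" by (rule card_image[OF inj_on_subset[OF inj Ysub]])
    then have tY: "t ` Y = Y" using Y(2) fY card_subset_eq by metis
    have "t ` X = id ` X" using X(1) by (intro image_cong) auto
    then have tX: "t ` X = X" by simp
    have "X \<inter> Y = {}" using X(1) Y(1) by blast
    then have "card (X \<union> Y) = a" using X Y(3) xy(1) fY by (simp add: card_Un_disjoint)
    moreover have "X \<union> Y \<subseteq> \<Omega>" using X(1) Ysub by blast
    ultimately show "\<exists>S\<subseteq>\<Omega>. card S = a \<and> t ` S = S"
      using tX tY by (intro exI[of _ "X \<union> Y"]) (simp add: image_Un)
  }
qed

section \<open>Elements of prime order in the symmetric group\<close>

lemma map_cycle_of_list: "distinct cs \<Longrightarrow> map (cycle_of_list cs) cs = rotate1 cs"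
  using cyclic_rotation[of cs 1] by simp

text \<open>Mapping a cycle over its own list rotates the list, so the value at \<open>k\<close> is
  the entry at position \<open>k - s\<close> of the rotated interval.\<close>

lemma cycle_of_list_upt:
  assumes "s \<le> k" "k < s + p"
  shows "cycle_of_list [s..<s + p] k = (if Suc k = s + p then s else Suc k)"
proof -
  have "map (cycle_of_list [s..<s + p]) [s..<s + p] ! (k - s) = rotate1 [s..<s + p] ! (k - s)"
    by (simp only: map_cycle_of_list distinct_upt)
  moreover have "k - s < p" using assms by simp
  ultimately show ?thesis using assms by (auto simp: nth_rotate1 mod_Suc)
qed

lemma p_cycles_outside: "k \<notin> {1..i * p} \<Longrightarrow> p_cycles p i k = k"
  by (induction i) (auto simp: id_outside_supp)

lemma p_cycles_Suc_block:
  assumes "k \<in> {i * p + 1..Suc i * p}"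
  shows "p_cycles p (Suc i) k = (if k = Suc i * p then i * p + 1 else Suc k)"
proof -
  have "cycle_of_list [i * p + 1..<(i * p + 1) + p] k = (if Suc k = (i * p + 1) + p then i * p + 1 else Suc k)"
    using assms by (intro cycle_of_list_upt) auto
  moreover have "(i * p + 1) + p = Suc i * p + 1" by simp
  ultimately have "cycle_of_list [i * p + 1..<Suc i * p + 1] k = (if Suc k = Suc i * p + 1 then i * p + 1 else Suc k)"
    by metis
  then show ?thesis using assms by (simp add: p_cycles_outside del: upt_Suc)
qed

lemma p_cycles_Suc_outside_block:
  assumes "k \<notin> {i * p + 1..Suc i * p}"
  shows "p_cycles p (Suc i) k = p_cycles p i k"
proof -
  have "k \<notin> set [i * p + 1..<Suc i * p + 1]" using assms by auto
  then show ?thesis by (simp add: id_outside_supp del: set_upt)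
qed

lemma p_cycles_permutes: "p_cycles p i permutes {1..i * p}"
proof (induction i)
  case 0
  show ?case unfolding p_cycles.simps by (rule permutes_id)
next
  case (Suc i)
  have "cycle_of_list [i * p + 1..<Suc i * p + 1] permutes {1..Suc i * p}"
    by (rule permutes_subset[OF cycle_permutes]) auto
  moreover have "p_cycles p i permutes {1..Suc i * p}"
    by (rule permutes_subset[OF Suc]) auto
  ultimately show ?case unfolding p_cycles.simps by (rule permutes_compose)
qed

text \<open>Neither the last block nor its complement is ever left under iteration, so the power is
  computed separately: on the block from the single cycle, off it from the induction
  hypothesis.\<close>

lemma p_cycles_funpow: "p_cycles p i ^^ p = id"
proof (induction i)
  case 0
  have "id ^^ m = id" for m by (induction m) (simp_all only: funpow.simps id_comp)
  then show ?case by (simp only: p_cycles.simps)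
next
  case (Suc i)
  let ?c = "cycle_of_list [i * p + 1..<Suc i * p + 1]" and ?B = "{i * p + 1..Suc i * p}"
  have B: "set [i * p + 1..<Suc i * p + 1] = ?B" by auto
  have cB: "?c k \<in> ?B" if "k \<in> ?B" for k
    using permutes_in_image[OF cycle_permutes[of "[i * p + 1..<Suc i * p + 1]", unfolded B]] that by metis
  have notB: "(p_cycles p (Suc i) ^^ m) k = (p_cycles p i ^^ m) k \<and> (p_cycles p i ^^ m) k \<notin> ?B"
    if "k \<notin> ?B" for m k
  proof (induction m)
    case (Suc m)
    \<comment> \<open>The shorter product fixes the new block pointwise, so by injectivity nothing
      enters the block from outside.\<close>
    have "p_cycles p i j \<notin> ?B" if "j \<notin> ?B" for j
    proof
      assume *: "p_cycles p i j \<in> ?B"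
      then have "p_cycles p i (p_cycles p i j) = p_cycles p i j" by (intro p_cycles_outside) auto
      then have "p_cycles p i j = j" using permutes_inj[OF p_cycles_permutes] by (metis injD)
      then show False using * that by simp
    qed
    then show ?case using Suc by (simp add: p_cycles_Suc_outside_block del: p_cycles.simps)
  qed (use that in simp)
  have inB: "(p_cycles p (Suc i) ^^ m) k = (?c ^^ m) k \<and> (?c ^^ m) k \<in> ?B" if "k \<in> ?B" for m k
  proof (induction m)
    case (Suc m)
    have "p_cycles p (Suc i) j = ?c j" if "j \<in> ?B" for j
      using cB[OF that] by (simp add: p_cycles_outside del: upt_Suc)
    then show ?case using Suc cB by (simp del: p_cycles.simps upt_Suc)
  qed (use that in simp)
  have "?c ^^ p = id" using cycle_is_id_root[of "[i * p + 1..<Suc i * p + 1]"] by (simp del: upt_Suc)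
  then have "(p_cycles p (Suc i) ^^ p) k = k" for k
    using inB[of k p] notB[of k p] Suc by (cases "k \<in> ?B") (simp_all del: p_cycles.simps upt_Suc)
  then show ?case by (intro ext) (simp only: id_apply)
qed

lemma p_cycles_neq_id:
  assumes "i > 0" "p > 1" shows "p_cycles p i \<noteq> id"
proof -
  obtain j where j: "i = Suc j" using assms gr0_conv_Suc by auto
  then have "p_cycles p i (j * p + 1) = Suc (j * p + 1)"
    using assms p_cycles_Suc_block[of "j * p + 1" j p] by (simp del: p_cycles.simps)
  then show ?thesis by (metis id_apply n_not_Suc_n)
qed

text \<open>Elements of the same cycle type are conjugate: \<open>i\<close> is the number of
  nontrivial orbits of \<open>g\<close>, and \<open>h\<close> lays the consecutive blocks of length
  \<open>p\<close> along these orbits in the order of iteration.\<close>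

lemma prime_period_conj_p_cycles:
  assumes p: "prime p" and g: "g permutes {1..n}" "g ^^ p = id" "g \<noteq> id"
  shows "\<exists>i h. 1 \<le> i \<and> i * p \<le> n \<and> h permutes {1..n} \<and> g \<circ> h = h \<circ> p_cycles p i"
proof -
  define A where "A = {x. g x \<noteq> x}"
  have A: "A \<subseteq> {1..n}" using g(1) by (auto simp: A_def permutes_def)
  then have finA: "finite A" by (rule finite_subset) simp
  have gA: "g ` A \<subseteq> A" using permutes_inj[OF g(1)] by (auto simp: A_def dest: injD)
  have per: "\<forall>x\<in>A. (g ^^ p) x = x" by (simp add: g(2))
  have nofix: "\<forall>x\<in>A. g x \<noteq> x" by (simp add: A_def)
  have "\<exists>i f. bij_betw f {1..i * p} A \<and> (\<forall>k\<in>{1..i * p}. g (f k) = f (p_cycles p i k))"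
    using p finA gA per nofix
  proof (induction rule: prime_period_induct)
    case empty
    show ?case by (intro exI[of _ 0]) (simp add: bij_betw_def)
  next
    case (orbit B x)
    then obtain i f where f: "bij_betw f {1..i * p} B"
      and gf: "\<And>k. k \<in> {1..i * p} \<Longrightarrow> g (f k) = f (p_cycles p i k)" by blast
    \<comment> \<open>The new block runs along the orbit of \<open>x\<close>: position
      \<open>i * p + 1 + j\<close> is sent to \<open>(g ^^ j) x\<close>.\<close>
    define f' where "f' k = (if k \<in> {1..i * p} then f k else (g ^^ (k - (i * p + 1))) x)" for k
    have split: "{1..Suc i * p} = {1..i * p} \<union> {i * p + 1..Suc i * p}" by auto
    have "bij_betw (\<lambda>j. (g ^^ j) x) {..<p} ((\<lambda>j. (g ^^ j) x) ` {..<p})"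
      using orbit.hyps(5) by (rule inj_on_imp_bij_betw)
    moreover have "bij_betw (\<lambda>k. k - (i * p + 1)) {i * p + 1..Suc i * p} {..<p}"
      by (rule bij_betw_byWitness[where f' = "\<lambda>j. j + (i * p + 1)"]) auto
    ultimately have "bij_betw ((\<lambda>j. (g ^^ j) x) \<circ> (\<lambda>k. k - (i * p + 1))) {i * p + 1..Suc i * p}
        ((\<lambda>j. (g ^^ j) x) ` {..<p})"
      using bij_betw_trans by blast
    then have "bij_betw f' {i * p + 1..Suc i * p} ((\<lambda>j. (g ^^ j) x) ` {..<p})"
      by (rule bij_betw_cong[THEN iffD1, rotated]) (simp add: f'_def)
    moreover have "bij_betw f' {1..i * p} B"
      using f by (rule bij_betw_cong[THEN iffD1, rotated]) (simp add: f'_def)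
    ultimately have bij: "bij_betw f' {1..Suc i * p} (B \<union> (\<lambda>j. (g ^^ j) x) ` {..<p})"
      unfolding split using orbit.hyps(6) by (intro bij_betw_combine)
    have "g (f' k) = f' (p_cycles p (Suc i) k)" if k: "k \<in> {1..Suc i * p}" for k
    proof (cases "k \<in> {1..i * p}")
      case True
      then have "p_cycles p i k \<in> {1..i * p}" using permutes_in_image[OF p_cycles_permutes] by metis
      moreover have "k \<notin> {i * p + 1..Suc i * p}" using True by auto
      ultimately show ?thesis
        using True gf[OF True] unfolding p_cycles_Suc_outside_block[OF \<open>k \<notin> _\<close>] f'_def by simp
    next
      case False
      then have kB: "k \<in> {i * p + 1..Suc i * p}" using k by auto
      have f'k: "f' k = (g ^^ (k - (i * p + 1))) x" unfolding f'_def using False by (rule if_not_P)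
      show ?thesis
      proof (cases "k = Suc i * p")
        \<comment> \<open>At the end of the block both sides wrap around: \<open>g ^^ p\<close>
          brings \<open>x\<close> back to itself, and the cycle returns to the position
          \<open>i * p + 1\<close>.\<close>
        case True
        have "k - (i * p + 1) = p - 1" using True by simp
        then have "g (f' k) = (g ^^ Suc (p - 1)) x"
          unfolding f'k funpow.simps comp_apply by simp
        also have "\<dots> = x" using per orbit.hyps(4) prime_gt_0_nat[OF p] by simp
        also have "\<dots> = f' (p_cycles p (Suc i) k)"
          unfolding p_cycles_Suc_block[OF kB] using True by (simp add: f'_def)
        finally show ?thesis .
      next
        case neq: False
        have "g (f' k) = (g ^^ Suc (k - (i * p + 1))) x" by (simp add: f'k)
        also have "Suc (k - (i * p + 1)) = Suc k - (i * p + 1)" using kB by auto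
        also have "(g ^^ (Suc k - (i * p + 1))) x = f' (p_cycles p (Suc i) k)"
          unfolding p_cycles_Suc_block[OF kB] using neq kB by (simp add: f'_def)
        finally show ?thesis .
      qed
    qed
    then show ?case using bij by blast
  qed
  then obtain i f where f: "bij_betw f {1..i * p} A"
    and gf: "\<And>k. k \<in> {1..i * p} \<Longrightarrow> g (f k) = f (p_cycles p i k)" by blast
  have cardA: "card A = i * p" using bij_betw_same_card[OF f] by simp
  then have le: "i * p \<le> n" using card_mono[OF _ A] by simp
  have "A \<noteq> {}" using g(3) by (auto simp: A_def fun_eq_iff)
  then have "i \<noteq> 0" using cardA finA by auto
  \<comment> \<open>Off the supports both permutations are trivial, so any bijection between the two
    complements completes \<open>h\<close>.\<close>
  have "card {i * p + 1..n} = card ({1..n} - A)"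
    using A finA cardA by (simp add: card_Diff_subset)
  then obtain f2 where f2: "bij_betw f2 {i * p + 1..n} ({1..n} - A)"
    using finite_same_card_bij by (metis finite_atLeastAtMost finite_Diff)
  define h where "h k = (if k \<in> {1..i * p} then f k else if k \<in> {1..n} then f2 k else k)" for k
  have split: "{1..n} = {1..i * p} \<union> {i * p + 1..n}" using le by auto
  have "bij_betw h {1..i * p} A"
    using f by (rule bij_betw_cong[THEN iffD1, rotated]) (simp add: h_def)
  moreover have "bij_betw h {i * p + 1..n} ({1..n} - A)"
    using f2 by (rule bij_betw_cong[THEN iffD1, rotated]) (simp add: h_def)
  ultimately have "bij_betw h ({1..i * p} \<union> {i * p + 1..n}) (A \<union> ({1..n} - A))"
    by (rule bij_betw_combine) auto
  then have bij: "bij_betw h {1..n} {1..n}" using A split by (simp add: Un_absorb1)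
  have perm: "h permutes {1..n}"
    by (rule bij_imp_permutes[OF bij]) (use le in \<open>auto simp: h_def\<close>)
  have "g (h k) = h (p_cycles p i k)" for k
  proof (cases "k \<in> {1..i * p}")
    case True
    then have "p_cycles p i k \<in> {1..i * p}" using permutes_in_image[OF p_cycles_permutes] by metis
    then show ?thesis using True gf[OF True] by (simp add: h_def)
  next
    case False
    then have fixk: "p_cycles p i k = k" by (rule p_cycles_outside)
    have "g (h k) = h k"
    proof (cases "k \<in> {1..n}")
      case True
      then have "k \<in> {i * p + 1..n}" using False by auto
      then have "f2 k \<in> {1..n} - A" using f2 by (auto simp: bij_betw_def)
      then show ?thesis using True False by (simp add: h_def A_def)
    next
      case k: False
      then have "g k = k" using g(1) by (auto simp: permutes_def)
      moreover have "h k = k" unfolding h_def if_not_P[OF k] if_not_P[OF False] ..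
      ultimately show ?thesis by simp
    qed
    then show ?thesis by (simp add: fixk)
  qed
  then have "g \<circ> h = h \<circ> p_cycles p i" by (simp add: fun_eq_iff)
  then show ?thesis using \<open>i \<noteq> 0\<close> le perm by (intro exI[of _ i] exI[of _ h]) simp
qed

section \<open>Coordinates and quotients\<close>

definition linear_functional :: "('k::field, 'v, 'e) module_scheme \<Rightarrow> ('v \<Rightarrow> 'k) \<Rightarrow> bool" where
  "linear_functional V D \<longleftrightarrow>
    (\<forall>v\<in>carrier V. \<forall>w\<in>carrier V. D (v \<oplus>\<^bsub>V\<^esub> w) = D v + D w) \<and>
    (\<forall>c. \<forall>v\<in>carrier V. D (c \<odot>\<^bsub>V\<^esub> v) = c * D v)"

lemma linear_functional_add:
  "linear_functional V D \<Longrightarrow> v \<in> carrier V \<Longrightarrow> w \<in> carrier V \<Longrightarrow> D (v \<oplus>\<^bsub>V\<^esub> w) = D v + D w"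
  by (simp add: linear_functional_def)

lemma linear_functional_smult:
  "linear_functional V D \<Longrightarrow> v \<in> carrier V \<Longrightarrow> D (c \<odot>\<^bsub>V\<^esub> v) = c * D v"
  by (simp add: linear_functional_def)

lemma linear_functional_zero:
  assumes "linear_functional V D" "module (class_ring :: 'k::field ring) V"
  shows "D \<zero>\<^bsub>V\<^esub> = (0 :: 'k)"
proof -
  interpret Module.module "class_ring :: 'k ring" V by fact
  have "D \<zero>\<^bsub>V\<^esub> = D \<zero>\<^bsub>V\<^esub> + D \<zero>\<^bsub>V\<^esub>"
    using linear_functional_add[OF assms(1), of "\<zero>\<^bsub>V\<^esub>" "\<zero>\<^bsub>V\<^esub>"] by simp
  then show ?thesis by (metis add_cancel_right_right)
qed

lemma linear_functional_finsum:
  assumes "linear_functional V D" "module (class_ring :: 'k::field ring) V" "f \<in> A \<rightarrow> carrier V"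
  shows "D (finsum V f A) = (\<Sum>a\<in>A. D (f a))"
proof -
  interpret Module.module "class_ring :: 'k ring" V by fact
  show ?thesis
  proof (cases "finite A")
    case True
    then show ?thesis using assms(3)
    proof (induction A)
      case (insert a A)
      then show ?case by (simp add: Pi_iff linear_functional_add[OF assms(1)])
    qed (simp add: linear_functional_zero[OF assms(1,2)])
  qed (simp add: linear_functional_zero[OF assms(1,2)] finsum_infinite)
qed

text \<open>A finite basis packaged with its dual basis. The functionals certify independence, and
  \<open>separating\<close> stands in for spanning: in a quotient it only asks that a representative
  with zero coordinates lie in the submodule divided out.\<close>

locale coordinates = vectorspace "class_ring :: 'k::field ring" V
  for V :: "('k::field, 'v, 'e) module_scheme" +
  fixes I :: "'i set" and e :: "'i \<Rightarrow> 'v" and D :: "'i \<Rightarrow> 'v \<Rightarrow> 'k"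
  assumes finite_index: "finite I"
    and e_closed: "x \<in> I \<Longrightarrow> e x \<in> carrier V"
    and D_linear: "x \<in> I \<Longrightarrow> linear_functional V (D x)"
    and D_e: "x \<in> I \<Longrightarrow> y \<in> I \<Longrightarrow> D x (e y) = (if x = y then 1 else 0)"
    and separating: "v \<in> carrier V \<Longrightarrow> (\<And>x. x \<in> I \<Longrightarrow> D x v = 0) \<Longrightarrow> v = \<zero>\<^bsub>V\<^esub>"
begin

lemma eqI_coordinates:
  assumes "v \<in> carrier V" "w \<in> carrier V" "\<And>x. x \<in> I \<Longrightarrow> D x v = D x w"
  shows "v = w"
proof -
  have "D x (v \<ominus>\<^bsub>V\<^esub> w) = 0" if "x \<in> I" for x
  proof -
    have "D x (w \<oplus>\<^bsub>V\<^esub> \<ominus>\<^bsub>V\<^esub> w) = 0"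
      using assms(2) linear_functional_zero[OF D_linear[OF that] module_axioms] by (simp add: r_neg)
    then have "D x w + D x (\<ominus>\<^bsub>V\<^esub> w) = 0"
      using assms(2) linear_functional_add[OF D_linear[OF that]] by simp
    then show ?thesis
      using assms that linear_functional_add[OF D_linear[OF that]] by (simp add: minus_eq)
  qed
  then have "v \<ominus>\<^bsub>V\<^esub> w = \<zero>\<^bsub>V\<^esub>" using assms by (intro separating) auto
  then show ?thesis using assms by simp
qed

lemma smult_e_closed: "x \<in> I \<Longrightarrow> c \<odot>\<^bsub>V\<^esub> e x \<in> carrier V"
  using e_closed by (simp add: class_ring_simps)

lemma D_combination:
  assumes "x \<in> I"
  shows "D x (finsum V (\<lambda>y. c y \<odot>\<^bsub>V\<^esub> e y) I) = c x"
proof -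
  have "D x (finsum V (\<lambda>y. c y \<odot>\<^bsub>V\<^esub> e y) I) = (\<Sum>y\<in>I. D x (c y \<odot>\<^bsub>V\<^esub> e y))"
    by (rule linear_functional_finsum[OF D_linear[OF assms] module_axioms]) (use smult_e_closed in auto)
  also have "\<dots> = (\<Sum>y\<in>I. c y * D x (e y))"
    using linear_functional_smult[OF D_linear[OF assms]] e_closed by (intro sum.cong) auto
  also have "\<dots> = (\<Sum>y\<in>I. if x = y then c y else 0)"
    using D_e[OF assms] by (intro sum.cong) auto
  finally show ?thesis using assms finite_index by simp
qed

lemma expansion:
  assumes "v \<in> carrier V"
  shows "v = finsum V (\<lambda>x. D x v \<odot>\<^bsub>V\<^esub> e x) I"
  using assms smult_e_closed by (intro eqI_coordinates) (auto simp: D_combination)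

lemma linear_functional_expansion:
  assumes "linear_functional V f" "v \<in> carrier V"
  shows "f v = (\<Sum>x\<in>I. D x v * f (e x))"
proof -
  have "f v = f (finsum V (\<lambda>x. D x v \<odot>\<^bsub>V\<^esub> e x) I)" using expansion[OF assms(2)] by simp
  also have "\<dots> = (\<Sum>x\<in>I. f (D x v \<odot>\<^bsub>V\<^esub> e x))"
    by (rule linear_functional_finsum[OF assms(1) module_axioms]) (use smult_e_closed in auto)
  also have "\<dots> = (\<Sum>x\<in>I. D x v * f (e x))"
    using linear_functional_smult[OF assms(1)] e_closed by (intro sum.cong) auto
  finally show ?thesis .
qed

lemma inj_on_e: "inj_on e I"
proof (rule inj_onI)
  fix x y assume "x \<in> I" "y \<in> I" "e x = e y"
  then show "x = y" using D_e[of x x] D_e[of x y] by (simp split: if_splits)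
qed

lemma lincomb_e: "lincomb c (e ` I) = finsum V (\<lambda>x. c (e x) \<odot>\<^bsub>V\<^esub> e x) I"
  unfolding lincomb_def using smult_e_closed inj_on_e by (intro finsum_reindex) auto

lemma dim_eq_card: "dim = card I"
proof -
  have sub: "e ` I \<subseteq> carrier V" using e_closed by auto
  have "lin_indpt (e ` I)"
  proof (rule finite_lin_indpt2)
    fix c assume "lincomb c (e ` I) = \<zero>\<^bsub>V\<^esub>"
    then have "c (e x) = 0" if "x \<in> I" for x
      using D_combination[OF that, of "\<lambda>x. c (e x)"]
        linear_functional_zero[OF D_linear[OF that] module_axioms] by (simp add: lincomb_e)
    then show "\<forall>v\<in>e ` I. c v = \<zero>\<^bsub>class_ring :: 'k ring\<^esub>" by (auto simp: class_ring_simps)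
  qed (use sub finite_index in auto)
  moreover have "span (e ` I) = carrier V"
  proof
    show "span (e ` I) \<subseteq> carrier V" using sub by (rule span_is_subset2)
    show "carrier V \<subseteq> span (e ` I)"
    proof
      fix v assume v: "v \<in> carrier V"
      have "finsum V (\<lambda>x. D x v \<odot>\<^bsub>V\<^esub> e x) I = lincomb (\<lambda>u. D (inv_into I e u) v) (e ` I)"
        unfolding lincomb_e using inj_on_e smult_e_closed by (intro finsum_cong') auto
      then have "v = lincomb (\<lambda>u. D (inv_into I e u) v) (e ` I)" using expansion[OF v] by simp
      then show "v \<in> span (e ` I)"
        unfolding span_def using finite_index by (auto simp: class_ring_simps)
    qed
  qed
  ultimately have "basis (e ` I)" using sub by (simp add: basis_def)
  then show ?thesis using dim_basis[OF finite_imageI[OF finite_index]] card_image[OF inj_on_e] by metis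
qed

end

section \<open>Quotient spaces and the functionals that descend to them\<close>

locale quotient_space = Module.module "class_ring :: 'k::field ring" V + W: submodule "class_ring :: 'k::field ring" W V
  for V :: "('k::field, 'v, 'g, 'e) gmodule_scheme" and W
begin

definition proj :: "'v \<Rightarrow> 'v set" where
  "proj v = W +>\<^bsub>V\<^esub> v"

lemma W_subset: "W \<subseteq> carrier V" by (rule W.subset)

lemma uminus_W:
  assumes "w \<in> W" shows "\<ominus>\<^bsub>V\<^esub> w \<in> W"
proof -
  have "(- 1 :: 'k) \<odot>\<^bsub>V\<^esub> w = \<ominus>\<^bsub>V\<^esub> w"
    using assms W_subset smult_l_minus[of 1 w] smult_one[of w] by (auto simp: class_ring_simps)
  then show ?thesis using W.smult_closed[of "-1" w] assms by auto
qed

lemma abelian_subgroup_W: "abelian_subgroup W V"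
proof -
  have "additive_subgroup W V"
    by (rule additive_subgroup.intro, rule add.subgroupI)
       (use W_subset uminus_W W.zero_closed in \<open>auto simp: a_inv_def[symmetric] simp del: W.zero_closed\<close>)
  then show ?thesis by (intro abelian_subgroupI3) (auto intro: abelian_group_axioms)
qed

sublocale abelian_subgroup W V by (rule abelian_subgroup_W)

lemma mem_proj_iff: "x \<in> proj v \<longleftrightarrow> (\<exists>w\<in>W. x = w \<oplus>\<^bsub>V\<^esub> v)"
  by (auto simp: proj_def a_r_coset_def')

lemma carrier_quotient: "carrier (quotient_gmodule V W) = proj ` carrier V"
  by (auto simp: quotient_gmodule_def A_RCOSETS_def' proj_def)

lemma proj_add:
  "v \<in> carrier V \<Longrightarrow> w \<in> carrier V \<Longrightarrow> proj (v \<oplus>\<^bsub>V\<^esub> w) = proj v \<oplus>\<^bsub>quotient_gmodule V W\<^esub> proj w"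
  using a_rcos_sum by (simp add: quotient_gmodule_def proj_def)

lemma proj_zero: "\<zero>\<^bsub>quotient_gmodule V W\<^esub> = W"
  by (simp add: quotient_gmodule_def)

lemma mem_proj_self: "v \<in> carrier V \<Longrightarrow> v \<in> proj v"
  by (auto simp: mem_proj_iff intro!: bexI[of _ "\<zero>\<^bsub>V\<^esub>"])

lemma proj_eq_zero_iff:
  assumes "v \<in> carrier V"
  shows "proj v = \<zero>\<^bsub>quotient_gmodule V W\<^esub> \<longleftrightarrow> v \<in> W"
proof
  assume "proj v = \<zero>\<^bsub>quotient_gmodule V W\<^esub>"
  then show "v \<in> W" using mem_proj_self[OF assms] by (simp add: proj_zero)
next
  assume "v \<in> W"
  then show "proj v = \<zero>\<^bsub>quotient_gmodule V W\<^esub>" unfolding proj_zero proj_def by (rule a_rcos_const)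
qed

lemma proj_smult:
  assumes v: "v \<in> carrier V"
  shows "proj (c \<odot>\<^bsub>V\<^esub> v) = c \<odot>\<^bsub>quotient_gmodule V W\<^esub> proj v"
proof (intro subset_antisym subsetI)
  fix x assume "x \<in> c \<odot>\<^bsub>quotient_gmodule V W\<^esub> proj v"
  then obtain w w' where w: "w \<in> W" "w' \<in> W" "x = w \<oplus>\<^bsub>V\<^esub> c \<odot>\<^bsub>V\<^esub> (w' \<oplus>\<^bsub>V\<^esub> v)"
    by (auto simp: quotient_gmodule_def set_add_def' mem_proj_iff)
  then have "x = (w \<oplus>\<^bsub>V\<^esub> c \<odot>\<^bsub>V\<^esub> w') \<oplus>\<^bsub>V\<^esub> c \<odot>\<^bsub>V\<^esub> v"
    using v W_subset by (auto simp: smult_r_distr a_assoc subset_iff class_ring_simps)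
  then show "x \<in> proj (c \<odot>\<^bsub>V\<^esub> v)" using w by (auto simp: mem_proj_iff class_ring_simps)
next
  fix x assume "x \<in> proj (c \<odot>\<^bsub>V\<^esub> v)"
  then obtain w where w: "w \<in> W" "x = w \<oplus>\<^bsub>V\<^esub> c \<odot>\<^bsub>V\<^esub> v" by (auto simp: mem_proj_iff)
  moreover have "v \<in> proj v" using v by (rule mem_proj_self)
  ultimately show "x \<in> c \<odot>\<^bsub>quotient_gmodule V W\<^esub> proj v"
    by (auto simp: quotient_gmodule_def set_add_def')
qed

text \<open>The value at an arbitrarily chosen representative; by \<open>descend_proj\<close> the
  choice is immaterial for a linear \<open>D\<close> that vanishes on \<open>W\<close>.\<close>

definition descend :: "('v \<Rightarrow> 'k) \<Rightarrow> 'v set \<Rightarrow> 'k" where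
  "descend D X = D (SOME v. v \<in> carrier V \<and> proj v = X)"

lemma descend_proj:
  assumes "linear_functional V D" "\<And>w. w \<in> W \<Longrightarrow> D w = 0" "v \<in> carrier V"
  shows "descend D (proj v) = D v"
proof -
  define u where "u = (SOME v'. v' \<in> carrier V \<and> proj v' = proj v)"
  have u: "u \<in> carrier V" "proj u = proj v"
    using someI[of "\<lambda>v'. v' \<in> carrier V \<and> proj v' = proj v" v] assms(3) unfolding u_def by auto
  have "u \<in> proj u" using u(1) by (rule mem_proj_self)
  then obtain w where w: "w \<in> W" "u = w \<oplus>\<^bsub>V\<^esub> v" unfolding u(2) mem_proj_iff by auto
  then have "D u = D v" using assms W_subset linear_functional_add[OF assms(1), of w v] by auto
  then show ?thesis by (simp add: descend_def u_def)
qed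

lemma linear_functional_descend:
  assumes "linear_functional V D" "\<And>w. w \<in> W \<Longrightarrow> D w = 0"
  shows "linear_functional (quotient_gmodule V W) (descend D)"
  unfolding linear_functional_def carrier_quotient ball_simps(9)
proof (intro conjI allI ballI)
  fix v w assume vw: "v \<in> carrier V" "w \<in> carrier V"
  then show "descend D (proj v \<oplus>\<^bsub>quotient_gmodule V W\<^esub> proj w) = descend D (proj v) + descend D (proj w)"
    using descend_proj[OF assms] linear_functional_add[OF assms(1)] by (simp flip: proj_add)
next
  fix c v assume v: "v \<in> carrier V"
  then have "c \<odot>\<^bsub>V\<^esub> v \<in> carrier V" by (simp add: class_ring_simps)
  with v show "descend D (c \<odot>\<^bsub>quotient_gmodule V W\<^esub> proj v) = c * descend D (proj v)"
    using descend_proj[OF assms] linear_functional_smult[OF assms(1)] by (simp flip: proj_smult)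
qed

end

section \<open>Finitely supported functions and linear functionals on them\<close>

lemma carrier_permutation_module:
  "carrier (permutation_module G B \<phi>) = {f. finite {x. f x \<noteq> 0} \<and> (\<forall>x. x \<notin> B \<longrightarrow> f x = 0)}"
  by (simp add: permutation_module_def)

text \<open>The set of points may be infinite, as it can be for the tuples that generate an exterior
  power, so vectors are built up point by point along their finite support.\<close>

lemma finite_support_induct [consumes 1, case_names zero add_point]:
  assumes "f \<in> carrier (permutation_module G B \<phi> :: ('k::field, 'b \<Rightarrow> 'k, 'g) gmodule)"
    and zero: "P (\<lambda>x. 0)"
    and add_point: "\<And>f x c. f \<in> carrier (permutation_module G B \<phi> :: ('k, 'b \<Rightarrow> 'k, 'g) gmodule) \<Longrightarrow>
      x \<in> B \<Longrightarrow> P f \<Longrightarrow> P (\<lambda>y. f y + c * point x y)"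
  shows "P f"
proof -
  have "P f" if "finite A" "{x. f x \<noteq> 0} \<subseteq> A" "A \<subseteq> B" for A f
    using that
  proof (induction A arbitrary: f rule: finite_induct)
    case empty
    then have "f = (\<lambda>x. 0)" by auto
    then show ?case using zero by simp
  next
    case (insert x A)
    have P0: "P (f(x := 0))" using insert.prems by (intro insert.IH) auto
    have "{y. (f(x := 0)) y \<noteq> 0} \<subseteq> A" using insert.prems by auto
    then have "finite {y. (f(x := 0)) y \<noteq> 0}" using insert.hyps(1) by (rule finite_subset)
    then have f0: "f(x := 0) \<in> carrier (permutation_module G B \<phi>)"
      unfolding carrier_permutation_module using insert.prems by auto
    have "P (\<lambda>y. (f(x := 0)) y + f x * point x y)"
      using insert.prems by (intro add_point[OF f0 _ P0]) auto
    moreover have "(\<lambda>y. (f(x := 0)) y + f x * point x y) = f" by (auto simp: point_def)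
    ultimately show ?case by simp
  qed
  moreover have "finite {x. f x \<noteq> 0}" "{x. f x \<noteq> 0} \<subseteq> B"
    using assms(1) by (auto simp: carrier_permutation_module)
  ultimately show ?thesis by blast
qed

lemma point_closed: "x \<in> B \<Longrightarrow> point x \<in> carrier (permutation_module G B \<phi>)"
  by (auto simp: carrier_permutation_module point_def)

lemma point_apply: "point x y = (if y = x then 1 else 0)"
  by (simp add: point_def)

lemma linear_functional_permutation_module:
  assumes "linear_functional (permutation_module G B \<phi> :: ('k::field, 'b \<Rightarrow> 'k, 'g) gmodule) L"
    and "f \<in> carrier (permutation_module G B \<phi> :: ('k, 'b \<Rightarrow> 'k, 'g) gmodule)"
    and "finite A" "{x. f x \<noteq> 0} \<subseteq> A"
  shows "L f = (\<Sum>x\<in>A. f x * L (point x))"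
proof -
  let ?M = "permutation_module G B \<phi> :: ('k, 'b \<Rightarrow> 'k, 'g) gmodule"
  \<comment> \<open>Quantified over \<open>A\<close> because the new coefficient may cancel at
    \<open>x\<close>: a set containing the new support can then miss \<open>x\<close>, and the
    induction hypothesis is applied to \<open>insert x A\<close>.\<close>
  have "\<forall>A. finite A \<and> {x. f x \<noteq> 0} \<subseteq> A \<longrightarrow> L f = (\<Sum>x\<in>A. f x * L (point x))"
    using assms(2)
  proof (induction rule: finite_support_induct)
    case zero
    have "(\<lambda>x. 0) \<in> carrier ?M" by (simp add: carrier_permutation_module)
    then have "L (\<lambda>x. 0) = L (\<lambda>x. 0) + L (\<lambda>x. 0)"
      using linear_functional_add[OF assms(1), of "\<lambda>x. 0" "\<lambda>x. 0"] by (simp add: permutation_module_def)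
    then have "L (\<lambda>x. 0) = 0" by (metis add_cancel_right_right)
    then show ?case by simp
  next
    case (add_point f x c)
    have px: "point x \<in> carrier ?M" using add_point by (intro point_closed)
    have cpx: "(\<lambda>y. c * point x y) \<in> carrier ?M"
      using add_point by (auto simp: carrier_permutation_module point_def)
    have "L (\<lambda>y. f y + c * point x y) = L f + L (\<lambda>y. c * point x y)"
      using linear_functional_add[OF assms(1) add_point.hyps(1) cpx] by (simp add: permutation_module_def)
    also have "L (\<lambda>y. c * point x y) = c * L (point x)"
      using linear_functional_smult[OF assms(1) px] by (simp add: permutation_module_def)
    finally have L: "L (\<lambda>y. f y + c * point x y) = L f + c * L (point x)" .
    show ?case
    proof (intro allI impI)
      fix A assume A: "finite A \<and> {y. f y + c * point x y \<noteq> 0} \<subseteq> A"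
      let ?A = "insert x A"
      have fA: "finite ?A" using A by simp
      have "{y. f y \<noteq> 0} \<subseteq> ?A" using A by (auto simp: point_def split: if_splits)
      then have "L f = (\<Sum>y\<in>?A. f y * L (point y))" using add_point.IH fA by blast
      moreover have "c * L (point x) = (\<Sum>y\<in>?A. c * point x y * L (point y))"
        using fA by (simp add: point_apply if_distrib[of "\<lambda>u. _ * u"] if_distrib[of "\<lambda>u. u * _"] cong: if_cong)
      ultimately have "L (\<lambda>y. f y + c * point x y) = (\<Sum>y\<in>?A. (f y + c * point x y) * L (point y))"
        unfolding L by (simp only: sum.distrib distrib_right)
      also have "\<dots> = (\<Sum>y\<in>A. (f y + c * point x y) * L (point y))"
        using A by (intro sum.mono_neutral_right) auto
      finally show "L (\<lambda>y. f y + c * point x y) = (\<Sum>y\<in>A. (f y + c * point x y) * L (point y))" .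
    qed
  qed
  then show ?thesis using assms by blast
qed

section \<open>Projectivity of monomial modules\<close>

context gmodule begin

text \<open>The unqualified names of these facts refer to the scalar ring.\<close>

lemmas G_assoc = monoid.m_assoc[OF group.is_monoid[OF group_axioms]]
lemmas G_pow_Suc2 = monoid.nat_pow_Suc2[OF group.is_monoid[OF group_axioms]]

lemma act_closed: "g \<in> carrier G \<Longrightarrow> v \<in> carrier V \<Longrightarrow> act V g v \<in> carrier V"
  using act_hom[of g] by (auto simp: LinearCombinations.module_hom_def)

lemma linear_functional_act:
  assumes "linear_functional V f" "g \<in> carrier G"
  shows "linear_functional V (\<lambda>v. f (act V g v))"
  using act_hom[OF assms(2)] assms act_closed[OF assms(2)]
  unfolding LinearCombinations.module_hom_def linear_functional_def
  by (auto simp: class_ring_simps)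

end

lemma gmodule_hom_closed: "h \<in> gmodule_hom G V W \<Longrightarrow> v \<in> carrier V \<Longrightarrow> h v \<in> carrier W"
  by (auto simp: gmodule_hom_def LinearCombinations.module_hom_def)

lemma gmodule_hom_act:
  "h \<in> gmodule_hom G V W \<Longrightarrow> g \<in> carrier G \<Longrightarrow> v \<in> carrier V \<Longrightarrow> h (act V g v) = act W g (h v)"
  by (simp add: gmodule_hom_def)

lemma linear_functional_comp_hom:
  assumes "linear_functional W f" "h \<in> gmodule_hom G V W"
  shows "linear_functional V (\<lambda>v. f (h v))"
  using assms unfolding gmodule_hom_def LinearCombinations.module_hom_def linear_functional_def
  by (auto simp: class_ring_simps Pi_iff)

text \<open>The Frobenius map is additive, so \<open>x - 1\<close> has vanishing \<open>p\<close>th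
  power.\<close>

lemma eq_one_of_power_char:
  fixes x :: "'k::field"
  assumes "prime CHAR('k)" "x ^ CHAR('k) = 1"
  shows "x = 1"
proof -
  have "((x - 1) + 1) ^ CHAR('k) = (x - 1) ^ CHAR('k) + 1 ^ CHAR('k)"
    by (rule freshmans_dream) (use assms in auto)
  then show ?thesis using assms by (simp add: power_0_left)
qed

locale monomial_gmodule = gmodule G V + coordinates V I e D
  for G :: "('g, 'z) monoid_scheme" (structure)
    and V :: "('k::field, 'v, 'g, 'e) gmodule_scheme" and I :: "'i set" and e D +
  fixes \<phi> :: "'g \<Rightarrow> 'i \<Rightarrow> 'i"
  assumes finite_carrier: "finite (carrier G)"
    and action_closed: "g \<in> carrier G \<Longrightarrow> x \<in> I \<Longrightarrow> \<phi> g x \<in> I"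
    and action_one: "x \<in> I \<Longrightarrow> \<phi> \<one> x = x"
    and action_mult: "g \<in> carrier G \<Longrightarrow> h \<in> carrier G \<Longrightarrow> x \<in> I \<Longrightarrow> \<phi> (g \<otimes> h) x = \<phi> g (\<phi> h x)"
    and monomial: "g \<in> carrier G \<Longrightarrow> x \<in> I \<Longrightarrow> y \<in> I \<Longrightarrow> \<phi> g x \<noteq> y \<Longrightarrow> D y (act V g (e x)) = 0"
begin

lemma action_inv:
  assumes "g \<in> carrier G" "x \<in> I"
  shows "\<phi> g (\<phi> (inv g) x) = x" "\<phi> (inv g) (\<phi> g x) = x"
  using assms by (simp_all flip: action_mult add: action_one)

lemma D_act:
  assumes "g \<in> carrier G" "x \<in> I" "v \<in> carrier V"
  shows "D x (act V g v) = D (\<phi> (inv g) x) v * D x (act V g (e (\<phi> (inv g) x)))"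
proof -
  let ?y = "\<phi> (inv g) x"
  have y: "?y \<in> I" using assms by (simp add: action_closed)
  have "D x (act V g v) = (\<Sum>y\<in>I. D y v * D x (act V g (e y)))"
    using assms by (intro linear_functional_expansion linear_functional_act D_linear)
  also have "\<dots> = (\<Sum>y\<in>{?y}. D y v * D x (act V g (e y)))"
  proof (rule sum.mono_neutral_right[OF finite_index])
    show "\<forall>y\<in>I - {?y}. D y v * D x (act V g (e y)) = 0"
    proof
      fix z assume z: "z \<in> I - {?y}"
      then have "\<phi> g z \<noteq> x" using action_inv(2)[OF assms(1), of z] by auto
      then show "D z v * D x (act V g (e z)) = 0" using monomial assms z by auto
    qed
  qed (use y in auto)
  finally show ?thesis by simp
qed

lemma D_act_stabilizer:
  assumes "g \<in> carrier G" "x \<in> I" "\<phi> g x = x" "v \<in> carrier V"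
  shows "D x (act V g v) = D x v * D x (act V g (e x))"
  using D_act[OF assms(1,2,4)] action_inv(2)[OF assms(1,2)] assms(3) by simp

text \<open>The scalar by which \<open>g\<close> acts on \<open>e x\<close> is a \<open>p\<close>th root of unity, hence trivial in
  characteristic \<open>p\<close>.\<close>

lemma prime_stabilizer_acts_trivially:
  assumes p: "prime CHAR('k)" and g: "g \<in> carrier G" "g [^] CHAR('k) = \<one>" and x: "x \<in> I" "\<phi> g x = x"
  shows "D x (act V g (e x)) = 1" and "act V g (e x) = e x"
proof -
  let ?c = "D x (act V g (e x))"
  have "D x (act V (g [^] m) (e x)) = ?c ^ m" for m :: nat
  proof (induction m)
    case 0
    then show ?case using x e_closed D_e by (simp add: act_one)
  next
    case (Suc m)
    have "act V (g [^] Suc m) (e x) = act V g (act V (g [^] m) (e x))"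
      unfolding G_pow_Suc2[OF g(1)] using g x e_closed by (intro act_mult) auto
    moreover have "act V (g [^] m) (e x) \<in> carrier V" using g(1) x(1) e_closed by (intro act_closed) auto
    ultimately show ?case using D_act_stabilizer[OF g(1) x] Suc by (simp only: power_Suc2)
  qed
  from this[of "CHAR('k)"] have "?c ^ CHAR('k) = 1" using g x e_closed D_e by (simp add: act_one)
  then show c: "?c = 1" by (rule eq_one_of_power_char[OF p])
  show "act V g (e x) = e x"
  proof (rule eqI_coordinates)
    fix y assume y: "y \<in> I"
    show "D y (act V g (e x)) = D y (e x)"
      using monomial[OF g(1) x(1) y] c D_e[OF y x(1)] x(2) by (cases "y = x") auto
  qed (use g x e_closed act_closed in auto)
qed

lemma not_projective_of_fixed:
  assumes p: "prime CHAR('k)" and g: "g \<in> carrier G" "g \<noteq> \<one>" "g [^] CHAR('k) = \<one>"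
    and x: "x \<in> I" "\<phi> g x = x"
  shows "\<not> projective_gmodule G V"
proof
  assume "projective_gmodule G V"
  then obtain X :: "'v set" and i r where
    i: "i \<in> gmodule_hom G V (free_gmodule G X)" and r: "r \<in> gmodule_hom G (free_gmodule G X) V"
    and ri: "\<And>v. v \<in> carrier V \<Longrightarrow> r (i v) = v"
    unfolding projective_gmodule_def by blast
  let ?F = "free_gmodule G X :: ('k, 'v \<times> 'g \<Rightarrow> 'k, 'g) gmodule"
  \<comment> \<open>\<open>f\<close> is an invariant vector of the free module and \<open>L\<close>
    an invariant functional. The value \<open>L f\<close> is 1 because \<open>r\<close> splits
    \<open>i\<close>, and 0 because it is a sum over orbits of the left translation
    \<open>t\<close>, which moves every basis point as \<open>g\<close> is not the identity.\<close>
  define f where "f = i (e x)"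
  define L where "L f = D x (r f)" for f
  define t where "t = (\<lambda>(y :: 'v, h). (y, g \<otimes> h))"
  let ?A = "{y. f y \<noteq> 0}"
  have fF: "f \<in> carrier ?F"
    unfolding f_def using i e_closed[OF x(1)] by (rule gmodule_hom_closed)
  then have fin: "finite ?A" and supp: "?A \<subseteq> X \<times> carrier G"
    by (auto simp: free_gmodule_def carrier_permutation_module)
  have gf: "act ?F g f = f"
    using gmodule_hom_act[OF i g(1) e_closed[OF x(1)]]
      prime_stabilizer_acts_trivially(2)[OF p g(1,3) x] by (simp add: f_def)
  have ft: "f (t y) = f y" if y: "y \<in> X \<times> carrier G" for y
  proof -
    obtain u h where uh: "y = (u, h)" "u \<in> X" "h \<in> carrier G" using y by auto
    have "f (u, inv g \<otimes> (g \<otimes> h)) = act ?F g f (u, g \<otimes> h)"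
      using uh g(1) by (simp add: free_gmodule_def permutation_module_def)
    moreover have "inv g \<otimes> (g \<otimes> h) = h" using g(1) uh by (simp add: G_assoc[symmetric])
    ultimately show ?thesis by (simp add: gf t_def uh)
  qed
  have L: "linear_functional ?F L"
    unfolding L_def using D_linear[OF x(1)] r by (rule linear_functional_comp_hom)
  have Lt: "L (point (t y)) = L (point y)" if y: "y \<in> X \<times> carrier G" for y
  proof -
    have py: "point y \<in> carrier ?F" unfolding free_gmodule_def using y by (rule point_closed)
    have "act ?F g (point y) = point (t y)"
      unfolding free_gmodule_def t_def using g(1) y
      by (subst act_permutation_module_point) (auto simp: G_assoc group_axioms)
    then have "r (point (t y)) = act V g (r (point y))" using gmodule_hom_act[OF r g(1) py] by simp
    moreover have "r (point y) \<in> carrier V" using r py by (rule gmodule_hom_closed)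
    ultimately show ?thesis
      using D_act_stabilizer[OF g(1) x] prime_stabilizer_acts_trivially(1)[OF p g(1,3) x]
      by (simp add: L_def)
  qed
  have pow: "(t ^^ m) y = (fst y, g [^] m \<otimes> snd y)" if "snd y \<in> carrier G" for m :: nat and y
  proof (induction m)
    case (Suc m)
    have "g [^] Suc m \<otimes> snd y = g \<otimes> (g [^] m \<otimes> snd y)"
      unfolding G_pow_Suc2[OF g(1)] using that g(1) by (simp add: G_assoc)
    then show ?case using Suc by (simp add: t_def del: nat_pow_Suc)
  qed (use that in simp)
  have "(\<Sum>y\<in>?A. f y * L (point y)) = 0"
  proof (rule sum_fixed_point_free[OF p fin, of t])
    show "t ` ?A \<subseteq> ?A" using ft supp by auto
    show "\<forall>y\<in>?A. (t ^^ CHAR('k)) y = y" using supp pow g by auto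
    show "\<forall>y\<in>?A. t y \<noteq> y" using supp g by (auto simp: t_def)
    show "f (t y) * L (point (t y)) = f y * L (point y)" if "y \<in> ?A" for y
      using that supp ft Lt by auto
  qed simp
  moreover have "L f = (\<Sum>y\<in>?A. f y * L (point y))"
    using L fF fin unfolding free_gmodule_def by (rule linear_functional_permutation_module) auto
  moreover have "L f = 1" unfolding L_def f_def using ri[OF e_closed[OF x(1)]] D_e[OF x(1,1)] by simp
  ultimately show False by simp
qed

end

text \<open>Cauchy's theorem inside \<open>H\<close>. Sylow's theorem is applied to the exponent 1,
  with a cofactor \<open>m\<close> that may still be divisible by \<open>p\<close>; every nontrivial
  element of the resulting subgroup of order \<open>p\<close> will do.\<close>

lemma (in group) exists_prime_order_element:
  assumes p: "prime p" and fin: "finite (carrier G)" and H: "subgroup H G" and dvd: "p dvd card H"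
  shows "\<exists>g\<in>H. g \<noteq> \<one> \<and> g [^] p = \<one>"
proof -
  let ?H = "G\<lparr>carrier := H\<rparr>"
  have gH: "group ?H" by (rule subgroup_imp_group[OF H])
  have finH: "finite H" using fin subgroup.subset[OF H] by (rule rev_finite_subset)
  obtain m where m: "order ?H = p ^ 1 * m" using dvd by (auto simp: Coset.order_def)
  obtain K where K: "subgroup K ?H" "card K = p"
    using sylow_thm[OF p gH m] finH by auto
  let ?K = "?H\<lparr>carrier := K\<rparr>"
  have gK: "group ?K" by (rule group.subgroup_imp_group[OF gH K(1)])
  have sub: "K \<subseteq> H" using subgroup.subset[OF K(1)] by simp
  have "card {\<one>} < card K" using K(2) prime_gt_1_nat[OF p] by simp
  then obtain g where g: "g \<in> K" "g \<noteq> \<one>"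
    by (metis card_mono finite.emptyI finite_insert leD singletonI subset_iff)
  have "g [^]\<^bsub>?K\<^esub> order ?K = \<one>\<^bsub>?K\<^esub>" by (rule group.pow_order_eq_1[OF gK]) (use g in simp)
  then have "g [^] p = \<one>" using K(2) by (simp add: Coset.order_def nat_pow_def)
  then show ?thesis using g sub by auto
qed

text \<open>One representative \<open>y\<close> of each orbit carries the weight
  \<open>1 / of_nat (card (Stab y))\<close>. The group elements taking \<open>y\<close> to a given
  point of its orbit form a coset of the stabiliser, so the weights add up to 1. By Cauchy's theorem
  \<open>p\<close> does not divide the order of a stabiliser, which is therefore invertible in the
  field.\<close>

lemma (in group) averaging_weights:
  fixes \<phi> :: "'a \<Rightarrow> 'i \<Rightarrow> 'i"
  assumes fin: "finite (carrier G)"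
    and closed: "\<And>g x. g \<in> carrier G \<Longrightarrow> x \<in> I \<Longrightarrow> \<phi> g x \<in> I"
    and one: "\<And>x. x \<in> I \<Longrightarrow> \<phi> \<one> x = x"
    and mult: "\<And>g h x. g \<in> carrier G \<Longrightarrow> h \<in> carrier G \<Longrightarrow> x \<in> I \<Longrightarrow> \<phi> (g \<otimes> h) x = \<phi> g (\<phi> h x)"
    and p: "prime CHAR('k::field)"
    and free: "\<And>g x. g \<in> carrier G \<Longrightarrow> g \<noteq> \<one> \<Longrightarrow> g [^] CHAR('k) = \<one> \<Longrightarrow> x \<in> I \<Longrightarrow> \<phi> g x \<noteq> x"
  shows "\<exists>c :: 'i \<Rightarrow> 'k. \<forall>x\<in>I. (\<Sum>g\<in>carrier G. c (\<phi> (inv g) x)) = 1"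
proof -
  define Stab where "Stab x = {g \<in> carrier G. \<phi> g x = x}" for x
  define Orb where "Orb x = (\<lambda>g. \<phi> g x) ` carrier G" for x
  \<comment> \<open>The choice depends only on the orbit as a set, so all points of an orbit share
    one representative.\<close>
  define rep where "rep x = (SOME y. y \<in> Orb x)" for x
  define c where "c x = (if rep x = x then 1 / of_nat (card (Stab x)) else 0 :: 'k)" for x
  have inv_cancel: "\<phi> (inv g) (\<phi> g x) = x" "\<phi> g (\<phi> (inv g) x) = x" if "g \<in> carrier G" "x \<in> I" for g x
    using mult[of "inv g" g x] mult[of g "inv g" x] that one by simp_all
  have Orb_self: "x \<in> Orb x" if "x \<in> I" for x
    unfolding Orb_def using that one by (intro image_eqI[of _ _ \<one>]) auto
  have Orb_eq: "Orb (\<phi> g x) = Orb x" if "g \<in> carrier G" "x \<in> I" for g x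
  proof
    show "Orb (\<phi> g x) \<subseteq> Orb x"
    proof
      fix y assume "y \<in> Orb (\<phi> g x)"
      then obtain h where h: "h \<in> carrier G" "y = \<phi> h (\<phi> g x)" by (auto simp: Orb_def)
      then have "y = \<phi> (h \<otimes> g) x" using that mult by simp
      then show "y \<in> Orb x" unfolding Orb_def using h that by blast
    qed
    show "Orb x \<subseteq> Orb (\<phi> g x)"
    proof
      fix y assume "y \<in> Orb x"
      then obtain h where h: "h \<in> carrier G" "y = \<phi> h x" by (auto simp: Orb_def)
      then have "y = \<phi> (h \<otimes> inv g) (\<phi> g x)" using that mult[of h "inv g" "\<phi> g x"] closed inv_cancel by simp
      then show "y \<in> Orb (\<phi> g x)" unfolding Orb_def using h that by blast
    qed
  qed
  have Stab_nonzero: "of_nat (card (Stab x)) \<noteq> (0 :: 'k)" if x: "x \<in> I" for x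
  proof
    assume "of_nat (card (Stab x)) = (0 :: 'k)"
    then have "CHAR('k) dvd card (Stab x)" by (simp add: of_nat_eq_0_iff_char_dvd)
    moreover have "subgroup (Stab x) G"
    proof (rule subgroupI)
      show "inv g \<in> Stab x" if "g \<in> Stab x" for g
        using that x inv_cancel(1)[of g x] by (simp add: Stab_def)
    qed (use x one mult in \<open>auto simp: Stab_def\<close>)
    ultimately obtain g where "g \<in> Stab x" "g \<noteq> \<one>" "g [^] CHAR('k) = \<one>"
      using exists_prime_order_element[OF p fin] by blast
    then show False using free x by (auto simp: Stab_def)
  qed
  have "(\<Sum>g\<in>carrier G. c (\<phi> (inv g) x)) = 1" if x: "x \<in> I" for x
  proof -
    let ?r = "rep x"
    have "?r \<in> Orb x" unfolding rep_def by (rule someI[of "\<lambda>y. y \<in> Orb x"]) (rule Orb_self[OF x])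
    then obtain h where h: "h \<in> carrier G" "?r = \<phi> h x" by (auto simp: Orb_def)
    have rI: "?r \<in> I" using h x closed by simp
    have rep: "rep (\<phi> g x) = ?r" if "g \<in> carrier G" for g
      using Orb_eq[OF that x] by (simp add: rep_def)
    have "(\<Sum>g\<in>carrier G. c (\<phi> (inv g) x)) =
        (\<Sum>g\<in>carrier G. if \<phi> (inv g) x = ?r then 1 / of_nat (card (Stab ?r)) else 0)"
      using rep by (intro sum.cong) (auto simp: c_def)
    also have "\<dots> = of_nat (card {g \<in> carrier G. \<phi> (inv g) x = ?r}) / of_nat (card (Stab ?r))"
      using fin by (simp add: sum.If_cases Int_def)
    also have "card {g \<in> carrier G. \<phi> (inv g) x = ?r} = card (Stab ?r)"
    proof (rule bij_betw_same_card, rule bij_betw_byWitness)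
      \<comment> \<open>With \<open>\<phi> h x = ?r\<close>, left multiplication by \<open>h\<close>
        carries the coset of elements sending \<open>?r\<close> to \<open>x\<close> onto the
        stabiliser of \<open>?r\<close>.\<close>
      let ?f = "\<lambda>g. h \<otimes> g" and ?f' = "\<lambda>g. inv h \<otimes> g"
      show "\<forall>g\<in>{g \<in> carrier G. \<phi> (inv g) x = ?r}. ?f' (?f g) = g"
        "\<forall>g\<in>Stab ?r. ?f (?f' g) = g"
        using h(1) by (auto simp: Stab_def m_assoc[symmetric])
      show "?f ` {g \<in> carrier G. \<phi> (inv g) x = ?r} \<subseteq> Stab ?r"
      proof
        fix k assume "k \<in> ?f ` {g \<in> carrier G. \<phi> (inv g) x = ?r}"
        then obtain g where g: "g \<in> carrier G" "\<phi> (inv g) x = ?r" "k = h \<otimes> g" by auto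
        have "\<phi> g ?r = x" using inv_cancel(2)[OF g(1) x] g(2) by simp
        then have "\<phi> (h \<otimes> g) ?r = ?r" using mult[OF h(1) g(1) rI] h(2) by simp
        then show "k \<in> Stab ?r" using g h(1) by (simp add: Stab_def)
      qed
      show "?f' ` Stab ?r \<subseteq> {g \<in> carrier G. \<phi> (inv g) x = ?r}"
      proof
        fix k assume "k \<in> ?f' ` Stab ?r"
        then obtain g where g: "g \<in> carrier G" "\<phi> g ?r = ?r" "k = inv h \<otimes> g" by (auto simp: Stab_def)
        have "\<phi> (inv k) x = \<phi> (inv g \<otimes> h) x" using g h by (simp add: inv_mult_group)
        also have "\<dots> = \<phi> (inv g) ?r" using g h x by (simp add: mult)
        also have "\<dots> = ?r" using inv_cancel(1)[OF g(1) rI] g(2) by simp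
        finally show "k \<in> {g \<in> carrier G. \<phi> (inv g) x = ?r}" using g h by simp
      qed
    qed
    finally show ?thesis using Stab_nonzero[OF rI] by simp
  qed
  then show ?thesis by blast
qed

context monomial_gmodule begin

lemma act_mult_inv:
  assumes "g \<in> carrier G" "v \<in> carrier V"
  shows "act V g (act V (inv g) v) = v"
  using act_mult[of g "inv g" v] assms by (simp add: act_one)

text \<open>Higman's criterion: with weights \<open>c\<close> as in \<open>averaging_weights\<close>, the diagonal endomorphism
  \<open>e x \<mapsto> c x e x\<close> has \<open>G\<close>-trace the identity. Here \<open>i\<close> is the \<open>G\<close>-average of its linear lift
  to the free module on the basis, and \<open>r\<close> is the canonical map from that free module.\<close>

lemma projective_of_weights:
  fixes c :: "'i \<Rightarrow> 'k"
  assumes c: "\<And>x. x \<in> I \<Longrightarrow> (\<Sum>g\<in>carrier G. c (\<phi> (inv g) x)) = 1"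
  shows "projective_gmodule G V"
proof -
  \<comment> \<open>Projectivity asks for an index set in the type of the vectors, so the copies of
    the regular module are labelled by the basis vectors \<open>e x\<close>; \<open>s\<close>
    recovers the index.\<close>
  let ?F = "free_gmodule G (e ` I) :: ('k, 'v \<times> 'g \<Rightarrow> 'k, 'g) gmodule"
  define s where "s = inv_into I e"
  have s: "s (e x) = x" if "x \<in> I" for x unfolding s_def using inj_on_e that by simp
  define i where "i v = (\<lambda>(u, g). if u \<in> e ` I \<and> g \<in> carrier G then c (s u) * D (s u) (act V (inv g) v) else 0)"
    for v
  define r where "r f = finsum V (\<lambda>(x, g). f (e x, g) \<odot>\<^bsub>V\<^esub> act V g (e x)) (I \<times> carrier G)" for f
  have carrF: "f \<in> carrier ?F \<longleftrightarrow> (\<forall>y. y \<notin> e ` I \<times> carrier G \<longrightarrow> f y = 0)" for f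
  proof -
    have "finite (e ` I \<times> carrier G)" using finite_index finite_carrier by simp
    moreover have "{y. f y \<noteq> 0} \<subseteq> e ` I \<times> carrier G" if "\<forall>y. y \<notin> e ` I \<times> carrier G \<longrightarrow> f y = 0"
      using that by auto
    ultimately show ?thesis
      unfolding free_gmodule_def carrier_permutation_module using finite_subset by blast
  qed
  have addF: "f \<oplus>\<^bsub>?F\<^esub> h = (\<lambda>x. f x + h x)" for f h
    by (simp add: free_gmodule_def permutation_module_def)
  have smultF: "a \<odot>\<^bsub>?F\<^esub> f = (\<lambda>x. a * f x)" for a f
    by (simp add: free_gmodule_def permutation_module_def)
  have actF: "act ?F g f = (\<lambda>(u, h). if u \<in> e ` I \<and> h \<in> carrier G then f (u, inv g \<otimes> h) else 0)" for g f
    by (simp add: free_gmodule_def permutation_module_def fun_eq_iff)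
  have term_closed: "f (e x, g) \<odot>\<^bsub>V\<^esub> act V g (e x) \<in> carrier V" if "x \<in> I" "g \<in> carrier G" for f x g
    using that e_closed act_closed by (simp add: class_ring_simps)
  have r_closed: "r f \<in> carrier V" for f
    unfolding r_def using term_closed by (intro finsum_closed) auto
  have r_functional: "L (r f) = (\<Sum>(x, g)\<in>I \<times> carrier G. f (e x, g) * L (act V g (e x)))"
    if L: "linear_functional V L" for L f
  proof -
    have "L (r f) = (\<Sum>(x, g)\<in>I \<times> carrier G. L (f (e x, g) \<odot>\<^bsub>V\<^esub> act V g (e x)))"
      unfolding r_def case_prod_unfold
      by (rule linear_functional_finsum[OF L module_axioms]) (use term_closed in auto)
    also have "\<dots> = (\<Sum>(x, g)\<in>I \<times> carrier G. f (e x, g) * L (act V g (e x)))"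
      using linear_functional_smult[OF L] e_closed act_closed by (intro sum.cong) auto
    finally show ?thesis .
  qed
  note r_D = r_functional[OF D_linear]
  have "i \<in> gmodule_hom G V ?F"
    unfolding gmodule_hom_def LinearCombinations.module_hom_def
  proof (intro CollectI conjI allI impI ballI funcsetI; (elim conjE)?)
    have D_in: "s u \<in> I" if "u \<in> e ` I" for u using that s by auto
    note lin = linear_functional_act[OF D_linear[OF D_in] inv_closed]
    show "i v \<in> carrier ?F" for v by (auto simp: carrF i_def)
    show "i (v \<oplus>\<^bsub>V\<^esub> w) = i v \<oplus>\<^bsub>?F\<^esub> i w" if "v \<in> carrier V" "w \<in> carrier V" for v w
      using linear_functional_add[OF lin] that by (auto simp: i_def addF fun_eq_iff distrib_left)
    show "i (a \<odot>\<^bsub>V\<^esub> v) = a \<odot>\<^bsub>?F\<^esub> i v" if "v \<in> carrier V" for a v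
      using linear_functional_smult[OF lin] that by (auto simp: i_def smultF fun_eq_iff)
    show "i (act V g v) = act ?F g (i v)" if g: "g \<in> carrier G" and v: "v \<in> carrier V" for g v
    proof (rule ext, clarify)
      fix u h
      show "i (act V g v) (u, h) = act ?F g (i v) (u, h)"
      proof (cases "u \<in> e ` I \<and> h \<in> carrier G")
        case True
        then have "act V (inv (inv g \<otimes> h)) v = act V (inv h) (act V g v)"
          using g v act_mult[of "inv h" g v] by (simp add: inv_mult_group)
        then show ?thesis using True g by (simp add: i_def actF)
      qed (auto simp: i_def actF)
    qed
  qed
  moreover have "r \<in> gmodule_hom G ?F V"
    unfolding gmodule_hom_def LinearCombinations.module_hom_def
  proof (intro CollectI conjI allI impI ballI funcsetI; (elim conjE)?)
    show "r f \<in> carrier V" for f by (rule r_closed)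
    show "r (f \<oplus>\<^bsub>?F\<^esub> h) = r f \<oplus>\<^bsub>V\<^esub> r h" for f h
      by (rule eqI_coordinates)
        (use r_closed linear_functional_add[OF D_linear] in
          \<open>simp_all add: r_D addF distrib_right sum.distrib case_prod_unfold\<close>)
    show "r (a \<odot>\<^bsub>?F\<^esub> f) = a \<odot>\<^bsub>V\<^esub> r f" for a f
      by (rule eqI_coordinates)
        (use r_closed linear_functional_smult[OF D_linear] in
          \<open>simp_all add: r_D smultF sum_distrib_left case_prod_unfold class_ring_simps mult.assoc\<close>)
    show "r (act ?F g f) = act V g (r f)" if g: "g \<in> carrier G" for g f
    proof (rule eqI_coordinates)
      fix y assume y: "y \<in> I"
      have "D y (r (act ?F g f)) =
          (\<Sum>x\<in>I. \<Sum>h\<in>carrier G. f (e x, inv g \<otimes> h) * D y (act V h (e x)))"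
        unfolding r_D[OF y] sum.cartesian_product[symmetric]
        by (intro sum.cong) (auto simp: actF)
      also have "\<dots> = (\<Sum>x\<in>I. \<Sum>h\<in>carrier G. f (e x, h) * D y (act V g (act V h (e x))))"
      proof (rule sum.cong[OF refl])
        fix x assume x: "x \<in> I"
        have can: "inv g \<otimes> (g \<otimes> h) = h" "g \<otimes> (inv g \<otimes> h) = h" if "h \<in> carrier G" for h
          using g that by (simp_all add: G_assoc[symmetric])
        show "(\<Sum>h\<in>carrier G. f (e x, inv g \<otimes> h) * D y (act V h (e x))) =
            (\<Sum>h\<in>carrier G. f (e x, h) * D y (act V g (act V h (e x))))"
          by (rule sum.reindex_bij_witness[where i = "\<lambda>h. g \<otimes> h" and j = "\<lambda>h. inv g \<otimes> h"])
            (use g x e_closed can in \<open>auto simp: act_mult[symmetric]\<close>)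
      qed
      also have "\<dots> = D y (act V g (r f))"
        unfolding r_functional[OF linear_functional_act[OF D_linear[OF y] g]] sum.cartesian_product ..
      finally show "D y (r (act ?F g f)) = D y (act V g (r f))" .
    qed (use g r_closed act_closed in auto)
  qed
  moreover have "r (i v) = v" if v: "v \<in> carrier V" for v
  proof (rule eqI_coordinates)
    fix y assume y: "y \<in> I"
    have "D y (r (i v)) = (\<Sum>x\<in>I. \<Sum>g\<in>carrier G. c x * D x (act V (inv g) v) * D y (act V g (e x)))"
      unfolding r_D[OF y] sum.cartesian_product[symmetric]
      by (intro sum.cong) (auto simp: i_def s)
    also have "\<dots> = (\<Sum>g\<in>carrier G. \<Sum>x\<in>I. c x * D x (act V (inv g) v) * D y (act V g (e x)))"
      by (rule sum.swap)
    \<comment> \<open>For each \<open>g\<close> only \<open>x = \<phi> (inv g) y\<close> survives,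
      and by \<open>D_act\<close> the two remaining factors recombine to the coordinate of
      \<open>act V g (act V (inv g) v) = v\<close>. The unknown monomial scalar thus
      disappears.\<close>
    also have "\<dots> = (\<Sum>g\<in>carrier G. c (\<phi> (inv g) y) * D y v)"
    proof (rule sum.cong[OF refl])
      fix g assume g: "g \<in> carrier G"
      let ?y = "\<phi> (inv g) y"
      have "(\<Sum>x\<in>I. c x * D x (act V (inv g) v) * D y (act V g (e x))) =
          (\<Sum>x\<in>{?y}. c x * D x (act V (inv g) v) * D y (act V g (e x)))"
      proof (rule sum.mono_neutral_right[OF finite_index])
        show "\<forall>x\<in>I - {?y}. c x * D x (act V (inv g) v) * D y (act V g (e x)) = 0"
        proof
          fix x assume x: "x \<in> I - {?y}"
          then have "\<phi> g x \<noteq> y" using action_inv(2)[OF g, of x] by auto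
          then show "c x * D x (act V (inv g) v) * D y (act V g (e x)) = 0"
            using monomial[OF g _ y] x by simp
        qed
      qed (use action_closed g y in auto)
      also have "\<dots> = c ?y * D y (act V g (act V (inv g) v))"
        using D_act[OF g y, of "act V (inv g) v"] g v act_closed by simp
      also have "\<dots> = c ?y * D y v" using act_mult_inv[OF g v] by simp
      finally show "(\<Sum>x\<in>I. c x * D x (act V (inv g) v) * D y (act V g (e x))) = c ?y * D y v" .
    qed
    also have "\<dots> = D y v" using c[OF y] by (simp flip: sum_distrib_right)
    finally show "D y (r (i v)) = D y v" .
  qed (use v r_closed in auto)
  ultimately show ?thesis
    unfolding projective_gmodule_def using gmodule_axioms by blast
qed

theorem projective_iff:
  assumes p: "prime CHAR('k)"
  shows "projective_gmodule G V \<longleftrightarrow>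
    \<not> (\<exists>g\<in>carrier G. g \<noteq> \<one> \<and> g [^] CHAR('k) = \<one> \<and> (\<exists>x\<in>I. \<phi> g x = x))"
proof
  show "\<not> (\<exists>g\<in>carrier G. g \<noteq> \<one> \<and> g [^] CHAR('k) = \<one> \<and> (\<exists>x\<in>I. \<phi> g x = x))"
    if "projective_gmodule G V"
    using not_projective_of_fixed[OF p] that by blast
next
  assume *: "\<not> (\<exists>g\<in>carrier G. g \<noteq> \<one> \<and> g [^] CHAR('k) = \<one> \<and> (\<exists>x\<in>I. \<phi> g x = x))"
  have "\<exists>c :: 'i \<Rightarrow> 'k. \<forall>x\<in>I. (\<Sum>g\<in>carrier G. c (\<phi> (inv g) x)) = 1"
    by (rule group.averaging_weights[OF group_axioms finite_carrier])
      (use * action_closed action_one action_mult p in auto)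
  then show "projective_gmodule G V" using projective_of_weights by blast
qed

end

section \<open>Exterior powers of permutation modules\<close>

lemma (in quotient_space) proj_act:
  assumes V: "gmodule G V" and W_act: "\<And>g w. g \<in> carrier G \<Longrightarrow> w \<in> W \<Longrightarrow> act V g w \<in> W"
    and g: "g \<in> carrier G" and v: "v \<in> carrier V"
  shows "act (quotient_gmodule V W) g (proj v) = proj (act V g v)"
proof -
  interpret A: gmodule G V by fact
  have add: "act V g (x \<oplus>\<^bsub>V\<^esub> y) = act V g x \<oplus>\<^bsub>V\<^esub> act V g y" if "x \<in> carrier V" "y \<in> carrier V" for x y
    using A.act_hom[OF g] that by (auto simp: LinearCombinations.module_hom_def)
  show ?thesis
  proof (intro subset_antisym subsetI)
    fix x assume "x \<in> act (quotient_gmodule V W) g (proj v)"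
    then obtain w where w: "w \<in> W" "x = act V g (w \<oplus>\<^bsub>V\<^esub> v)"
      by (auto simp: quotient_gmodule_def mem_proj_iff)
    then have "x = act V g w \<oplus>\<^bsub>V\<^esub> act V g v" using add v W_subset by auto
    then show "x \<in> proj (act V g v)" using W_act[OF g w(1)] by (auto simp: mem_proj_iff)
  next
    fix x assume "x \<in> proj (act V g v)"
    then obtain w where w: "w \<in> W" "x = w \<oplus>\<^bsub>V\<^esub> act V g v" by (auto simp: mem_proj_iff)
    have inv: "inv\<^bsub>G\<^esub> g \<in> carrier G" using g by simp
    have w': "act V (inv\<^bsub>G\<^esub> g) w \<in> W" using W_act[OF inv w(1)] .
    have "act V g (act V (inv\<^bsub>G\<^esub> g) w) = w"
      using A.act_mult[OF g inv, of w] A.act_one[of w] w(1) W_subset g by auto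
    then have "x = act V g (act V (inv\<^bsub>G\<^esub> g) w \<oplus>\<^bsub>V\<^esub> v)"
      using add[of "act V (inv\<^bsub>G\<^esub> g) w" v] w w' v W_subset by auto
    moreover have "act V (inv\<^bsub>G\<^esub> g) w \<oplus>\<^bsub>V\<^esub> v \<in> proj v" using w' by (auto simp: mem_proj_iff)
    ultimately show "x \<in> act (quotient_gmodule V W) g (proj v)" by (auto simp: quotient_gmodule_def)
  qed
qed

section \<open>Determinants as alternating multilinear functions of their rows\<close>

lemma det_mat_Leibniz:
  "det (mat n n (\<lambda>(i, j). f i j)) =
    (\<Sum>p | p permutes {0..<n}. of_int (sign p) * (\<Prod>i = 0..<n. f i (p i) :: 'k::comm_ring_1))"
proof -
  have "(\<Prod>i = 0..<n. mat n n (\<lambda>(i, j). f i j) $$ (i, p i)) = (\<Prod>i = 0..<n. f i (p i))"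
    if "p permutes {0..<n}" for p
    using permutes_in_image[OF that] by (intro prod.cong) auto
  then show ?thesis by (simp add: det_def)
qed

lemma det_row_update_add:
  fixes r :: "nat \<Rightarrow> nat \<Rightarrow> 'k::comm_ring_1"
  assumes "k < n"
  shows "det (mat n n (\<lambda>(i, j). (r(k := \<lambda>j. x j + y j)) i j)) =
    det (mat n n (\<lambda>(i, j). (r(k := x)) i j)) + det (mat n n (\<lambda>(i, j). (r(k := y)) i j))"
proof -
  have "(\<Prod>i = 0..<n. (r(k := z)) i (p i)) = z (p k) * (\<Prod>i\<in>{0..<n} - {k}. r i (p i))" for z p
    using assms by (subst prod.remove[of _ k]) auto
  then show ?thesis
    unfolding det_mat_Leibniz by (simp add: distrib_left distrib_right sum.distrib)
qed

lemma det_row_update_smult: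
  fixes r :: "nat \<Rightarrow> nat \<Rightarrow> 'k::comm_ring_1"
  assumes "k < n"
  shows "det (mat n n (\<lambda>(i, j). (r(k := \<lambda>j. c * x j)) i j)) = c * det (mat n n (\<lambda>(i, j). (r(k := x)) i j))"
proof -
  have "(\<Prod>i = 0..<n. (r(k := z)) i (p i)) = z (p k) * (\<Prod>i\<in>{0..<n} - {k}. r i (p i))" for z p
    using assms by (subst prod.remove[of _ k]) auto
  then show ?thesis
    unfolding det_mat_Leibniz by (simp add: sum_distrib_left ac_simps)
qed

lemma det_zero_column:
  fixes f :: "nat \<Rightarrow> nat \<Rightarrow> 'k::comm_ring_1"
  assumes "j < n" "\<And>i. i < n \<Longrightarrow> f i j = 0"
  shows "det (mat n n (\<lambda>(i, j). f i j)) = 0"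
proof -
  have "(\<Prod>i = 0..<n. f i (p i)) = 0" if "p permutes {0..<n}" for p
  proof -
    have "inv_into UNIV p j < n" "p (inv_into UNIV p j) = j"
      using permutes_in_image[OF permutes_inv[OF that], of j] assms(1) permutes_inverses(1)[OF that] by auto
    then show ?thesis using assms(2) by (intro prod_zero) (auto intro!: bexI[of _ "inv_into UNIV p j"])
  qed
  then show ?thesis unfolding det_mat_Leibniz by simp
qed

lemma det_equal_rows:
  fixes f :: "nat \<Rightarrow> nat \<Rightarrow> 'k::comm_ring_1"
  assumes "i < n" "k < n" "i \<noteq> k" "\<And>j. j < n \<Longrightarrow> f i j = f k j"
  shows "det (mat n n (\<lambda>(i, j). f i j)) = 0"
  by (rule det_identical_rows[of _ n i k]) (use assms in \<open>auto intro!: eq_vecI\<close>)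

text \<open>\<open>us\<close> collects the entries already in place, and one swap brings the head of
  \<open>ys\<close> forward. This carries a property from the ordering \<open>enum S\<close> to
  every other ordering of \<open>S\<close>.\<close>

lemma swap_closed_mset:
  assumes swap: "\<And>us v vs w ws. P (us @ v # vs @ w # ws) \<Longrightarrow> P (us @ w # vs @ v # ws)"
    and "mset xs = mset ys" "P (us @ xs)"
  shows "P (us @ ys)"
  using assms(2,3)
proof (induction ys arbitrary: xs us)
  case (Cons y ys)
  then have "y \<in> set xs" by (metis list.set_intros(1) set_mset_mset)
  then obtain A B where xs: "xs = A @ y # B" by (meson split_list)
  have "\<exists>xs'. mset xs' = mset ys \<and> P ((us @ [y]) @ xs')"
  proof (cases A)
    case Nil
    then show ?thesis using Cons.prems xs by (intro exI[of _ B]) auto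
  next
    case A: (Cons x A')
    have "P (us @ y # A' @ x # B)" using swap[of us x A' y B] Cons.prems(2) xs A by simp
    then show ?thesis using Cons.prems(1) xs A by (intro exI[of _ "A' @ x # B"]) auto
  qed
  then have "P ((us @ [y]) @ ys)" using Cons.IH by blast
  then show ?case by simp
qed simp

section \<open>Permutation modules on finite sets\<close>

locale permutation_gmodule = group G for G :: "('g, 'z) monoid_scheme" (structure) +
  fixes \<Omega> :: "'b set" and \<phi> :: "'g \<Rightarrow> 'b \<Rightarrow> 'b" and M :: "('k::field, 'b \<Rightarrow> 'k, 'g) gmodule"
  assumes finite_points: "finite \<Omega>"
    and action_closed: "g \<in> carrier G \<Longrightarrow> x \<in> \<Omega> \<Longrightarrow> \<phi> g x \<in> \<Omega>"
    and action_one: "x \<in> \<Omega> \<Longrightarrow> \<phi> \<one> x = x"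
    and action_mult: "g \<in> carrier G \<Longrightarrow> h \<in> carrier G \<Longrightarrow> x \<in> \<Omega> \<Longrightarrow> \<phi> (g \<otimes> h) x = \<phi> g (\<phi> h x)"
    and M_def: "M = permutation_module G \<Omega> \<phi>"
begin

sublocale M: gmodule G M
  unfolding M_def by (rule gmodule_permutation_module) (auto simp: action_closed action_one action_mult group_axioms)

lemma M_add: "f \<oplus>\<^bsub>M\<^esub> h = (\<lambda>x. f x + h x)"
  and M_smult: "c \<odot>\<^bsub>M\<^esub> f = (\<lambda>x. c * f x)"
  and M_zero: "\<zero>\<^bsub>M\<^esub> = (\<lambda>x. 0)"
  by (simp_all add: M_def permutation_module_def)

lemma carrier_M: "f \<in> carrier M \<longleftrightarrow> (\<forall>x. x \<notin> \<Omega> \<longrightarrow> f x = 0)"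
proof -
  have "finite {x. f x \<noteq> 0}" if "\<forall>x. x \<notin> \<Omega> \<longrightarrow> f x = 0"
    by (rule finite_subset[OF _ finite_points]) (use that in auto)
  then show ?thesis by (auto simp: M_def carrier_permutation_module)
qed

lemma point_M: "x \<in> \<Omega> \<Longrightarrow> point x \<in> carrier M"
  unfolding M_def by (rule point_closed)

lemma act_M: "act M g f = (\<lambda>x. if x \<in> \<Omega> then f (\<phi> (inv g) x) else 0)"
  by (simp add: M_def permutation_module_def)

lemma act_M_point: "g \<in> carrier G \<Longrightarrow> x \<in> \<Omega> \<Longrightarrow> act M g (point x) = point (\<phi> g x)"
  unfolding M_def
  by (rule act_permutation_module_point) (auto simp: action_closed action_one action_mult group_axioms)

lemma action_inv:
  assumes "g \<in> carrier G" "x \<in> \<Omega>"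
  shows "\<phi> g (\<phi> (inv g) x) = x" "\<phi> (inv g) (\<phi> g x) = x"
  using assms by (simp_all flip: action_mult add: action_one)

lemma inj_on_action: "g \<in> carrier G \<Longrightarrow> inj_on (\<phi> g) \<Omega>"
  by (rule inj_on_inverseI[where g = "\<phi> (inv g)"]) (simp add: action_inv)

lemma linear_functional_eval: "linear_functional M (\<lambda>f. f x)"
  by (simp add: linear_functional_def M_add M_smult)

lemma coordinates_M: "coordinates M \<Omega> point (\<lambda>x f. f x)"
  by unfold_locales
    (auto simp: finite_points point_M linear_functional_eval point_def carrier_M M_zero fun_eq_iff)

lemma dim_M: "vectorspace.dim (class_ring :: 'k ring) M = card \<Omega>"
  by (rule coordinates.dim_eq_card[OF coordinates_M])

end

section \<open>The presentation of the exterior power and its coordinates\<close>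

locale exterior_permutation_module = permutation_gmodule G \<Omega> \<phi> M
  for G :: "('g, 'z) monoid_scheme" (structure) and \<Omega> :: "'b set" and \<phi>
    and M :: "('k::field, 'b \<Rightarrow> 'k, 'g) gmodule" +
  fixes a :: nat
begin

abbreviation tup where "tup \<equiv> tuples a M"

definition F :: "('k, ('b \<Rightarrow> 'k) list \<Rightarrow> 'k, 'g) gmodule" where
  "F = permutation_module G tup (\<lambda>g. map (act M g))"

definition N :: "(('b \<Rightarrow> 'k) list \<Rightarrow> 'k) set" where
  "N = LinearCombinations.module.span (class_ring :: 'k ring) F (exterior_relations a M)"

lemma exterior_power_eq: "exterior_power G a M = quotient_gmodule F N"
  by (simp add: exterior_power_def F_def N_def Let_def)

lemma act_tup_closed: "g \<in> carrier G \<Longrightarrow> vs \<in> tup \<Longrightarrow> map (act M g) vs \<in> tup"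
  by (auto simp: tuples_def M.act_closed)

lemma act_tup_one: "vs \<in> tup \<Longrightarrow> map (act M \<one>) vs = vs"
  by (auto simp: tuples_def M.act_one intro!: map_idI)

lemma act_tup_mult:
  "g \<in> carrier G \<Longrightarrow> h \<in> carrier G \<Longrightarrow> vs \<in> tup \<Longrightarrow>
    map (act M (g \<otimes> h)) vs = map (act M g) (map (act M h) vs)"
  by (auto simp: tuples_def M.act_mult)

sublocale F: gmodule G F
  unfolding F_def by (rule gmodule_permutation_module) (auto simp: act_tup_closed act_tup_one act_tup_mult group_axioms simp del: map_map)

lemma act_F_point: "g \<in> carrier G \<Longrightarrow> vs \<in> tup \<Longrightarrow> act F g (point vs) = point (map (act M g) vs)"
  unfolding F_def by (rule act_permutation_module_point)
    (auto simp: act_tup_closed act_tup_one act_tup_mult group_axioms simp del: map_map)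

lemma F_add: "f \<oplus>\<^bsub>F\<^esub> h = (\<lambda>x. f x + h x)"
  and F_smult: "c \<odot>\<^bsub>F\<^esub> f = (\<lambda>x. c * f x)"
  and F_zero: "\<zero>\<^bsub>F\<^esub> = (\<lambda>x. 0)"
  by (simp_all add: F_def permutation_module_def)

lemma F_closed:
  "f \<in> carrier F \<Longrightarrow> h \<in> carrier F \<Longrightarrow> (\<lambda>x. f x + h x) \<in> carrier F"
  "f \<in> carrier F \<Longrightarrow> (\<lambda>x. c * f x) \<in> carrier F"
  "f \<in> carrier F \<Longrightarrow> h \<in> carrier F \<Longrightarrow> (\<lambda>x. f x - h x) \<in> carrier F"
proof -
  show add: "(\<lambda>x. f x + h x) \<in> carrier F" if "f \<in> carrier F" "h \<in> carrier F" for f h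
    using F.M.add.m_closed[OF that] by (simp add: F_add)
  show smult: "(\<lambda>x. c * f x) \<in> carrier F" if "f \<in> carrier F" for f c
    using F.smult_closed[of c f] that by (simp add: F_smult class_ring_simps)
  show "(\<lambda>x. f x - h x) \<in> carrier F" if "f \<in> carrier F" "h \<in> carrier F"
    using add[OF that(1) smult[OF that(2), of "-1"]] by simp
qed

lemma point_F: "vs \<in> tup \<Longrightarrow> point vs \<in> carrier F"
  unfolding F_def by (rule point_closed)

lemma tup_iff: "us @ v # ws \<in> tup \<longleftrightarrow> length us + length ws + 1 = a \<and> set us \<subseteq> carrier M \<and>
    v \<in> carrier M \<and> set ws \<subseteq> carrier M"
  by (auto simp: tuples_def)

lemma exterior_relations_cases:
  assumes "f \<in> exterior_relations a M"
  obtains (add) us v w ws where "us @ v # ws \<in> tup" "us @ w # ws \<in> tup" "us @ (v \<oplus>\<^bsub>M\<^esub> w) # ws \<in> tup"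
      "f = (\<lambda>x. point (us @ (v \<oplus>\<^bsub>M\<^esub> w) # ws) x - point (us @ v # ws) x - point (us @ w # ws) x)"
  | (smult) us c v ws where "us @ v # ws \<in> tup" "us @ (c \<odot>\<^bsub>M\<^esub> v) # ws \<in> tup"
      "f = (\<lambda>x. point (us @ (c \<odot>\<^bsub>M\<^esub> v) # ws) x - c * point (us @ v # ws) x)"
  | (alt) us v vs ws where "us @ v # vs @ v # ws \<in> tup" "f = point (us @ v # vs @ v # ws)"
  using assms unfolding exterior_relations_def
  by (elim UnE CollectE exE conjE) (auto simp: tup_iff class_ring_simps)

lemma exterior_relations_closed: "exterior_relations a M \<subseteq> carrier F"
proof
  fix f assume "f \<in> exterior_relations a M"
  then show "f \<in> carrier F" by (cases rule: exterior_relations_cases) (auto intro!: F_closed point_F)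
qed

sublocale Q: quotient_space F N
proof -
  interpret submodule "class_ring :: 'k ring" N F
    unfolding N_def by (rule F.span_is_submodule[OF exterior_relations_closed])
  show "quotient_space F N" by unfold_locales
qed

lemma relation_in_N: "f \<in> exterior_relations a M \<Longrightarrow> f \<in> N"
  unfolding N_def using F.in_own_span[OF exterior_relations_closed] by blast

lemma N_closed:
  "f \<in> N \<Longrightarrow> h \<in> N \<Longrightarrow> (\<lambda>x. f x + h x) \<in> N"
  "f \<in> N \<Longrightarrow> (\<lambda>x. c * f x) \<in> N"
  "f \<in> N \<Longrightarrow> h \<in> N \<Longrightarrow> (\<lambda>x. f x - h x) \<in> N"
  "(\<lambda>x. 0) \<in> N"
proof -
  show add: "(\<lambda>x. f x + h x) \<in> N" if "f \<in> N" "h \<in> N" for f h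
    using Q.W.m_closed[OF that] by (simp add: F_add)
  show smult: "(\<lambda>x. c * f x) \<in> N" if "f \<in> N" for f c
    using Q.W.smult_closed[of c f] that by (simp add: F_smult class_ring_simps)
  show "(\<lambda>x. f x - h x) \<in> N" if "f \<in> N" "h \<in> N"
    using add[OF that(1) smult[OF that(2), of "-1"]] by simp
  show "(\<lambda>x. 0) \<in> N" using Q.W.zero_closed by (simp add: F_zero)
qed

lemma act_F_diff: "act F g (\<lambda>x. f x - h x) = (\<lambda>x. act F g f x - act F g h x)"
  and act_F_smult: "act F g (\<lambda>x. c * f x) = (\<lambda>x. c * act F g f x)"
  and act_F_add: "act F g (\<lambda>x. f x + h x) = (\<lambda>x. act F g f x + act F g h x)"
  by (auto simp: F_def permutation_module_def)

lemma act_M_add: "act M g (v \<oplus>\<^bsub>M\<^esub> w) = act M g v \<oplus>\<^bsub>M\<^esub> act M g w"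
  and act_M_smult: "act M g (c \<odot>\<^bsub>M\<^esub> v) = c \<odot>\<^bsub>M\<^esub> act M g v"
  by (auto simp: M_def permutation_module_def)

lemma relation_intros:
  "us @ v # ws \<in> tup \<Longrightarrow> us @ w # ws \<in> tup \<Longrightarrow>
    (\<lambda>x. point (us @ (v \<oplus>\<^bsub>M\<^esub> w) # ws) x - point (us @ v # ws) x - point (us @ w # ws) x) \<in> N"
  "us @ v # ws \<in> tup \<Longrightarrow> (\<lambda>x. point (us @ (c \<odot>\<^bsub>M\<^esub> v) # ws) x - c * point (us @ v # ws) x) \<in> N"
  "us @ v # vs @ v # ws \<in> tup \<Longrightarrow> point (us @ v # vs @ v # ws) \<in> N"
  by (rule relation_in_N; unfold exterior_relations_def; blast)+

text \<open>The vectors that \<open>g\<close> sends into \<open>N\<close> form a submodule, so it is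
  enough to look at the relations, and \<open>g\<close> maps each kind of relation to the same kind.
  The next lemma argues likewise with the kernel of \<open>L\<close>.\<close>

lemma act_N:
  assumes g: "g \<in> carrier G" and "f \<in> N"
  shows "act F g f \<in> N"
proof -
  let ?K = "{f \<in> carrier F. act F g f \<in> N}"
  have "submodule (class_ring :: 'k ring) ?K F"
    by unfold_locales
      (use N_closed F_closed in \<open>auto simp: F_add F_smult act_F_add act_F_smult\<close>,
        use N_closed in \<open>auto simp: F_def permutation_module_def\<close>)
  moreover have "exterior_relations a M \<subseteq> ?K"
  proof
    fix f assume f: "f \<in> exterior_relations a M"
    have closed: "map (act M g) us @ act M g v # map (act M g) ws \<in> tup" if "us @ v # ws \<in> tup" for us v ws
      using act_tup_closed[OF g that] by simp
    from f have "act F g f \<in> N"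
    proof (cases rule: exterior_relations_cases)
      case (add us v w ws)
      then show ?thesis using g relation_intros(1)[OF closed closed, of us v ws w]
        by (simp add: act_F_diff act_F_point act_M_add)
    next
      case (smult us c v ws)
      then show ?thesis using g relation_intros(2)[OF closed, of us v ws c]
        by (simp add: act_F_diff act_F_smult act_F_point act_M_smult)
    next
      case (alt us v vs ws)
      then show ?thesis using g relation_intros(3)[of "map (act M g) us" "act M g v" "map (act M g) vs" "map (act M g) ws"]
          act_tup_closed[OF g alt(1)] by (simp add: act_F_point)
    qed
    then show "f \<in> ?K" using f exterior_relations_closed by auto
  qed
  ultimately have "N \<subseteq> ?K" unfolding N_def using F.span_is_subset by blast
  then show ?thesis using assms by blast
qed

lemma functional_vanishes_on_N:
  assumes L: "linear_functional F L" and rel: "\<And>f. f \<in> exterior_relations a M \<Longrightarrow> L f = 0" and "f \<in> N"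
  shows "L f = 0"
proof -
  let ?K = "{f \<in> carrier F. L f = 0}"
  have "submodule (class_ring :: 'k ring) ?K F"
    by unfold_locales
      (auto simp: linear_functional_add[OF L] linear_functional_smult[OF L]
        linear_functional_zero[OF L F.module_axioms] class_ring_simps)
  moreover have "exterior_relations a M \<subseteq> ?K" using rel exterior_relations_closed by auto
  ultimately have "N \<subseteq> ?K" unfolding N_def using F.span_is_subset by blast
  then show ?thesis using assms by blast
qed

text \<open>\<open>minor S vs\<close> is the coefficient of \<open>vs\<close> at the basis element of the exterior power indexed by
  the \<open>a\<close>-subset \<open>S\<close>, whose points are put in an arbitrary order \<open>enum S\<close>.\<close>

definition subsets :: "'b set set" where
  "subsets = {S. S \<subseteq> \<Omega> \<and> card S = a}"

definition enum :: "'b set \<Rightarrow> 'b list" where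
  "enum S = (SOME l. set l = S \<and> distinct l)"

definition minor :: "'b set \<Rightarrow> ('b \<Rightarrow> 'k) list \<Rightarrow> 'k" where
  "minor S vs = det (mat a a (\<lambda>(i, j). (vs ! i) (enum S ! j)))"

lemma finite_subsets: "finite subsets"
  unfolding subsets_def using finite_points by auto

lemma enum:
  assumes "S \<in> subsets"
  shows "set (enum S) = S" "distinct (enum S)" "length (enum S) = a"
proof -
  have "finite S" using assms finite_points finite_subset by (auto simp: subsets_def)
  then have "\<exists>l. set l = S \<and> distinct l" by (rule finite_distinct_list)
  then have "set (enum S) = S \<and> distinct (enum S)" unfolding enum_def by (rule someI_ex)
  then show "set (enum S) = S" "distinct (enum S)" by auto
  then show "length (enum S) = a" using assms distinct_card by (fastforce simp: subsets_def)
qed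

text \<open>The entry \<open>undefined\<close> is a placeholder in a row that is overwritten at
  once; in this form the other rows visibly do not depend on \<open>v\<close>.\<close>

lemma minor_row:
  assumes "length us + length ws + 1 = a"
  shows "minor S (us @ v # ws) =
    det (mat a a (\<lambda>(i, j). ((\<lambda>i j. ((us @ undefined # ws) ! i) (enum S ! j))(length us := \<lambda>j. v (enum S ! j))) i j))"
  unfolding minor_def
  by (rule arg_cong[where f = det], rule eq_matI) (auto simp: nth_append nth_Cons')

lemma minor_add:
  assumes "length us + length ws + 1 = a"
  shows "minor S (us @ (v \<oplus>\<^bsub>M\<^esub> w) # ws) = minor S (us @ v # ws) + minor S (us @ w # ws)"
  unfolding minor_row[OF assms] M_add using assms by (intro det_row_update_add) simp

lemma minor_smult:
  assumes "length us + length ws + 1 = a"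
  shows "minor S (us @ (c \<odot>\<^bsub>M\<^esub> v) # ws) = c * minor S (us @ v # ws)"
  unfolding minor_row[OF assms] M_smult using assms by (intro det_row_update_smult) simp

lemma minor_alt:
  assumes "length us + length vs + length ws + 2 = a"
  shows "minor S (us @ v # vs @ v # ws) = 0"
  unfolding minor_def
  by (rule det_equal_rows[of "length us" _ "length us + length vs + 1"])
    (use assms in \<open>auto simp: nth_append nth_Cons'\<close>)

lemma minor_enum:
  assumes "S \<in> subsets"
  shows "minor S (map point (enum S)) = 1"
proof -
  have "mat a a (\<lambda>(i, j). (map point (enum S) ! i) (enum S ! j)) = (1\<^sub>m a :: 'k mat)"
    using enum[OF assms] by (intro eq_matI) (auto simp: point_def nth_eq_iff_index_eq)
  then show ?thesis by (simp add: minor_def)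
qed

text \<open>\<open>l\<close> has only \<open>a\<close> entries, so unless it lists \<open>S\<close>
  exactly it misses some \<open>s\<close> in \<open>S\<close>, and the column of \<open>s\<close> is
  zero. Lists with repetitions are included.\<close>

lemma minor_points_eq_zero:
  assumes S: "S \<in> subsets" and l: "length l = a" "set l \<noteq> S"
  shows "minor S (map point l) = 0"
proof -
  have finS: "finite S" using S finite_points finite_subset by (auto simp: subsets_def)
  have "\<not> S \<subseteq> set l"
  proof
    assume "S \<subseteq> set l"
    moreover have "card (set l) \<le> card S" using card_length[of l] l S by (simp add: subsets_def)
    ultimately show False using card_seteq[of "set l" S] l by auto
  qed
  then obtain s where s: "s \<in> S" "s \<notin> set l" by auto
  then obtain j where j: "j < a" "enum S ! j = s" using enum[OF S] by (metis in_set_conv_nth)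
  show ?thesis unfolding minor_def
    by (rule det_zero_column[OF j(1)]) (use j s l in \<open>auto simp: point_def\<close>)
qed

definition coord :: "'b set \<Rightarrow> (('b \<Rightarrow> 'k) list \<Rightarrow> 'k) \<Rightarrow> 'k" where
  "coord S f = (\<Sum>vs | f vs \<noteq> 0. f vs * minor S vs)"

lemma coord_eq_sum:
  assumes "finite A" "{vs. f vs \<noteq> 0} \<subseteq> A"
  shows "coord S f = (\<Sum>vs\<in>A. f vs * minor S vs)"
  unfolding coord_def using assms by (intro sum.mono_neutral_left) auto

lemma finite_support: "f \<in> carrier F \<Longrightarrow> finite {vs. f vs \<noteq> 0}"
  by (simp add: F_def carrier_permutation_module)

lemma coord_add:
  assumes "f \<in> carrier F" "h \<in> carrier F"
  shows "coord S (\<lambda>x. f x + h x) = coord S f + coord S h"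
proof -
  let ?A = "{vs. f vs \<noteq> 0} \<union> {vs. h vs \<noteq> 0}"
  have fin: "finite ?A" using assms finite_support by simp
  show ?thesis
    unfolding coord_eq_sum[OF fin Un_upper1] coord_eq_sum[OF fin Un_upper2]
    by (subst coord_eq_sum[OF fin]) (auto simp: distrib_right sum.distrib)
qed

lemma coord_smult:
  assumes "f \<in> carrier F"
  shows "coord S (\<lambda>x. c * f x) = c * coord S f"
  by (subst coord_eq_sum[OF finite_support[OF assms]]) (auto simp: coord_def sum_distrib_left mult.assoc)

lemma linear_functional_coord: "linear_functional F (coord S)"
  by (simp add: linear_functional_def F_add F_smult coord_add coord_smult)

lemma coord_diff:
  assumes "f \<in> carrier F" "h \<in> carrier F"
  shows "coord S (\<lambda>x. f x - h x) = coord S f - coord S h"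
  using coord_add[OF assms(1) F_closed(2)[OF assms(2), of "-1"]] coord_smult[OF assms(2), of S "-1"] by simp

lemma coord_point: "coord S (point vs) = minor S vs"
  by (subst coord_eq_sum[of "{vs}"]) (auto simp: point_def)

text \<open>The relations say that the symbol is additive, homogeneous and alternating in its
  entries, and a determinant has these properties in its rows. Hence \<open>coord S\<close> descends
  to the exterior power.\<close>

lemma coord_N: "f \<in> N \<Longrightarrow> coord S f = 0"
proof (rule functional_vanishes_on_N[OF linear_functional_coord])
  fix f assume "f \<in> exterior_relations a M"
  then show "coord S f = 0"
  proof (cases rule: exterior_relations_cases)
    case (add us v w ws)
    then show ?thesis
      using minor_add[of us ws S v w] by (simp add: coord_diff coord_point F_closed point_F tup_iff)
  next
    case (smult us c v ws)
    then show ?thesis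
      using minor_smult[of us ws S c v] by (simp add: coord_diff coord_smult coord_point F_closed point_F tup_iff)
  next
    case (alt us v vs ws)
    then show ?thesis using minor_alt[of us vs ws S v] by (simp add: coord_point tup_iff)
  qed
qed

text \<open>Polarisation: the alternating relation at the sum of \<open>v\<close> and
  \<open>w\<close> is expanded in both places, and the squares of \<open>v\<close> and
  \<open>w\<close> are relations themselves. Nothing is divided by 2.\<close>

lemma swap_in_N:
  assumes "us @ v # vs @ w # ws \<in> tup"
  shows "(\<lambda>x. point (us @ v # vs @ w # ws) x + point (us @ w # vs @ v # ws) x) \<in> N"
proof -
  have in_tup: "us @ x # vs @ y # ws \<in> tup" if "x \<in> {v, w, v \<oplus>\<^bsub>M\<^esub> w}" "y \<in> {v, w, v \<oplus>\<^bsub>M\<^esub> w}" for x y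
    using assms that by (auto simp: tup_iff)
  let ?b = "\<lambda>x y. point (us @ x # vs @ y # ws)" and ?s = "v \<oplus>\<^bsub>M\<^esub> w"
  have 1: "(\<lambda>x. ?b ?s ?s x - ?b v ?s x - ?b w ?s x) \<in> N"
    by (rule relation_intros(1)) (use in_tup in auto)
  have 2: "(\<lambda>x. ?b y ?s x - ?b y v x - ?b y w x) \<in> N" if "y \<in> {v, w}" for y
    using relation_intros(1)[of "us @ y # vs" v ws w] in_tup that by auto
  have 3: "?b y y \<in> N" if "y \<in> {v, w, ?s}" for y
    using relation_intros(3)[of us y vs ws] in_tup that by auto
  have 4: "(\<lambda>x. ?b ?s ?s x - (?b ?s ?s x - ?b v ?s x - ?b w ?s x)) \<in> N"
    by (rule N_closed(3)[OF 3 1]) simp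
  have 5: "(\<lambda>x. (?b v ?s x - ?b v v x - ?b v w x) + (?b w ?s x - ?b w v x - ?b w w x)) \<in> N"
    by (rule N_closed(1)[OF 2 2]) simp_all
  have 6: "(\<lambda>x. ?b v v x + ?b w w x) \<in> N" by (rule N_closed(1)[OF 3 3]) simp_all
  show ?thesis using N_closed(3)[OF N_closed(3)[OF 4 5] 6] by (simp add: algebra_simps)
qed

text \<open>The error of the minor expansion of a generator. That it always lies in \<open>N\<close>
  is the spanning half of the basis theorem.\<close>

definition remainder :: "('b \<Rightarrow> 'k) list \<Rightarrow> ('b \<Rightarrow> 'k) list \<Rightarrow> 'k" where
  "remainder vs = (\<lambda>x. point vs x - (\<Sum>S\<in>subsets. minor S vs * point (map point (enum S)) x))"

lemma points_tup: "length l = a \<Longrightarrow> set l \<subseteq> \<Omega> \<Longrightarrow> map point l \<in> tup"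
  by (auto simp: tuples_def M_def intro!: point_closed)

text \<open>With a repeated point all minors vanish and the generator is itself a relation.
  Otherwise only the subset \<open>set l\<close> contributes, and a swap of two points changes the
  generator and its minor by the same sign modulo \<open>N\<close>, so the claim spreads from
  \<open>enum (set l)\<close>, where the minor is 1.\<close>

lemma remainder_points:
  assumes l: "length l = a" "set l \<subseteq> \<Omega>"
  shows "remainder (map point l) \<in> N"
proof (cases "distinct l")
  case False
  then obtain xs ys zs y where l': "l = xs @ y # ys @ y # zs"
    using not_distinct_decomp[OF False] by auto
  have "minor S (map point l) = 0" for S
    unfolding l' using l minor_alt[of "map point xs" "map point ys" "map point zs" S "point y"] by (simp add: l')
  then have "remainder (map point l) = point (map point l)" by (simp add: remainder_def)
  then show ?thesis
    using relation_intros(3)[of "map point xs" "point y" "map point ys" "map point zs"] points_tup[OF l]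
    by (simp add: l')
next
  case True
  let ?S = "set l"
  have S: "?S \<in> subsets" using True l distinct_card by (auto simp: subsets_def)
  define R :: "'b list \<Rightarrow> ('b \<Rightarrow> 'k) list \<Rightarrow> 'k"
    where "R k = (\<lambda>x. point (map point k) x - minor ?S (map point k) * point (map point (enum ?S)) x)" for k
  have "mset (enum ?S) = mset l" using enum[OF S] True by (simp add: set_eq_iff_mset_eq_distinct)
  moreover have "R (enum ?S) = (\<lambda>x. 0)" using minor_enum[OF S] by (simp add: R_def)
  then have "length ([] @ enum ?S) = a \<and> set ([] @ enum ?S) \<subseteq> \<Omega> \<and> R ([] @ enum ?S) \<in> N"
    using enum[OF S] l N_closed(4) by simp
  ultimately have "length ([] @ l) = a \<and> set ([] @ l) \<subseteq> \<Omega> \<and> R ([] @ l) \<in> N"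
  proof (rule swap_closed_mset[rotated 1])
    fix us vs ws :: "'b list" and v w :: 'b
    let ?k = "us @ v # vs @ w # ws" and ?k' = "us @ w # vs @ v # ws"
    assume k: "length ?k = a \<and> set ?k \<subseteq> \<Omega> \<and> R ?k \<in> N"
    then have "map point ?k \<in> tup" by (intro points_tup) auto
    then have sw: "(\<lambda>x. point (map point ?k) x + point (map point ?k') x) \<in> N" using swap_in_N by simp
    have tups: "map point ?k \<in> tup" "map point ?k' \<in> tup" using k by (intro points_tup; auto)+
    \<comment> \<open>The sign change of the minor is read off from the swap relation, on which
      \<open>coord\<close> vanishes.\<close>
    have "minor ?S (map point ?k) + minor ?S (map point ?k') = 0"
      using coord_N[OF sw, of ?S] coord_add[OF tups[THEN point_F], of ?S] by (simp only: coord_point)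
    then have neg: "minor ?S (map point ?k') = - minor ?S (map point ?k)" by (metis add_eq_0_iff)
    have "(\<lambda>x. (point (map point ?k) x + point (map point ?k') x) - R ?k x) = R ?k'"
      unfolding R_def neg by (simp add: algebra_simps)
    then have "R ?k' \<in> N" using N_closed(3)[OF sw, of "R ?k"] k by simp
    then show "length ?k' = a \<and> set ?k' \<subseteq> \<Omega> \<and> R ?k' \<in> N" using k by auto
  qed
  moreover have "remainder (map point l) = R l"
  proof (rule ext)
    fix x :: "('b \<Rightarrow> 'k) list"
    have "(\<Sum>T\<in>subsets. minor T (map point l) * point (map point (enum T)) x) =
        (\<Sum>T\<in>{?S}. minor T (map point l) * point (map point (enum T)) x)"
      using S finite_subsets minor_points_eq_zero[OF _ l(1)] by (intro sum.mono_neutral_right) auto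
    then show "remainder (map point l) x = R l x" by (simp add: remainder_def R_def)
  qed
  ultimately show ?thesis by simp
qed

lemma remainder_add:
  assumes "us @ v # ws \<in> tup" "us @ w # ws \<in> tup"
    and "remainder (us @ v # ws) \<in> N" "remainder (us @ w # ws) \<in> N"
  shows "remainder (us @ (v \<oplus>\<^bsub>M\<^esub> w) # ws) \<in> N"
proof -
  have m: "minor S (us @ (v \<oplus>\<^bsub>M\<^esub> w) # ws) = minor S (us @ v # ws) + minor S (us @ w # ws)" for S
    using assms by (intro minor_add) (simp add: tup_iff)
  have "remainder (us @ (v \<oplus>\<^bsub>M\<^esub> w) # ws) =
    (\<lambda>x. (point (us @ (v \<oplus>\<^bsub>M\<^esub> w) # ws) x - point (us @ v # ws) x - point (us @ w # ws) x) +
      (remainder (us @ v # ws) x + remainder (us @ w # ws) x))"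
    unfolding remainder_def m by (rule ext) (simp add: sum.distrib distrib_right)
  then show ?thesis
    using N_closed(1)[OF relation_intros(1)[OF assms(1,2)] N_closed(1)[OF assms(3,4)]] by simp
qed

lemma remainder_smult:
  assumes "us @ v # ws \<in> tup" "remainder (us @ v # ws) \<in> N"
  shows "remainder (us @ (c \<odot>\<^bsub>M\<^esub> v) # ws) \<in> N"
proof -
  have m: "minor S (us @ (c \<odot>\<^bsub>M\<^esub> v) # ws) = c * minor S (us @ v # ws)" for S
    using assms by (intro minor_smult) (simp add: tup_iff)
  have "remainder (us @ (c \<odot>\<^bsub>M\<^esub> v) # ws) =
    (\<lambda>x. (point (us @ (c \<odot>\<^bsub>M\<^esub> v) # ws) x - c * point (us @ v # ws) x) + c * remainder (us @ v # ws) x)"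
    unfolding remainder_def m by (rule ext) (simp add: sum_distrib_left right_diff_distrib mult.assoc)
  then show ?thesis
    using N_closed(1)[OF relation_intros(2)[OF assms(1)] N_closed(2)[OF assms(2)]] by simp
qed

text \<open>Expand the entries of the tuple one after the other, starting from the left.\<close>

lemma remainder_in_N:
  assumes "vs \<in> tup" shows "remainder vs \<in> N"
proof -
  have "remainder (map point l @ ws) \<in> N"
    if "set l \<subseteq> \<Omega>" "set ws \<subseteq> carrier M" "length l + length ws = a" for l ws
    using that
  proof (induction ws arbitrary: l)
    case Nil
    then show ?case using remainder_points[of l] by simp
  next
    case (Cons v ws)
    have pts: "set (map point l) \<subseteq> carrier M" using Cons.prems(1) by (auto simp: M_def intro!: point_closed)
    have tup: "map point l @ u # ws \<in> tup" if "u \<in> carrier M" for u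
      using Cons.prems pts that by (simp add: tup_iff)
    have "v \<in> carrier (permutation_module G \<Omega> \<phi>)" using Cons.prems by (simp add: M_def)
    then show ?case
    proof (induction rule: finite_support_induct)
      case zero
      \<comment> \<open>The zero vector is written as 0 times \<open>v\<close>, so the homogeneity
        relation puts the generator into \<open>N\<close>.\<close>
      have "v \<in> carrier M" using Cons.prems by simp
      note t = tup[OF this]
      have "minor S (map point l @ (\<lambda>x. 0) # ws) = 0" for S
        using minor_smult[of "map point l" ws S 0 v] Cons.prems(3) by (simp add: M_smult)
      then have "remainder (map point l @ (\<lambda>x. 0) # ws) = point (map point l @ (\<lambda>x. 0) # ws)"
        by (simp add: remainder_def)
      moreover have "point (map point l @ (\<lambda>x. 0) # ws) \<in> N"
        using relation_intros(2)[OF t, of 0] by (simp add: M_smult)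
      ultimately show ?case by simp
    next
      case (add_point f x c)
      have f: "f \<in> carrier M" using add_point.hyps by (simp add: M_def)
      have x: "point x \<in> carrier M" using add_point.hyps by (auto simp: M_def intro: point_closed)
      have cx: "c \<odot>\<^bsub>M\<^esub> point x \<in> carrier M" using x by (simp add: class_ring_simps)
      have "remainder (map point (l @ [x]) @ ws) \<in> N"
        by (rule Cons.IH) (use Cons.prems add_point.hyps in auto)
      then have "remainder (map point l @ point x # ws) \<in> N" by simp
      then have "remainder (map point l @ (c \<odot>\<^bsub>M\<^esub> point x) # ws) \<in> N"
        by (rule remainder_smult[OF tup[OF x]])
      then have "remainder (map point l @ (f \<oplus>\<^bsub>M\<^esub> c \<odot>\<^bsub>M\<^esub> point x) # ws) \<in> N"
        using add_point.IH by (intro remainder_add tup f cx)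
      then show ?case by (simp add: M_add M_smult)
    qed
  qed
  from this[of "[]" vs] show ?thesis using assms by (simp add: tuples_def)
qed

text \<open>By induction on the support every \<open>f\<close> agrees modulo \<open>N\<close> with
  its minor expansion, which is empty of terms when all coordinates vanish. This yields the
  separating property of the coordinates.\<close>

lemma in_N_of_coord_zero:
  assumes "f \<in> carrier F" "\<And>S. S \<in> subsets \<Longrightarrow> coord S f = 0"
  shows "f \<in> N"
proof -
  have "f \<in> carrier (permutation_module G tup (\<lambda>g. map (act M g)))" using assms(1) by (simp add: F_def)
  then have "(\<lambda>x. f x - (\<Sum>S\<in>subsets. coord S f * point (map point (enum S)) x)) \<in> N"
  proof (induction rule: finite_support_induct)
    case zero
    then show ?case using N_closed(4) by (simp add: coord_def)
  next
    case (add_point f vs c)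
    have f: "f \<in> carrier F" using add_point.hyps by (simp add: F_def)
    have vs: "point vs \<in> carrier F" using add_point.hyps by (intro point_F)
    have c: "coord S (\<lambda>x. f x + c * point vs x) = coord S f + c * minor S vs" for S
      using coord_add[OF f F_closed(2)[OF vs]] coord_smult[OF vs] by (simp add: coord_point)
    have "(\<lambda>x. (f x - (\<Sum>S\<in>subsets. coord S f * point (map point (enum S)) x)) + c * remainder vs x) \<in> N"
      by (rule N_closed(1)[OF add_point.IH N_closed(2)[OF remainder_in_N[OF add_point.hyps(2)]]])
    then show ?case
      unfolding c remainder_def
      by (simp add: sum.distrib sum_distrib_left distrib_right right_diff_distrib mult.assoc algebra_simps)
  qed
  then show ?thesis using assms(2) by simp
qed

abbreviation Lambda where "Lambda \<equiv> exterior_power G a M"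

lemma gmodule_Lambda: "gmodule G Lambda"
  unfolding exterior_power_eq
  by (rule gmodule_quotient_gmodule[OF F.gmodule_axioms Q.W.submodule_axioms act_N])

lemma enum_tup: "S \<in> subsets \<Longrightarrow> map point (enum S) \<in> tup"
  using enum[of S] by (intro points_tup) (auto simp: subsets_def)

lemma enum_F: "S \<in> subsets \<Longrightarrow> point (map point (enum S)) \<in> carrier F"
  by (intro point_F enum_tup)

lemma image_subset: "g \<in> carrier G \<Longrightarrow> S \<in> subsets \<Longrightarrow> \<phi> g ` S \<in> subsets"
proof -
  assume g: "g \<in> carrier G" and S: "S \<in> subsets"
  have "inj_on (\<phi> g) \<Omega>" using g by (rule inj_on_action)
  moreover have "S \<subseteq> \<Omega>" using S by (simp add: subsets_def)
  ultimately have "inj_on (\<phi> g) S" by (rule inj_on_subset)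
  then show "\<phi> g ` S \<in> subsets" using S g action_closed by (auto simp: subsets_def card_image)
qed

text \<open>\<open>g\<close> sends the generator of \<open>enum S\<close> to that of a possibly
  different ordering of the image set, whose coordinates at all other subsets vanish by
  \<open>minor_points_eq_zero\<close>. The coordinate at the image itself is never
  evaluated.\<close>

theorem monomial_exterior_power:
  assumes "finite (carrier G)"
  shows "monomial_gmodule G Lambda subsets (\<lambda>S. Q.proj (point (map point (enum S))))
    (\<lambda>S. Q.descend (coord S)) (\<lambda>g S. \<phi> g ` S)"
proof -
  interpret L: gmodule G Lambda by (rule gmodule_Lambda)
  have desc: "Q.descend (coord S) (Q.proj f) = coord S f" if "f \<in> carrier F" for S f
    using linear_functional_coord coord_N that by (rule Q.descend_proj)
  show ?thesis
  proof (unfold_locales)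
    show "finite subsets" by (rule finite_subsets)
    show "Q.proj (point (map point (enum S))) \<in> carrier Lambda" if "S \<in> subsets" for S
      using enum_F[OF that] by (simp add: exterior_power_eq Q.carrier_quotient)
    show "linear_functional Lambda (Q.descend (coord S))" for S
      unfolding exterior_power_eq using linear_functional_coord coord_N by (rule Q.linear_functional_descend)
    show "Q.descend (coord S) (Q.proj (point (map point (enum T)))) = (if S = T then 1 else 0)"
      if "S \<in> subsets" "T \<in> subsets" for S T
      using that desc[OF enum_F] minor_enum minor_points_eq_zero[of S "enum T"] enum[of T]
      by (auto simp: coord_point)
    show "v = \<zero>\<^bsub>Lambda\<^esub>" if v: "v \<in> carrier Lambda"
      and zero: "\<And>S. S \<in> subsets \<Longrightarrow> Q.descend (coord S) v = 0" for v
    proof -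
      obtain f where f: "f \<in> carrier F" "v = Q.proj f"
        using v by (auto simp: exterior_power_eq Q.carrier_quotient)
      then have "f \<in> N" using zero desc by (intro in_N_of_coord_zero) auto
      then show ?thesis using Q.proj_eq_zero_iff[OF f(1)] f(2) by (simp add: exterior_power_eq)
    qed
    show "finite (carrier G)" by fact
    show "\<phi> g ` S \<in> subsets" if "g \<in> carrier G" "S \<in> subsets" for g S
      using that by (rule image_subset)
    show "\<phi> \<one> ` S = S" if "S \<in> subsets" for S
    proof -
      have "\<phi> \<one> ` S = id ` S" using that action_one by (intro image_cong) (auto simp: subsets_def)
      then show ?thesis by simp
    qed
    show "\<phi> (g \<otimes> h) ` S = \<phi> g ` \<phi> h ` S" if "g \<in> carrier G" "h \<in> carrier G" "S \<in> subsets" for g h S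
      unfolding image_image using that action_mult by (intro image_cong) (auto simp: subsets_def)
    show "Q.descend (coord T) (act Lambda g (Q.proj (point (map point (enum S))))) = 0"
      if g: "g \<in> carrier G" and S: "S \<in> subsets" and T: "T \<in> subsets" and neq: "\<phi> g ` S \<noteq> T" for g S T
    proof -
      have "map (act M g) (map point (enum S)) = map point (map (\<phi> g) (enum S))"
        unfolding list.map_comp
      proof (rule list.map_cong0)
        fix x assume "x \<in> set (enum S)"
        then have "x \<in> \<Omega>" using enum(1)[OF S] S by (auto simp: subsets_def)
        then show "(act M g \<circ> point) x = (point \<circ> \<phi> g) x" using act_M_point[OF g] by simp
      qed
      then have "act F g (point (map point (enum S))) = point (map point (map (\<phi> g) (enum S)))"
        by (simp only: act_F_point[OF g enum_tup[OF S]])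
      moreover have "act Lambda g (Q.proj (point (map point (enum S)))) =
          Q.proj (act F g (point (map point (enum S))))"
        unfolding exterior_power_eq using F.gmodule_axioms act_N g enum_F[OF S] by (rule Q.proj_act)
      moreover have "point (map point (map (\<phi> g) (enum S))) \<in> carrier F"
        using enum[OF S] S g action_closed by (intro point_F points_tup) (auto simp: subsets_def)
      ultimately show ?thesis
        using desc minor_points_eq_zero[OF T, of "map (\<phi> g) (enum S)"] enum[OF S] neq
        by (simp add: coord_point)
    qed
  qed
qed

end

section \<open>Brauer quotients at subgroups of prime order\<close>

lemma (in group) generate_prime_order:
  fixes p :: nat
  assumes t: "t \<in> carrier G" "t \<noteq> \<one>" "t [^] p = \<one>" and p: "prime p"
  shows "generate G {t} = (\<lambda>j. t [^] j) ` {..<p}" and "inj_on (\<lambda>j. t [^] j) {..<p}"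
proof -
  have "ord t dvd p" using t by (simp add: pow_eq_id)
  moreover have "ord t \<noteq> 1" using ord_eq_1[OF t(1)] t(2) by simp
  ultimately have ord: "ord t = p" using p by (metis prime_nat_iff)
  have p0: "p > 0" using p by (rule prime_gt_0_nat)
  then have atMost: "{0..ord t - 1} = {..<p}" unfolding ord by auto
  show "inj_on (\<lambda>j. t [^] j) {..<p}" using ord_inj[OF t(1)] unfolding atMost .
  have "generate G {t} = {t [^] j | j. j \<in> (UNIV :: nat set)}"
    using t ord p0 by (intro generate_pow_nat) auto
  also have "\<dots> = {t [^] j | j. j \<in> {0..ord t - 1}}"
    using t ord p0 by (intro ord_elems_inf_carrier) auto
  finally show "generate G {t} = (\<lambda>j. t [^] j) ` {..<p}" unfolding atMost by auto
qed

lemma (in group) proper_subgroup_of_prime_order: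
  assumes P: "subgroup P G" and p: "prime (card P)" and Q: "subgroup Q G" "Q \<subset> P"
  shows "Q = {\<one>}"
proof -
  have finP: "finite P" using p by (metis card.infinite not_prime_0)
  then have finQ: "finite Q" using Q(2) finite_subset by blast
  have "subgroup Q (G\<lparr>carrier := P\<rparr>)" using Q P by (intro subgroup_incl) auto
  from group.lagrange[OF subgroup_imp_group[OF P] this]
  have "card (rcosets\<^bsub>G\<lparr>carrier := P\<rparr>\<^esub> Q) * card Q = card P" by (simp add: Coset.order_def)
  then have "card Q dvd card P" by (metis dvd_triv_right)
  moreover have "card Q \<noteq> card P" using psubset_card_mono[OF finP Q(2)] by simp
  ultimately have "card Q = 1" using p by (metis prime_nat_iff)
  moreover have "\<one> \<in> Q" using subgroup.one_closed[OF Q(1)] .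
  ultimately show ?thesis by (metis card_1_singletonE singletonD)
qed

lemma sum_shift_periodic:
  fixes h :: "nat \<Rightarrow> 'a::ab_group_add"
  assumes "h p = h 0"
  shows "(\<Sum>j<p. h (Suc j)) = (\<Sum>j<p. h j)"
  using assms sum.lessThan_Suc_shift[of h p] sum.lessThan_Suc[of h p] by (simp add: add.commute)

locale prime_order_action = permutation_gmodule G \<Omega> \<phi> M
  for G :: "('g, 'z) monoid_scheme" (structure) and \<Omega> :: "'b set" and \<phi>
    and M :: "('k::field, 'b \<Rightarrow> 'k, 'g) gmodule" +
  fixes t :: 'g and p :: nat
  assumes char: "CHAR('k) = p" and prime_p: "prime p" and t_closed: "t \<in> carrier G" and t_neq_one: "t \<noteq> \<one>"
    and t_pow: "t [^] p = \<one>"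
begin

definition P where "P = generate G {t}"

lemma P_eq: "P = (\<lambda>j. t [^] j) ` {..<p}" and inj_pow: "inj_on (\<lambda>j. t [^] j) {..<p}"
  unfolding P_def using generate_prime_order[OF t_closed t_neq_one t_pow prime_p] by auto

lemma P_subgroup: "subgroup P G"
  unfolding P_def using t_closed by (intro generate_is_subgroup) auto

lemma P_subset: "P \<subseteq> carrier G"
  using P_subgroup by (rule subgroup.subset)

lemma card_P: "card P = p" by (simp add: P_eq card_image inj_pow)

lemma t_P: "t \<in> P" unfolding P_def by (rule generate.incl) simp

lemma action_t_closed: "x \<in> \<Omega> \<Longrightarrow> \<phi> t x \<in> \<Omega>"
  using t_closed by (rule action_closed)

lemma funpow_action: "x \<in> \<Omega> \<Longrightarrow> (\<phi> t ^^ j) x = \<phi> (t [^] j) x"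
proof (induction j)
  case (Suc j)
  have "\<phi> (t [^] Suc j) x = \<phi> t (\<phi> (t [^] j) x)"
    unfolding nat_pow_Suc2[OF t_closed] using t_closed Suc.prems by (intro action_mult) auto
  then show ?case using Suc by (simp del: nat_pow_Suc)
qed (simp add: action_one)

lemma funpow_p: "x \<in> \<Omega> \<Longrightarrow> (\<phi> t ^^ p) x = x"
  by (simp add: funpow_action t_pow action_one)

lemma funpow_closed: "x \<in> \<Omega> \<Longrightarrow> (\<phi> t ^^ j) x \<in> \<Omega>"
  by (simp add: funpow_action action_closed t_closed)

lemma fixed_points_iff: "f \<in> fixed_points M P \<longleftrightarrow> f \<in> carrier M \<and> (\<forall>x\<in>\<Omega>. f (\<phi> t x) = f x)"
proof
  assume f: "f \<in> fixed_points M P"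
  have "act M t f = f" using f t_P by (simp add: fixed_points_def)
  then have "act M t f (\<phi> t x) = f (\<phi> t x)" for x by simp
  then have "f (\<phi> t x) = f x" if "x \<in> \<Omega>" for x
    using that action_inv(2)[OF t_closed that] action_t_closed[OF that] by (metis act_M)
  then show "f \<in> carrier M \<and> (\<forall>x\<in>\<Omega>. f (\<phi> t x) = f x)" using f by (simp add: fixed_points_def)
next
  assume f: "f \<in> carrier M \<and> (\<forall>x\<in>\<Omega>. f (\<phi> t x) = f x)"
  have pow: "f ((\<phi> t ^^ j) x) = f x" if "x \<in> \<Omega>" for j x
    using that f funpow_closed by (induction j) auto
  have "act M g f = f" if g: "g \<in> P" for g
  proof
    fix x
    obtain j :: nat where j: "g = t [^] j" using g by (auto simp: P_eq)
    have gG: "g \<in> carrier G" using g P_subset by auto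
    show "act M g f x = f x"
    proof (cases "x \<in> \<Omega>")
      case True
      then have y: "\<phi> (inv g) x \<in> \<Omega>" using gG by (simp add: action_closed)
      have "f (\<phi> g (\<phi> (inv g) x)) = f (\<phi> (inv g) x)" using pow[OF y, of j] y by (simp add: funpow_action j)
      then show ?thesis using True gG by (simp add: act_M action_inv)
    next
      case False
      then show ?thesis using f by (simp add: act_M carrier_M)
    qed
  qed
  then show "f \<in> fixed_points M P" using f by (simp add: fixed_points_def)
qed

lemma relative_trace_eq:
  assumes "v \<in> carrier M"
  shows "relative_trace G M {\<one>} P v = finsum M (\<lambda>g. act M g v) P"
proof -
  \<comment> \<open>Cosets of the trivial subgroup are singletons, so the choice of representatives
    in the trace is forced.\<close>
  have "g \<otimes> \<one> = g" if "g \<in> P" for g using that P_subset by auto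
  then have "lcosets\<^bsub>G\<lparr>carrier := P\<rparr>\<^esub> {\<one>} = (\<lambda>g. {g}) ` P"
    by (auto simp: LCOSETS_def l_coset_def)
  then have "relative_trace G M {\<one>} P v = finsum M (\<lambda>C. act M (SOME g. g \<in> C) v) ((\<lambda>g. {g}) ` P)"
    by (simp add: relative_trace_def)
  also have "\<dots> = finsum M (\<lambda>g. act M (SOME h. h \<in> {g}) v) P"
    using M.act_closed[OF _ assms] P_subset by (intro M.M.finsum_reindex) auto
  finally show ?thesis by simp
qed

lemma relative_trace_closed: "v \<in> carrier M \<Longrightarrow> relative_trace G M {\<one>} P v \<in> carrier M"
  unfolding relative_trace_eq using P_subset M.act_closed by (intro M.M.finsum_closed) auto

lemma relative_trace_apply:
  assumes v: "v \<in> carrier M" and x: "x \<in> \<Omega>"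
  shows "relative_trace G M {\<one>} P v x = (\<Sum>j<p. v ((\<phi> t ^^ j) x))"
proof -
  have "relative_trace G M {\<one>} P v x = (\<Sum>g\<in>P. act M g v x)"
    unfolding relative_trace_eq[OF v]
    by (rule linear_functional_finsum[OF linear_functional_eval M.module_axioms])
      (use P_subset M.act_closed[OF _ v] in auto)
  also have "\<dots> = (\<Sum>g\<in>P. v (\<phi> (inv g) x))" using x by (simp add: act_M)
  also have "\<dots> = (\<Sum>g\<in>P. v (\<phi> g x))"
    by (rule sum.reindex_bij_witness[where i = "\<lambda>g. inv g" and j = "\<lambda>g. inv g"])
      (use P_subset subgroup.m_inv_closed[OF P_subgroup] in auto)
  also have "\<dots> = (\<Sum>j<p. v ((\<phi> t ^^ j) x))"
    unfolding P_eq using x by (simp add: sum.reindex[OF inj_pow] funpow_action)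
  finally show ?thesis .
qed

text \<open>This turns out to be the space of all relative traces from proper subgroups, as
  \<open>span_traces\<close> shows.\<close>

definition W where
  "W = {f \<in> fixed_points M P. \<forall>x\<in>\<Omega>. \<phi> t x = x \<longrightarrow> f x = 0}"

text \<open>Moving along an orbit only shifts the cyclic summation index; at a fixed point the trace
  is \<open>p\<close> times a value, and here the characteristic enters.\<close>

lemma relative_trace_W:
  assumes v: "v \<in> carrier M"
  shows "relative_trace G M {\<one>} P v \<in> W"
proof -
  let ?f = "relative_trace G M {\<one>} P v"
  have "?f (\<phi> t x) = ?f x" if x: "x \<in> \<Omega>" for x
    using sum_shift_periodic[of "\<lambda>j. v ((\<phi> t ^^ j) x)" p] funpow_p[OF x]
    by (simp add: relative_trace_apply[OF v] x action_t_closed funpow_swap1)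
  moreover have "?f x = 0" if x: "x \<in> \<Omega>" "\<phi> t x = x" for x
  proof -
    have "(\<phi> t ^^ j) x = x" for j using x(2) by (induction j) auto
    then have "?f x = of_nat p * v x" by (simp add: relative_trace_apply[OF v x(1)])
    then show ?thesis using of_nat_CHAR[where ?'a = 'k] char by simp
  qed
  ultimately show ?thesis using relative_trace_closed[OF v] by (simp add: W_def fixed_points_iff)
qed

text \<open>\<open>f\<close> is the trace of its restriction to a transversal of the orbits of size
  \<open>p\<close>, since exactly one term of each orbit sum meets the transversal. At fixed points
  both sides are zero.\<close>

lemma W_trace:
  assumes f: "f \<in> W"
  shows "\<exists>v\<in>carrier M. f = relative_trace G M {\<one>} P v"
proof -
  let ?A = "{x \<in> \<Omega>. \<phi> t x \<noteq> x}"
  have fM: "f \<in> carrier M" and ft: "\<And>x. x \<in> \<Omega> \<Longrightarrow> f (\<phi> t x) = f x"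
    and f0: "\<And>x. x \<in> \<Omega> \<Longrightarrow> \<phi> t x = x \<Longrightarrow> f x = 0"
    using f by (auto simp: W_def fixed_points_iff)
  have pow: "f ((\<phi> t ^^ j) x) = f x" if "x \<in> \<Omega>" for j x
    using that ft funpow_closed by (induction j) auto
  have inv: "\<phi> t ` ?A \<subseteq> ?A"
    using action_t_closed inj_on_action[OF t_closed] by (auto dest: inj_onD)
  have "\<forall>x\<in>?A. (\<phi> t ^^ p) x = x" "\<forall>x\<in>?A. \<phi> t x \<noteq> x" using funpow_p by simp_all
  from fixed_point_free_transversal[OF prime_p _ inv this]
  obtain R where R: "R \<subseteq> ?A" "\<forall>x\<in>?A. \<exists>!j. j < p \<and> (\<phi> t ^^ j) x \<in> R"
    using finite_points by auto
  define v where "v x = (if x \<in> R then f x else 0)" for x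
  have vM: "v \<in> carrier M" using fM by (simp add: v_def carrier_M)
  have "f x = relative_trace G M {\<one>} P v x" for x
  proof (cases "x \<in> \<Omega>")
    case x: True
    have "(\<Sum>j<p. v ((\<phi> t ^^ j) x)) = f x"
    proof (cases "\<phi> t x = x")
      case True
      then have "(\<phi> t ^^ j) x = x" for j by (induction j) auto
      then show ?thesis using f0[OF x True] by (simp add: v_def)
    next
      case False
      then obtain j where j: "j < p" "(\<phi> t ^^ j) x \<in> R" "\<And>k. k < p \<Longrightarrow> (\<phi> t ^^ k) x \<in> R \<Longrightarrow> k = j"
        using R(2) x by blast
      have "(\<Sum>j<p. v ((\<phi> t ^^ j) x)) = (\<Sum>k\<in>{j}. v ((\<phi> t ^^ k) x))"
      proof (rule sum.mono_neutral_right)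
        show "\<forall>k\<in>{..<p} - {j}. v ((\<phi> t ^^ k) x) = 0" using j(3) by (auto simp: v_def)
      qed (use j(1) in auto)
      then show ?thesis using j(2) pow[OF x, of j] by (simp add: v_def)
    qed
    then show ?thesis using relative_trace_apply[OF vM x] by simp
  next
    case False
    then show ?thesis using fM relative_trace_closed[OF vM] by (simp add: carrier_M)
  qed
  then show ?thesis using vM by blast
qed

lemma submodule_fixed_points: "submodule (class_ring :: 'k ring) (fixed_points M P) M"
  by unfold_locales (auto simp: fixed_points_iff carrier_M M_add M_smult M_zero)

lemma submodule_W: "submodule (class_ring :: 'k ring) W M"
  by unfold_locales (auto simp: W_def fixed_points_iff carrier_M M_add M_smult M_zero)

lemma span_traces:
  "LinearCombinations.module.span (class_ring :: 'k ring) M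
     (\<Union>Q\<in>{Q. subgroup Q G \<and> Q \<subset> P}. relative_trace G M Q P ` fixed_points M Q) = W"
proof -
  have "{Q. subgroup Q G \<and> Q \<subset> P} = {{\<one>}}"
  proof (intro equalityI subsetI)
    fix Q assume "Q \<in> {Q. subgroup Q G \<and> Q \<subset> P}"
    then show "Q \<in> {{\<one>}}" using proper_subgroup_of_prime_order[OF P_subgroup, of Q] prime_p by (simp add: card_P)
  next
    fix Q assume "Q \<in> {{\<one>}}"
    moreover have "{\<one>} \<noteq> P" using t_P t_neq_one by auto
    ultimately show "Q \<in> {Q. subgroup Q G \<and> Q \<subset> P}"
      using triv_subgroup subgroup.one_closed[OF P_subgroup] by auto
  qed
  moreover have "fixed_points M {\<one>} = carrier M" using M.act_one by (auto simp: fixed_points_def)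
  ultimately have eq: "(\<Union>Q\<in>{Q. subgroup Q G \<and> Q \<subset> P}. relative_trace G M Q P ` fixed_points M Q) =
      relative_trace G M {\<one>} P ` carrier M" by simp
  also have "\<dots> = W" using relative_trace_W W_trace by blast
  finally have eq: "(\<Union>Q\<in>{Q. subgroup Q G \<and> Q \<subset> P}. relative_trace G M Q P ` fixed_points M Q) = W" .
  have "W \<subseteq> carrier M" by (auto simp: W_def fixed_points_iff)
  then show ?thesis unfolding eq
    using M.span_is_subset[OF subset_refl submodule_W] M.in_own_span by blast
qed

abbreviation MP where "MP \<equiv> M\<lparr>carrier := fixed_points M P\<rparr>"

lemma quotient_MP: "quotient_space MP W"
proof -
  have "module (class_ring :: 'k ring) MP" by (rule M.submodule_is_module[OF submodule_fixed_points])
  then interpret MP: Module.module "class_ring :: 'k ring" MP .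
  show ?thesis
    by unfold_locales (auto simp: W_def fixed_points_iff carrier_M M_add M_smult M_zero)
qed

text \<open>Only the linear structure is wanted. The fixed points of \<open>P\<close> need not be
  stable under \<open>G\<close>, so \<open>MP\<close> is viewed as a module for the trivial group to
  make \<open>gmodule_quotient_gmodule\<close> applicable.\<close>

lemma vectorspace_brauer_quotient: "vectorspace (class_ring :: 'k ring) (quotient_gmodule MP W)"
proof -
  interpret quotient_space MP W by (rule quotient_MP)
  have "gmodule (G\<lparr>carrier := {\<one>}\<rparr>) MP"
  proof (intro gmodule.intro gmodule_axioms.intro)
    show "group (G\<lparr>carrier := {\<one>}\<rparr>)" by (rule subgroup_imp_group[OF triv_subgroup])
    show "vectorspace (class_ring :: 'k ring) MP" by (rule vectorspace_class_ringI[OF module_axioms])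
    have one: "act M \<one> v = v" if "v \<in> fixed_points M P" for v
      using that M.act_one by (simp add: fixed_points_def)
    show "act MP g \<in> module_hom (class_ring :: 'k ring) MP MP" if "g \<in> carrier (G\<lparr>carrier := {\<one>}\<rparr>)" for g
      using that one smult_closed M.a_closed unfolding LinearCombinations.module_hom_def by auto
    show "act MP \<one>\<^bsub>G\<lparr>carrier := {\<one>}\<rparr>\<^esub> v = v" if "v \<in> carrier MP" for v
      using that one by simp
    show "act MP (g \<otimes>\<^bsub>G\<lparr>carrier := {\<one>}\<rparr>\<^esub> h) v = act MP g (act MP h v)"
      if "g \<in> carrier (G\<lparr>carrier := {\<one>}\<rparr>)" "h \<in> carrier (G\<lparr>carrier := {\<one>}\<rparr>)" "v \<in> carrier MP" for g h v
      using that one by simp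
  qed
  then have "gmodule (G\<lparr>carrier := {\<one>}\<rparr>) (quotient_gmodule MP W)"
    using W.submodule_axioms
    by (rule gmodule_quotient_gmodule) (auto simp: W_def fixed_points_def M.act_one)
  then show ?thesis by (simp add: gmodule_def)
qed

text \<open>Evaluations at fixed points kill \<open>W\<close>, and an invariant function on which
  all of them vanish is in \<open>W\<close>; hence they descend to coordinates dual to the classes
  of the fixed points.\<close>

theorem dim_brauer_quotient:
  "vectorspace.dim (class_ring :: 'k ring) (brauer_quotient G M (generate G {t})) = card {x \<in> \<Omega>. \<phi> t x = x}"
proof -
  interpret Q: quotient_space MP W by (rule quotient_MP)
  interpret BQ: vectorspace "class_ring :: 'k ring" "quotient_gmodule MP W" by (rule vectorspace_brauer_quotient)
  let ?I = "{x \<in> \<Omega>. \<phi> t x = x}"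
  have eval: "linear_functional MP (\<lambda>f. f x)" for x
    by (simp add: linear_functional_def M_add M_smult)
  have W0: "w x = 0" if "x \<in> ?I" "w \<in> W" for x w using that by (simp add: W_def)
  have point: "point x \<in> carrier MP" if "x \<in> ?I" for x
  proof -
    have "point x (\<phi> t y) = (point x y :: 'k)" if "y \<in> \<Omega>" for y
      using that \<open>x \<in> ?I\<close> inj_onD[OF inj_on_action[OF t_closed], of x y] by (auto simp: point_def)
    then show ?thesis using that point_M by (simp add: fixed_points_iff)
  qed
  have desc: "Q.descend (\<lambda>f. f x) (Q.proj f) = f x" if "x \<in> ?I" "f \<in> carrier MP" for x f
    using that W0 by (intro Q.descend_proj eval) auto
  have "coordinates (quotient_gmodule MP W) ?I (\<lambda>x. Q.proj (point x)) (\<lambda>x. Q.descend (\<lambda>f. f x))"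
  proof unfold_locales
    show "finite ?I" using finite_points by simp
    show "Q.proj (point x) \<in> carrier (quotient_gmodule MP W)" if "x \<in> ?I" for x
      using point[OF that] by (simp only: Q.carrier_quotient imageI)
    show "linear_functional (quotient_gmodule MP W) (Q.descend (\<lambda>f. f x))" if "x \<in> ?I" for x
      using eval W0[OF that] by (rule Q.linear_functional_descend)
    show "Q.descend (\<lambda>f. f x) (Q.proj (point y)) = (if x = y then 1 else 0)" if "x \<in> ?I" "y \<in> ?I" for x y
      using desc[OF that(1) point[OF that(2)]] by (simp add: point_def)
    show "v = \<zero>\<^bsub>quotient_gmodule MP W\<^esub>" if "v \<in> carrier (quotient_gmodule MP W)"
      and zero: "\<And>x. x \<in> ?I \<Longrightarrow> Q.descend (\<lambda>f. f x) v = 0" for v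
    proof -
      obtain f where f: "f \<in> carrier MP" "v = Q.proj f"
        using \<open>v \<in> carrier _\<close> unfolding Q.carrier_quotient by blast
      have "f x = 0" if "x \<in> ?I" for x using zero[OF that] desc[OF that f(1)] f(2) by simp
      then have "f \<in> W" using f(1) by (simp add: W_def)
      then show ?thesis using Q.proj_eq_zero_iff[OF f(1)] f(2) by simp
    qed
  qed
  then have "BQ.dim = card ?I" by (rule coordinates.dim_eq_card)
  then show ?thesis
    unfolding brauer_quotient_def P_def[symmetric] span_traces .
qed

end

section \<open>Tabloids\<close>

lemma finite_young_diagram: "finite (young_diagram lam)"
proof -
  have "young_row lam i = Pair i ` {..<lam ! i}" for i by (auto simp: young_row_def)
  then show ?thesis by (simp add: young_diagram_def)
qed

lemma young_row_subset: "i < length lam \<Longrightarrow> young_row lam i \<subseteq> young_diagram lam"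
  by (auto simp: young_diagram_def)

lemma finite_tableaux: "finite (tableaux n lam)"
proof (rule finite_subset)
  show "tableaux n lam \<subseteq> young_diagram lam \<rightarrow>\<^sub>E {1..n}"
    by (auto simp: tableaux_def PiE_def bij_betw_def)
  show "finite (young_diagram lam \<rightarrow>\<^sub>E {1..n})" by (simp add: finite_PiE finite_young_diagram)
qed

lemma finite_tabloids: "finite (tabloids n lam)"
proof (rule finite_subset)
  show "tabloids n lam \<subseteq> Pow (tableaux n lam)"
    by (auto simp: tabloids_def quotient_def row_equiv_def)
qed (simp add: finite_tableaux)

lemma compose_tableaux:
  assumes "\<sigma> permutes {1..n}" "t \<in> tableaux n lam"
  shows "compose (young_diagram lam) \<sigma> t \<in> tableaux n lam"
proof -
  have "bij_betw (\<sigma> \<circ> t) (young_diagram lam) {1..n}"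
    using assms permutes_imp_bij by (auto simp: tableaux_def intro: bij_betw_trans)
  then have "bij_betw (compose (young_diagram lam) \<sigma> t) (young_diagram lam) {1..n}"
    by (rule bij_betw_cong[THEN iffD1, rotated]) (simp add: compose_def)
  then show ?thesis by (simp add: tableaux_def)
qed

lemma compose_row_equiv:
  assumes "\<sigma> permutes {1..n}" "(s, t) \<in> row_equiv n lam"
  shows "(compose (young_diagram lam) \<sigma> s, compose (young_diagram lam) \<sigma> t) \<in> row_equiv n lam"
proof -
  have "compose (young_diagram lam) \<sigma> u ` young_row lam i = \<sigma> ` u ` young_row lam i"
    if "i < length lam" for u i
    unfolding image_image using young_row_subset[OF that] by (intro image_cong) (auto simp: compose_def)
  then show ?thesis using assms by (simp add: row_equiv_def compose_tableaux)
qed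

lemma compose_tableaux_id: "t \<in> tableaux n lam \<Longrightarrow> compose (young_diagram lam) id t = t"
  by (auto simp: tableaux_def compose_def extensional_def fun_eq_iff)

lemma compose_comp:
  "compose (young_diagram lam) (\<sigma> \<circ> \<tau>) t = compose (young_diagram lam) \<sigma> (compose (young_diagram lam) \<tau> t)"
  by (auto simp: compose_def fun_eq_iff)

lemma tabloid_subset: "T \<in> tabloids n lam \<Longrightarrow> T \<subseteq> tableaux n lam"
  by (auto simp: tabloids_def quotient_def row_equiv_def)

text \<open>The image of a class under \<open>\<sigma>\<close> obviously lies in one class; that it
  fills this class is seen by applying the inverse permutation.\<close>

lemma tabloid_act_class:
  assumes \<sigma>: "\<sigma> permutes {1..n}" and t: "t \<in> tableaux n lam"
  shows "tabloid_act lam \<sigma> (row_equiv n lam `` {t}) = row_equiv n lam `` {compose (young_diagram lam) \<sigma> t}"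
proof
  show "tabloid_act lam \<sigma> (row_equiv n lam `` {t}) \<subseteq> row_equiv n lam `` {compose (young_diagram lam) \<sigma> t}"
    using compose_row_equiv[OF \<sigma>] by (auto simp: tabloid_act_def)
  show "row_equiv n lam `` {compose (young_diagram lam) \<sigma> t} \<subseteq> tabloid_act lam \<sigma> (row_equiv n lam `` {t})"
  proof
    let ?\<tau> = "inv_into UNIV \<sigma>"
    fix u assume "u \<in> row_equiv n lam `` {compose (young_diagram lam) \<sigma> t}"
    then have u: "(compose (young_diagram lam) \<sigma> t, u) \<in> row_equiv n lam" by simp
    then have uT: "u \<in> tableaux n lam" by (simp add: row_equiv_def)
    have "compose (young_diagram lam) ?\<tau> (compose (young_diagram lam) \<sigma> t) = t"
      using t by (simp add: compose_comp[symmetric] permutes_inv_o[OF \<sigma>] compose_tableaux_id)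
    then have "(t, compose (young_diagram lam) ?\<tau> u) \<in> row_equiv n lam"
      using compose_row_equiv[OF permutes_inv[OF \<sigma>] u] by simp
    moreover have "u = compose (young_diagram lam) \<sigma> (compose (young_diagram lam) ?\<tau> u)"
      using uT by (simp add: compose_comp[symmetric] permutes_inv_o[OF \<sigma>] compose_tableaux_id)
    ultimately show "u \<in> tabloid_act lam \<sigma> (row_equiv n lam `` {t})" by (auto simp: tabloid_act_def)
  qed
qed

lemma tabloid_act_closed:
  assumes "\<sigma> permutes {1..n}" "T \<in> tabloids n lam"
  shows "tabloid_act lam \<sigma> T \<in> tabloids n lam"
proof -
  obtain t where "t \<in> tableaux n lam" "T = row_equiv n lam `` {t}"
    using assms(2) unfolding tabloids_def by (rule quotientE)
  then show ?thesis
    using assms(1) by (simp add: tabloid_act_class tabloids_def quotientI compose_tableaux)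
qed

lemma permutation_gmodule_tabloids:
  "permutation_gmodule (sym_group n) (tabloids n lam) (tabloid_act lam) (young_permutation_module n lam)"
proof (intro permutation_gmodule.intro permutation_gmodule_axioms.intro)
  show "group (sym_group n)" by (rule sym_group_is_group)
  show "finite (tabloids n lam)" by (rule finite_tabloids)
  show "tabloid_act lam \<sigma> T \<in> tabloids n lam" if "\<sigma> \<in> carrier (sym_group n)" "T \<in> tabloids n lam" for \<sigma> T
    using that by (simp add: sym_group_carrier tabloid_act_closed)
  show "tabloid_act lam \<one>\<^bsub>sym_group n\<^esub> T = T" if "T \<in> tabloids n lam" for T
  proof -
    have "compose (young_diagram lam) id ` T = (\<lambda>t. t) ` T"
      using tabloid_subset[OF that] compose_tableaux_id by (intro image_cong) auto
    then show ?thesis by (simp add: tabloid_act_def sym_group_one)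
  qed
  show "tabloid_act lam (\<sigma> \<otimes>\<^bsub>sym_group n\<^esub> \<tau>) T = tabloid_act lam \<sigma> (tabloid_act lam \<tau> T)" for \<sigma> \<tau> T
    by (simp add: tabloid_act_def sym_group_mult compose_comp image_image)
  show "young_permutation_module n lam = permutation_module (sym_group n) (tabloids n lam) (tabloid_act lam)"
    by (rule young_permutation_module_def)
qed

lemma finite_carrier_sym_group: "finite (carrier (sym_group n))"
  by (simp add: sym_group_def finite_permutations)

lemma sym_group_pow: "\<sigma> [^]\<^bsub>sym_group n\<^esub> (k :: nat) = \<sigma> ^^ k"
  by (induction k) (simp_all add: nat_pow_def sym_group_one sym_group_mult funpow_Suc_right del: funpow.simps(2))

theorem proposition3p10:
  fixes n p a b :: nat and lam :: "nat list"
    and M :: "'k::field young_module" and m mbar :: "nat \<Rightarrow> nat"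
  assumes "n > 0" and "p > 0" and "CHAR('k) = p"
    and "is_partition lam n" and "a > 1" and "b = n div p"
    and "M = young_permutation_module n lam"
    and "\<And>i. m i = vectorspace.dim (class_ring :: 'k ring)
                     (brauer_quotient (sym_group n) M (p_cycle_group n p i))"
    and "\<And>i. mbar i = vectorspace.dim (class_ring :: 'k ring) M - m i"
    and "a \<le> vectorspace.dim (class_ring :: 'k ring) M"
  shows "projective_gmodule (sym_group n) (exterior_power (sym_group n) a M) \<longleftrightarrow>
    (\<forall>i\<in>{1..b}. \<forall>x y. a = x + p * y \<longrightarrow> m i < x \<or> mbar i < p * y)"
proof -
  let ?G = "sym_group n" and ?\<Omega> = "tabloids n lam" and ?\<phi> = "tabloid_act lam" and ?t = "p_cycles p"
  have p: "prime p" using assms(2,3) prime_CHAR_semidom by metis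
  interpret permutation_gmodule ?G ?\<Omega> ?\<phi> M
    unfolding assms(7) by (rule permutation_gmodule_tabloids)
  interpret E: exterior_permutation_module ?G ?\<Omega> ?\<phi> M a ..
  interpret X: monomial_gmodule ?G E.Lambda E.subsets
    "\<lambda>S. E.Q.proj (point (map point (E.enum S)))" "\<lambda>S. E.Q.descend (E.coord S)" "\<lambda>g S. ?\<phi> g ` S"
    by (rule E.monomial_exterior_power[OF finite_carrier_sym_group])
  have t: "?t i \<in> carrier ?G" "?t i \<noteq> \<one>\<^bsub>?G\<^esub>" "?t i [^]\<^bsub>?G\<^esub> p = \<one>\<^bsub>?G\<^esub>" if i: "i \<in> {1..b}" for i
  proof -
    have "i * p \<le> n" using i assms(2) by (simp add: assms(6) less_eq_div_iff_mult_less_eq)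
    then have "?t i permutes {1..n}" by (intro permutes_subset[OF p_cycles_permutes]) auto
    then show "?t i \<in> carrier ?G" by (simp add: sym_group_carrier)
    show "?t i \<noteq> \<one>\<^bsub>?G\<^esub>" using i p_cycles_neq_id[of i p] prime_gt_1_nat[OF p] by (simp add: sym_group_one)
    show "?t i [^]\<^bsub>?G\<^esub> p = \<one>\<^bsub>?G\<^esub>" by (simp add: sym_group_pow p_cycles_funpow sym_group_one)
  qed
  \<comment> \<open>The right side is the negation, for this \<open>i\<close>, of the condition in
    the theorem; \<open>mbar i\<close> becomes the number of tabloids moved by
    \<open>?t i\<close>.\<close>
  have fixed_iff: "(\<exists>S\<in>E.subsets. ?\<phi> (?t i) ` S = S) \<longleftrightarrow>
      (\<exists>x y. a = x + p * y \<and> x \<le> m i \<and> p * y \<le> mbar i)" if i: "i \<in> {1..b}" for i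
  proof -
    interpret B: prime_order_action ?G ?\<Omega> ?\<phi> M "?t i" p
      by unfold_locales (use t[OF i] p assms(3) in auto)
    have m: "m i = card {x \<in> ?\<Omega>. ?\<phi> (?t i) x = x}"
      using B.dim_brauer_quotient by (simp add: assms(8) p_cycle_group_def)
    have "?\<phi> (?t i) ` ?\<Omega> \<subseteq> ?\<Omega>" using B.action_t_closed by auto
    from invariant_subset_of_card_iff[OF p finite_points this B.funpow_p, of a]
    show ?thesis unfolding assms(9) dim_M m E.subsets_def by auto
  qed
  have conj: "(\<exists>g\<in>carrier ?G. g \<noteq> \<one>\<^bsub>?G\<^esub> \<and> g [^]\<^bsub>?G\<^esub> p = \<one>\<^bsub>?G\<^esub> \<and> (\<exists>S\<in>E.subsets. ?\<phi> g ` S = S)) \<longleftrightarrow>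
      (\<exists>i\<in>{1..b}. \<exists>S\<in>E.subsets. ?\<phi> (?t i) ` S = S)"
  proof
    assume "\<exists>g\<in>carrier ?G. g \<noteq> \<one>\<^bsub>?G\<^esub> \<and> g [^]\<^bsub>?G\<^esub> p = \<one>\<^bsub>?G\<^esub> \<and> (\<exists>S\<in>E.subsets. ?\<phi> g ` S = S)"
    then obtain g S where g: "g \<in> carrier ?G" "g \<noteq> id" "g ^^ p = id" and S: "S \<in> E.subsets" "?\<phi> g ` S = S"
      by (auto simp: sym_group_pow sym_group_one)
    then obtain i h where i: "1 \<le> i" "i * p \<le> n" and h: "h permutes {1..n}" "g \<circ> h = h \<circ> ?t i"
      using prime_period_conj_p_cycles[OF p, of g n] by (auto simp: sym_group_carrier)
    have ib: "i \<in> {1..b}" using i assms(2) by (simp add: assms(6) less_eq_div_iff_mult_less_eq)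
    have hG: "h \<in> carrier ?G" using h(1) by (simp add: sym_group_carrier)
    have gh: "g \<otimes>\<^bsub>?G\<^esub> h = h \<otimes>\<^bsub>?G\<^esub> ?t i" using h(2) by (simp add: sym_group_mult)
    \<comment> \<open>\<open>?t i\<close> is the conjugate \<open>k g h\<close> of \<open>g\<close>
      with \<open>k\<close> inverse to \<open>h\<close>, so it stabilises the image under
      \<open>k\<close> of the subset \<open>S\<close> stabilised by \<open>g\<close>.\<close>
    define k where "k = inv\<^bsub>?G\<^esub> h"
    have kG: "k \<in> carrier ?G" unfolding k_def using hG by (rule inv_closed)
    have S': "?\<phi> k ` S \<in> E.subsets" using kG S(1) by (rule E.image_subset)
    have "?t i = k \<otimes>\<^bsub>?G\<^esub> (g \<otimes>\<^bsub>?G\<^esub> h)"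
      unfolding gh k_def by (rule inv_solve_left[THEN iffD2]) (use hG t(1)[OF ib] m_closed in auto)
    then have "?\<phi> (?t i) ` ?\<phi> k ` S = ?\<phi> k ` ?\<phi> g ` ?\<phi> h ` ?\<phi> k ` S"
      by (simp only: X.action_mult[OF kG m_closed[OF g(1) hG] S'] X.action_mult[OF g(1) hG S'])
    also have "\<dots> = ?\<phi> k ` S" unfolding k_def X.action_inv(1)[OF hG S(1)] S(2) ..
    finally show "\<exists>i\<in>{1..b}. \<exists>S\<in>E.subsets. ?\<phi> (?t i) ` S = S" using ib S' by blast
  next
    assume "\<exists>i\<in>{1..b}. \<exists>S\<in>E.subsets. ?\<phi> (?t i) ` S = S"
    then show "\<exists>g\<in>carrier ?G. g \<noteq> \<one>\<^bsub>?G\<^esub> \<and> g [^]\<^bsub>?G\<^esub> p = \<one>\<^bsub>?G\<^esub> \<and> (\<exists>S\<in>E.subsets. ?\<phi> g ` S = S)"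
      using t by blast
  qed
  have "projective_gmodule ?G E.Lambda \<longleftrightarrow> \<not> (\<exists>i\<in>{1..b}. \<exists>S\<in>E.subsets. ?\<phi> (?t i) ` S = S)"
    using X.projective_iff p conj unfolding assms(3) by simp
  also have "\<dots> \<longleftrightarrow> (\<forall>i\<in>{1..b}. \<forall>x y. a = x + p * y \<longrightarrow> m i < x \<or> mbar i < p * y)"
    using fixed_iff by (metis not_le)
  finally show ?thesis .
qed

end
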